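(* Consider the linear system with multiple time-varying input delays $$\dot{x}(t)=Ax(t)+\sum_{i=1}^{q}B_{i}u(t-\tau_{i}(t)),\qquad y(t)=Cx(t),\qquad t\ge 0,$$ where $x\in\mathbf{R}^{n}$, $u\in\mathbf{R}^{m}$, $y\in\mathbf{R}^{p}$, and $A\in\mathbf{R}^{n\times n}$, $B_{i}\in\mathbf{R}^{n\times m}$ ($i=1,\ldots,q$), $C\in\mathbf{R}^{p\times n}$ are constant matrices. Let $B=B_{1}+B_{2}+\cdots+B_{q}$. Assume that $(A,B)$ is controllable and that all the eigenvalues of $A$ are zero. Assume that there exist constants $\bar{\tau}>0$ and $d\in[0,1)$ (not used in the controller) such that $$0\leq\tau_{i}(t)\leq\bar{\tau},\qquad \dot{\tau}_{i}(t)\leq d,\qquad \forall t\geq 0,\ i=1,\ldots,q.$$ Assume further that $(A,C)$ is observable, and let $L\in\mathbf{R}^{n\times p}$ be chosen such that $A-LC$ is Hurwitz. Let $\gamma_{0}>0$, $\omega>0$ and $\mu\in(0,1)$ be arbitrary constants, and set $$\gamma(t)=\frac{\gamma_{0}}{(\omega t+1)^{\mu}},\qquad t\in[0,\infty).$$ Then the observer-based controller $$\dot{\xi}(t)=A\xi(t)+L(y(t)-C\xi(t)),\qquad u(t)=-B^{\mathrm{T}}P(\gamma(t))\xi(t),\qquad t\geq 0,$$ with $\xi\in\mathbf{R}^n$, where for each $\gamma>0$, $P(\gamma)$ is the unique positive definite solution to the parametric Lyapunov equation $A^{\mathrm{T}}P+PA-PBB^{\mathrm{T}}P=-\gamma P$,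 asymptotically stabilizes the system; that is, the zero solution of the closed-loop system (with state $(x,\xi)$) is asymptotically stable.
   Context: Under the stated hypotheses on $(A,B)$, the parametric Lyapunov equation $A^{\mathrm{T}}P+PA-PBB^{\mathrm{T}}P=-\gamma P$ has a unique positive definite solution $P(\gamma)$ for every $\gamma>0$. The delays $\tau_i:[0,\infty)\to\mathbf{R}$ are differentiable. The initial condition is $x(0)=x_{0}\in\mathbf{R}^n$, $\xi(0)=\xi_0\in\mathbf{R}^n$ and $u(\theta)=u_{0}(\theta)$ for $\theta\in[-\bar{\tau},0)$, with $u_0$ bounded (and measurable); the feedback law defines $u(t)$ for $t\ge 0$. Asymptotic stability of the zero solution of the closed-loop system means: (i) (Lyapunov stability) for every $\varepsilon>0$ there exists $\delta_{0}>0$ such that $\|x_{0}\|+\|\xi_0\|+\sup_{\theta\in[-\bar{\tau},0)}\|u_{0}(\theta)\|\leq\delta_{0}$ implies $\|x(t)\|+\|\xi(t)\|\leq\varepsilon$ for all $t\geq 0$; and (ii) (attractivity) $\lim_{t\to\infty}(\|x(t)\|+\|\xi(t)\|)=0$ for every initial condition. A matrix is Hurwitz if all its eigenvalues have negative real part. *)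

theory Defs
  imports "HOL-Analysis.Analysis"
begin

definition eigenvalue_of :: "real^'n^'n \<Rightarrow> complex \<Rightarrow> bool" where
  "eigenvalue_of M l \<longleftrightarrow>
     (\<exists>v::complex^'n. v \<noteq> 0 \<and> (\<chi> i j. complex_of_real (M $ i $ j)) *v v = l *s v)"

definition hurwitz :: "real^'n^'n \<Rightarrow> bool" where
  "hurwitz M \<longleftrightarrow> (\<forall>l. eigenvalue_of M l \<longrightarrow> Re l < 0)"

definition positive_definite :: "real^'n^'n \<Rightarrow> bool" where
  "positive_definite P \<longleftrightarrow> transpose P = P \<and> (\<forall>v. v \<noteq> 0 \<longrightarrow> v \<bullet> (P *v v) > 0)"

text \<open>
  Solutions of differential equations with a merely integrable input are understood in the
  sense of Caratheodory: the equation holds in integrated form.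

  The pair \<open>(A, B)\<close> is controllable if the system \<open>x' = A x + B u\<close> can be steered from
  every state to every other state in finite time.
\<close>

definition controllable :: "real^'n^'n \<Rightarrow> real^'m^'n \<Rightarrow> bool" where
  "controllable A B \<longleftrightarrow>
     (\<forall>a b. \<exists>T>0. \<exists>(u::real \<Rightarrow> real^'m) (x::real \<Rightarrow> real^'n).
        u absolutely_integrable_on {0..T} \<and> x 0 = a \<and> x T = b \<and>
        (\<forall>t\<in>{0..T}. ((\<lambda>s. A *v x s + B *v u s) has_integral (x t - x 0)) {0..t}))"

text \<open>
  The pair \<open>(A, C)\<close> is observable if the output \<open>y = C x\<close> of \<open>x' = A x\<close> on some finite
  time interval determines the initial state.
\<close>

definition observable :: "real^'n^'n \<Rightarrow> real^'n^'p \<Rightarrow> bool" where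
  "observable A C \<longleftrightarrow>
     (\<exists>T>0. \<forall>(x::real \<Rightarrow> real^'n) (z::real \<Rightarrow> real^'n).
        (\<forall>t\<in>{0..T}. (x has_vector_derivative A *v x t) (at t within {0..T})) \<longrightarrow>
        (\<forall>t\<in>{0..T}. (z has_vector_derivative A *v z t) (at t within {0..T})) \<longrightarrow>
        (\<forall>t\<in>{0..T}. C *v x t = C *v z t) \<longrightarrow> x 0 = z 0)"

definition parametric_lyapunov_solution ::
  "real^'n^'n \<Rightarrow> real^'m^'n \<Rightarrow> real \<Rightarrow> real^'n^'n \<Rightarrow> bool" where
  "parametric_lyapunov_solution A B g P \<longleftrightarrow>
     positive_definite P \<and>
     transpose A ** P + P ** A - P ** B ** transpose B ** P = - (g *\<^sub>R P)"

text \<open>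
  Trajectories \<open>(x, \<xi>)\<close> of the plant \<open>x' t = A (x t) + (\<Sum>i. B i (u (t - \<tau> i t)))\<close>, \<open>y = C x\<close>,
  with observer gain \<open>L\<close> and feedback \<open>u t = K t (\<xi> t)\<close> for \<open>t \<ge> 0\<close>; \<open>u0\<close> is the input
  before time \<open>0\<close>, and the initial states are \<open>x 0\<close> and \<open>\<xi> 0\<close>. As \<open>u0\<close> is only measurable,
  the plant equation is required in integrated form; the observer is driven by the
  continuous \<open>x\<close>, so its equation holds pointwise.
\<close>

definition closed_loop_solution ::
  "real^'n^'n \<Rightarrow> nat \<Rightarrow> (nat \<Rightarrow> real^'m^'n) \<Rightarrow> real^'n^'p \<Rightarrow> real^'p^'n \<Rightarrow>
   (nat \<Rightarrow> real \<Rightarrow> real) \<Rightarrow> (real \<Rightarrow> real^'n^'m) \<Rightarrow>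
   (real \<Rightarrow> real^'m) \<Rightarrow> (real \<Rightarrow> real^'n) \<Rightarrow> (real \<Rightarrow> real^'n) \<Rightarrow> bool" where
  "closed_loop_solution A q B C L \<tau> K u0 x \<xi> \<longleftrightarrow>
     (let u = (\<lambda>t. if t < 0 then u0 t else K t *v \<xi> t) in
       (\<forall>t\<ge>0. ((\<lambda>s. A *v x s + (\<Sum>i=1..q. B i *v u (s - \<tau> i s)))
                  has_integral (x t - x 0)) {0..t}) \<and>
       (\<forall>t\<ge>0. (\<xi> has_vector_derivative A *v \<xi> t + L *v (C *v x t - C *v \<xi> t))
                  (at t within {0..})))"

definition admissible_history :: "real \<Rightarrow> (real \<Rightarrow> real^'m) \<Rightarrow> bool" where
  "admissible_history r u0 \<longleftrightarrow>
     u0 \<in> borel_measurable (lebesgue_on {-r..<0}) \<and> bounded (u0 ` {-r..<0})"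

text \<open>
  Asymptotic stability of the zero solution: \<open>sol u0 x \<xi>\<close> says that \<open>(x, \<xi>)\<close> is a trajectory
  with input history \<open>u0\<close> on \<open>[-r, 0)\<close>.
\<close>

definition asymptotically_stable ::
  "real \<Rightarrow> ((real \<Rightarrow> real^'m) \<Rightarrow> (real \<Rightarrow> real^'n) \<Rightarrow> (real \<Rightarrow> real^'n) \<Rightarrow> bool) \<Rightarrow> bool" where
  "asymptotically_stable r sol \<longleftrightarrow>
     (\<forall>\<epsilon>>0. \<exists>\<delta>>0. \<forall>u0 x \<xi>. admissible_history r u0 \<longrightarrow> sol u0 x \<xi> \<longrightarrow>
        norm (x 0) + norm (\<xi> 0) + (SUP \<theta>\<in>{-r..<0}. norm (u0 \<theta>)) \<le> \<delta> \<longrightarrow>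
        (\<forall>t\<ge>0. norm (x t) + norm (\<xi> t) \<le> \<epsilon>)) \<and>
     (\<forall>u0 x \<xi>. admissible_history r u0 \<longrightarrow> sol u0 x \<xi> \<longrightarrow>
        ((\<lambda>t. norm (x t) + norm (\<xi> t)) \<longlongrightarrow> 0) at_top)"

end

theory Submission
  imports Defs "HOL-Computational_Algebra.Fundamental_Theorem_Algebra" "HOL-Real_Asymp.Real_Asymp"
begin

text \<open>
  Put \<open>e = x - \<xi>\<close>, \<open>V = x\<^sup>T P(\<gamma>) x\<close> and \<open>E = e\<^sup>T Q e\<close> with a Lyapunov matrix \<open>Q\<close> of \<open>A - L C\<close>. As
  \<open>A\<close> is nilpotent and \<open>(A, B)\<close> controllable, \<open>P(\<gamma>) \<rightarrow> 0\<close>, \<open>\<bar>B\<^sup>T P v\<bar>\<^sup>2 = O(\<gamma>) v\<^sup>T P v\<close>, \<open>(A v)\<^sup>T P (A v) = O(\<gamma>\<^sup>2) v\<^sup>T P v\<close> and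
  \<open>dP/d\<gamma> = O(1/\<gamma>) P\<close> as \<open>\<gamma> \<rightarrow> 0\<close>. Hence the input is of size \<open>sqrt (\<gamma> V)\<close>, the estimation error follows it, and
  the delays perturb the nominal decay rate \<open>\<gamma>\<close> of \<open>V\<close> only by \<open>o(\<gamma>)\<close>. A first-crossing argument shows that
  \<open>V \<le> k \<gamma>\<^sup>m\<close> and \<open>E \<le> \<kappa> k \<gamma>\<^sup>m\<^sup>+\<^sup>1\<close> persist from some time on, for any fixed \<open>m\<close>: these barriers decrease at a
  relative rate \<open>O(-\<gamma>'/\<gamma>) = o(\<gamma>)\<close>, which is slower than the decay. Since \<open>P(\<gamma>)\<close> is bounded below by a power of
  \<open>\<gamma>\<close>, the state tends to zero.
\<close>

section \<open>Spectrum and Lyapunov functions\<close>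

text \<open>The observer has no copy of the input, so
  \<open>e' = (A - L C) e + (\<Sum>i. B_i u(t - \<tau>_i))\<close> is forced by the full input and
  not by a mere mismatch. Hence \<open>E\<close> follows \<gamma> V, which explains the extra power
  of \<gamma> in its barrier. Conversely \<open>e\<close> enters the feedback through
  \<open>B^T P e\<close>, of size \<gamma> sqrt V, the same order as the change of the input over
  one delay. Because of this mutual forcing both barriers are kept in one crossing argument. The
  obstacle is that the sharp bound O(\<gamma>) on the squared feedback holds for the sum
  \<open>B\<close>; a single \<open>B_i\<close> is handled by |P v|^2 \<le> |P| v^T P v. The
  mismatch therefore costs sqrt |P| \<gamma> V, and this is o(\<gamma>) V because P(\<gamma>) tends
  to 0. The delayed terms require bounds on V and E over a whole window before the current time. The
  barriers supply them: they hold at all earlier times and vary over one delay by a bounded factor.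
  Constants and starting times do not depend on the trajectory and the bounds are linear in the size
  of the data, which yields stability together with attractivity.\<close>

declare transpose_matrix_vector [simp del]

section \<open>The Frobenius norm and transposes\<close>

lemma norm_matrix_vector_le:
  fixes A :: "real^'n^'m"
  shows "norm (A *v x) \<le> norm A * norm x"
proof -
  have "norm (A *v x) = L2_set (\<lambda>i. norm ((A *v x) $ i)) UNIV"
    by (simp add: norm_vec_def)
  also have "\<dots> \<le> L2_set (\<lambda>i. norm (A $ i) * norm x) UNIV"
    by (rule L2_set_mono) (auto simp: matrix_vector_mul_component Cauchy_Schwarz_ineq2)
  also have "\<dots> = norm A * norm x"
    by (simp add: L2_set_left_distrib[symmetric] norm_vec_def)
  finally show ?thesis .
qed

lemma norm_transpose:
  fixes A :: "real^'n^'m"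
  shows "norm (transpose A) = norm A"
  unfolding norm_eq_sqrt_inner inner_vec_def transpose_def
  by (simp, subst sum.swap, simp)

lemma norm_matrix_mult_le:
  fixes A :: "real^'n^'m" and B :: "real^'k^'n"
  shows "norm (A ** B) \<le> norm A * norm B"
proof -
  have row: "(A ** B) $ i = transpose B *v (A $ i)" for i
    by (simp add: vec_eq_iff matrix_matrix_mult_def matrix_vector_mult_def transpose_def
        mult.commute)
  have "norm (A ** B) = L2_set (\<lambda>i. norm ((A ** B) $ i)) UNIV"
    by (simp add: norm_vec_def)
  also have "\<dots> \<le> L2_set (\<lambda>i. norm (A $ i) * norm B) UNIV"
    unfolding row
    by (rule L2_set_mono)
      (simp_all, metis norm_matrix_vector_le norm_transpose mult.commute)
  also have "\<dots> = norm A * norm B"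
    by (simp add: L2_set_left_distrib[symmetric] norm_vec_def)
  finally show ?thesis .
qed

lemma matrix_add_rdistrib: "(A + B) ** C = A ** C + B ** C"
  by (vector matrix_matrix_mult_def sum.distrib[symmetric] field_simps)

lemma bounded_bilinear_matrix_vector_mult:
  "bounded_bilinear (\<lambda>(A::real^'n^'m) x. A *v x)"
  by (rule bounded_bilinear.intro)
    (auto simp: matrix_vector_mult_add_rdistrib matrix_vector_right_distrib
      scaleR_matrix_vector_assoc matrix_vector_mult_scaleR
      intro!: exI[of _ 1] norm_matrix_vector_le)

lemma bounded_bilinear_matrix_matrix_mult:
  "bounded_bilinear (\<lambda>(A::real^'n^'m) (B::real^'k^'n). A ** B)"
  by (rule bounded_bilinear.intro)
    (auto simp: matrix_add_rdistrib matrix_add_ldistrib scalar_matrix_assoc matrix_scalar_ac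
      intro!: exI[of _ 1] norm_matrix_mult_le)

lemmas has_vector_derivative_matrix_vector_mult =
  bounded_bilinear.has_vector_derivative[OF bounded_bilinear_matrix_vector_mult]

lemma bounded_linear_transpose: "bounded_linear (transpose :: real^'n^'m \<Rightarrow> real^'m^'n)"
proof (rule bounded_linear_intro[of _ 1])
  show "norm (transpose X) \<le> norm X * 1" for X :: "real^'n^'m"
    by (simp add: norm_transpose)
qed (simp_all add: transpose_scalar, simp add: vec_eq_iff transpose_def)

lemma inner_matrix_left: "((A::real^'n^'m) *v x) \<bullet> y = x \<bullet> (transpose A *v y)"
  by (simp add: inner_commute[of _ y] transpose_matrix_vector dot_lmul_matrix[symmetric])
    (simp add: inner_commute)

lemma inner_matrix_right: "x \<bullet> ((A::real^'n^'m) *v y) = (transpose A *v x) \<bullet> y"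
  by (simp add: transpose_matrix_vector dot_lmul_matrix)

lemma matrix_eqI_inner:
  fixes A B :: "real^'n^'m"
  assumes "\<And>x y. x \<bullet> (A *v y) = x \<bullet> (B *v y)"
  shows "A = B"
  using assms by (metis matrix_eq vector_eq_ldot)

section \<open>Annihilating polynomials and lists of eigenvalues\<close>

lemma linear_dependence_nat:
  fixes f :: "nat \<Rightarrow> 'a::euclidean_space"
  shows "\<exists>c. (\<exists>i\<le>DIM('a). c i \<noteq> 0) \<and> (\<Sum>i\<le>DIM('a). c i *\<^sub>R f i) = 0"
proof (cases "inj_on f {..DIM('a)}")
  case True
  then have "card (f ` {..DIM('a)}) = Suc (DIM('a))"
    by (simp add: card_image)
  then have "dependent (f ` {..DIM('a)})"
    by (intro dependent_biggerset) auto
  then obtain u where u: "\<exists>v\<in>f ` {..DIM('a)}. u v \<noteq> 0" "(\<Sum>v\<in>f ` {..DIM('a)}. u v *\<^sub>R v) = 0"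
    using dependent_finite[of "f ` {..DIM('a)}"] by blast
  have "(\<Sum>i\<le>DIM('a). u (f i) *\<^sub>R f i) = 0"
    using u(2) sum.reindex[OF True, of "\<lambda>v. u v *\<^sub>R v"] by simp
  then show ?thesis using u(1) by (intro exI[of _ "u \<circ> f"]) auto
next
  case False
  \<comment> \<open>A repeated value gives a relation of the indexed family that would be lost on
    passing to the image set.\<close>
  then obtain i j where ij: "i \<le> DIM('a)" "j \<le> DIM('a)" "i \<noteq> j" "f i = f j"
    by (auto simp: inj_on_def)
  define c where "c k = (if k = i then 1 else if k = j then -1 else (0::real))" for k
  have "(\<Sum>k\<le>DIM('a). c k *\<^sub>R f k) = (\<Sum>k\<in>{i,j}. c k *\<^sub>R f k)"
    by (rule sum.mono_neutral_right) (use ij in \<open>auto simp: c_def\<close>)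
  also have "\<dots> = 0" using ij by (simp add: c_def)
  finally show ?thesis using ij(1) by (intro exI[of _ c]) (auto simp: c_def)
qed

text \<open>This is \<open>p(M) v\<close>, evaluated by Horner's scheme directly on vectors.\<close>

definition poly_action :: "complex^'n^'n \<Rightarrow> complex poly \<Rightarrow> complex^'n \<Rightarrow> complex^'n" where
  "poly_action M p = fold_coeffs (\<lambda>c f v. c *s v + M *v f v) p (\<lambda>_. 0)"

lemma poly_action_0 [simp]: "poly_action M 0 v = 0"
  by (simp add: poly_action_def)

lemma poly_action_pCons [simp]:
  "poly_action M (pCons c p) v = c *s v + M *v poly_action M p v"
  by (cases "p = 0 \<and> c = 0") (auto simp: poly_action_def)

lemma poly_action_add: "poly_action M (p + q) v = poly_action M p v + poly_action M q v"
  by (induction p q rule: poly_induct2)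
    (auto simp: vector_sadd_rdistrib matrix_vector_right_distrib)

lemma poly_action_smult: "poly_action M (smult c p) v = c *s poly_action M p v"
  by (induction p)
    (auto simp: vector_smult_assoc vector_add_ldistrib vector_scalar_commute)

lemma poly_action_minus: "poly_action M (- p) v = - poly_action M p v"
  using poly_action_smult[of M "-1" p v] by simp

lemma poly_action_sum: "poly_action M (sum p I) v = (\<Sum>i\<in>I. poly_action M (p i) v)"
  by (induction I rule: infinite_finite_induct) (auto simp: poly_action_add)

lemma poly_action_monom: "poly_action M (monom c i) v = c *s (((**) M ^^ i) (mat 1) *v v)"
  by (induction i)
    (auto simp: monom_0 monom_Suc vector_scalar_commute matrix_vector_mul_assoc)

text \<open>The powers of \<open>M\<close> cannot all be independent in the finite-dimensional space
  of matrices. The dimension is taken over the reals, so the coefficients are real numbers embedded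
  into the complex ones; the degree does not matter.\<close>

lemma exists_annihilating_poly:
  fixes M :: "complex^'n^'n"
  shows "\<exists>p. p \<noteq> 0 \<and> (\<forall>v. poly_action M p v = 0)"
proof -
  define D where "D = DIM(complex^'n^'n)"
  obtain c where c: "\<exists>i\<le>D. c i \<noteq> 0" "(\<Sum>i\<le>D. c i *\<^sub>R ((**) M ^^ i) (mat 1)) = 0"
    using linear_dependence_nat[of "\<lambda>i. ((**) M ^^ i) (mat 1)"] by (auto simp: D_def)
  define p where "p = (\<Sum>i\<le>D. monom (complex_of_real (c i)) i)"
  have "coeff p i = c i" if "i \<le> D" for i
    using that by (simp add: p_def coeff_sum coeff_monom sum.delta)
  then have "p \<noteq> 0" using c(1) by auto
  moreover have "poly_action M p v = 0" for v
  proof -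
    have "poly_action M p v = (\<Sum>i\<le>D. (c i *\<^sub>R ((**) M ^^ i) (mat 1)) *v v)"
      unfolding p_def poly_action_sum poly_action_monom
      by (intro sum.cong refl)
        (simp add: vec_eq_iff matrix_vector_mult_def scaleR_conv_of_real[where 'a = complex]
          sum_distrib_left mult.assoc)
    also have "\<dots> = (\<Sum>i\<le>D. c i *\<^sub>R ((**) M ^^ i) (mat 1)) *v v"
      by (induction D) (simp_all add: matrix_vector_mult_add_rdistrib)
    finally show ?thesis using c(2) by simp
  qed
  ultimately show ?thesis by blast
qed

primrec linear_factors :: "complex^'n^'n \<Rightarrow> complex list \<Rightarrow> complex^'n \<Rightarrow> complex^'n" where
  "linear_factors M [] v = v"
| "linear_factors M (l # ls) v = M *v linear_factors M ls v - l *s linear_factors M ls v"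

lemma linear_factors_commute:
  "linear_factors M ls (M *v v - l *s v) = M *v linear_factors M ls v - l *s linear_factors M ls v"
  by (induction ls)
    (auto simp: matrix_vector_mult_diff_distrib vector_ssub_ldistrib vector_scalar_commute
      vector_smult_assoc mult.commute)

lemma poly_action_prod_list:
  "poly_action M (\<Prod>l\<leftarrow>ls. [:-l, 1:]) v = linear_factors M ls v"
proof (induction ls)
  case Nil
  then show ?case by (simp add: one_pCons)
next
  case (Cons l ls)
  then show ?case
    by (simp add: diff_conv_add_uminus poly_action_add poly_action_minus poly_action_smult
        del: add_uminus_conv_diff)
qed

text \<open>A substitute for the characteristic polynomial with its Cayley-Hamilton identity: it
  turns hypotheses on eigenvalues into an algebraic relation for \<open>M\<close>.\<close>

definition spectrum_list :: "complex^'n^'n \<Rightarrow> complex list \<Rightarrow> bool" where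
  "spectrum_list M ls \<longleftrightarrow> (\<forall>l\<in>set ls. \<exists>v. v \<noteq> 0 \<and> M *v v = l *s v) \<and> (\<forall>v. linear_factors M ls v = 0)"

text \<open>Roots of an annihilating polynomial that are not eigenvalues have injective factors, so they
  can be dropped.\<close>

lemma exists_spectrum_list: "\<exists>ls. spectrum_list M ls"
proof -
  obtain p where p: "p \<noteq> 0" "\<And>v. poly_action M p v = 0"
    using exists_annihilating_poly by blast
  obtain R where R: "p = smult (lead_coeff p) (\<Prod>x\<in>#R. [:-x, 1:])"
    using alg_closed_imp_factorization[OF p(1)] by blast
  obtain ls where ls: "R = mset ls" using ex_mset by metis
  have "p = smult (lead_coeff p) (\<Prod>x\<leftarrow>ls. [:-x, 1:])"
    using R by (metis ls mset_map prod_mset_prod_list)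
  then have "lead_coeff p *s linear_factors M ls v = 0" for v
    using p(2)[of v] by (metis poly_action_smult poly_action_prod_list)
  then have 0: "linear_factors M ls v = 0" for v
    using p(1) by (simp add: vector_mul_eq_0)
  let ?ev = "\<lambda>l. \<exists>v. v \<noteq> 0 \<and> M *v v = l *s v"
  have "linear_factors M ls v = 0 \<Longrightarrow> linear_factors M (filter ?ev ls) v = 0" for v
  proof (induction ls arbitrary: v)
    case (Cons l ls)
    show ?case
    proof (cases "?ev l")
      case True
      \<comment> \<open>The factor of a kept eigenvalue is moved innermost by commutation, which
        leaves the tail \<open>ls\<close> acting on another vector; hence the induction over
        arbitrary \<open>v\<close>.\<close>
      have "linear_factors M ls (M *v v - l *s v) = 0"
        using Cons.prems by (simp add: linear_factors_commute)
      from Cons.IH[OF this] True show ?thesis by (simp add: linear_factors_commute)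
    next
      case False
      then have "linear_factors M ls v = 0" using Cons.prems by auto
      from Cons.IH[OF this] False show ?thesis by simp
    qed
  qed simp
  then show ?thesis using 0 unfolding spectrum_list_def by (intro exI[of _ "filter ?ev ls"]) auto
qed


section \<open>Complexification and Lyapunov functions of Hurwitz matrices\<close>

definition cmat :: "real^'n^'m \<Rightarrow> complex^'n^'m" where
  "cmat M = (\<chi> i j. complex_of_real (M $ i $ j))"

definition cvec :: "real^'n \<Rightarrow> complex^'n" where
  "cvec v = (\<chi> i. complex_of_real (v $ i))"

lemma cvec_mult: "cvec (M *v v) = cmat M *v cvec v"
  by (simp add: cvec_def cmat_def matrix_vector_mult_def vec_eq_iff)

lemma cvec_eq_0_iff [simp]: "cvec v = 0 \<longleftrightarrow> v = 0"
  by (simp add: cvec_def vec_eq_iff)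

lemma linear_cvec: "linear cvec"
  by (rule linearI) (auto simp: cvec_def vec_eq_iff scaleR_conv_of_real[where 'a = complex])

lemma eigenvalue_of_cmat: "eigenvalue_of M l \<longleftrightarrow> (\<exists>v. v \<noteq> 0 \<and> cmat M *v v = l *s v)"
  by (simp add: eigenvalue_of_def cmat_def)

lemma linear_linear_factors: "linear (linear_factors M ls)"
proof (induction ls)
  case (Cons l ls)
  have "linear (\<lambda>v. M *v linear_factors M ls v)"
  proof (rule linearI)
    show "M *v linear_factors M ls (r *\<^sub>R v) = r *\<^sub>R (M *v linear_factors M ls v)" for r v
      by (simp add: linear_scale[OF Cons] vec_eq_iff matrix_vector_mult_def scaleR_sum_right)
  qed (simp add: linear_add[OF Cons] matrix_vector_right_distrib)
  moreover have "linear (\<lambda>v. l *s linear_factors M ls v)"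
    by (rule linearI) (simp_all add: linear_add[OF Cons] linear_scale[OF Cons]
        vector_add_ldistrib vec_eq_iff)
  ultimately show ?case by (simp add: linear_compose_sub)
qed (simp add: linear_ident)

text \<open>The inner product on \<open>complex^'n\<close> is the real part of the Hermitian one, so
  multiplication by the imaginary part of \<open>l\<close> is skew and drops out.\<close>

lemma inner_smult_complex: "(y::complex^'n) \<bullet> (l *s y) = Re l * (norm y)\<^sup>2"
proof -
  have "y \<bullet> (l *s y) = (\<Sum>i\<in>UNIV. Re l * (y $ i \<bullet> y $ i))"
    unfolding inner_vec_def
    by (rule sum.cong) (auto simp: inner_complex_def algebra_simps)
  then show ?thesis
    by (simp add: power2_norm_eq_inner inner_vec_def sum_distrib_left)
qed

text \<open>\<open>R\<close> is the Gram matrix of \<open>Y\<close>. It makes the squared norm of a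
  complex quantity that is linear in a real vector into a real quadratic form.\<close>

lemma pullback_matrix:
  fixes Y :: "real^'n \<Rightarrow> 'a::euclidean_space"
  assumes "linear Y"
  obtains R :: "real^'n^'n" where "\<And>v w. v \<bullet> (R *v w) = Y v \<bullet> Y w"
proof
  fix v w
  have "linear (\<lambda>w. adjoint Y (Y w))"
    using linear_compose[OF assms adjoint_linear[OF assms]] by (simp add: o_def)
  then have "v \<bullet> (matrix (\<lambda>w. adjoint Y (Y w)) *v w) = v \<bullet> adjoint Y (Y w)"
    by simp
  also have "\<dots> = Y v \<bullet> Y w" by (rule adjoint_works[OF assms])
  finally show "v \<bullet> (matrix (\<lambda>w. adjoint Y (Y w)) *v w) = Y v \<bullet> Y w" .
qed

text \<open>Along a factorisation of an annihilating polynomial, \<open>y' = M y\<close> is the cascade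
  \<open>y\<^sub>j' = l\<^sub>j y\<^sub>j + y\<^sub>j\<^sub>+\<^sub>1\<close>, so that a suitably weighted sum of the \<open>\<bar>y\<^sub>j\<bar>\<^sup>2\<close> is a Lyapunov function.\<close>

lemma cascade_lyapunov:
  fixes M :: "real^'n^'n"
  assumes "a > 0" and "\<forall>l\<in>set ls. Re l \<le> - a"
  shows "\<exists>Q k. transpose Q = Q \<and> k > 0 \<and> (\<forall>v. v \<bullet> (Q *v v) \<ge> 0) \<and>
    (ls \<noteq> [] \<longrightarrow> (\<forall>v. v \<noteq> 0 \<longrightarrow> v \<bullet> (Q *v v) > 0)) \<and>
    (\<forall>v. 2 * (v \<bullet> (Q *v (M *v v))) \<le> - a * (v \<bullet> (Q *v v))
         + k * (norm (linear_factors (cmat M) ls (cvec v)))\<^sup>2)"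
  using assms(2)
proof (induction ls)
  case Nil
  \<comment> \<open>With no factors the cascade variable is \<open>v\<close> itself and stays
    entirely in the remainder; definiteness enters with the first factor.\<close>
  show ?case
    by (rule exI[of _ 0], rule exI[of _ 1]) (auto simp: transpose_def vec_eq_iff)
next
  case (Cons l ls)
  define y where "y ls v = linear_factors (cmat M) ls (cvec v)" for ls v
  obtain Q k where Q: "transpose Q = Q" "k > 0" "\<And>v. v \<bullet> (Q *v v) \<ge> 0"
      "ls \<noteq> [] \<Longrightarrow> v \<noteq> 0 \<Longrightarrow> v \<bullet> (Q *v v) > 0"
      "\<And>v. 2 * (v \<bullet> (Q *v (M *v v))) \<le> - a * (v \<bullet> (Q *v v)) + k * (norm (y ls v))\<^sup>2" for v
    using Cons unfolding y_def by auto
  have "linear (y ls)"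
    using linear_compose[OF linear_cvec linear_linear_factors, of "cmat M" ls]
    by (simp add: y_def[abs_def] o_def)
  then obtain R :: "real^'n^'n" where R: "\<And>v w. v \<bullet> (R *v w) = y ls v \<bullet> y ls w"
    using pullback_matrix by metis
  have R_sym: "transpose R = R"
    by (rule matrix_eqI_inner)
      (metis R inner_commute inner_matrix_left transpose_transpose)
  \<comment> \<open>The new variable decays at rate \<open>2 * a\<close>, and Young's inequality
    spends \<open>a / 2\<close> of it on the next variable. Of the remaining
    \<open>3 / 2 * a * c\<close>, the part \<open>a * c\<close> is the claimed decay and
    \<open>a * c / 2 = k\<close> cancels the remainder left by the induction hypothesis.\<close>
  define c where "c = 2 * k / a"
  have c: "c > 0" using Q(2) assms(1) by (simp add: c_def)
  define Q' where "Q' = Q + c *\<^sub>R R"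
  have Q'_apply: "v \<bullet> (Q' *v w) = v \<bullet> (Q *v w) + c * (y ls v \<bullet> y ls w)" for v w
    by (simp add: Q'_def matrix_vector_mult_add_rdistrib inner_add_right R
        flip: scaleR_matrix_vector_assoc)
  have step: "y ls (M *v v) = l *s y ls v + y (l # ls) v" for v
    using linear_factors_commute[of "cmat M" ls "cvec v" 0] by (simp add: y_def cvec_mult)
  have "transpose Q' = Q'"
    using Q(1) R_sym by (simp add: Q'_def transpose_def vec_eq_iff)
  moreover have "2 * c / a > 0" using c assms(1) by simp
  moreover have "v \<bullet> (Q' *v v) \<ge> 0" for v
    using Q(3)[of v] c by (simp add: Q'_apply)
  moreover have "v \<bullet> (Q' *v v) > 0" if "v \<noteq> 0" for v
  proof (cases "ls = []")
    case True
    then have "y ls v \<noteq> 0" using that by (simp add: y_def)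
    then show ?thesis using Q(3)[of v] c by (simp add: Q'_apply add_nonneg_pos)
  next
    case False
    then show ?thesis using Q(4)[of v] that c by (simp add: Q'_apply add_pos_nonneg)
  qed
  moreover have "2 * (v \<bullet> (Q' *v (M *v v))) \<le> - a * (v \<bullet> (Q' *v v))
      + 2 * c / a * (norm (y (l # ls) v))\<^sup>2" for v
  proof -
    let ?p = "norm (y ls v)" and ?q = "norm (y (l # ls) v)"
    have "2 * (y ls v \<bullet> y ls (M *v v)) \<le> - 2 * a * ?p\<^sup>2 + 2 * (?p * ?q)"
    proof -
      have "Re l * ?p\<^sup>2 \<le> - a * ?p\<^sup>2"
        using Cons.prems by (intro mult_right_mono) auto
      moreover have "y ls v \<bullet> y (l # ls) v \<le> ?p * ?q" by (rule norm_cauchy_schwarz)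
      ultimately show ?thesis
        by (simp add: step inner_add_right inner_smult_complex)
    qed
    moreover have "2 * (?p * ?q) \<le> a / 2 * ?p\<^sup>2 + 2 / a * ?q\<^sup>2"
    proof -
      have "0 \<le> (a * ?p - 2 * ?q)\<^sup>2 / (2 * a)" using assms(1) by simp
      also have "\<dots> = a / 2 * ?p\<^sup>2 + 2 / a * ?q\<^sup>2 - 2 * (?p * ?q)"
        using assms(1) by (simp add: power2_diff field_simps power2_eq_square)
      finally show ?thesis by simp
    qed
    ultimately have "2 * (y ls v \<bullet> y ls (M *v v)) \<le> - (3 / 2) * a * ?p\<^sup>2 + 2 / a * ?q\<^sup>2"
      by simp
    then have "c * (2 * (y ls v \<bullet> y ls (M *v v))) \<le> c * (- (3 / 2) * a * ?p\<^sup>2 + 2 / a * ?q\<^sup>2)"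
      using c by (intro mult_left_mono) auto
    moreover have "c * (- (3 / 2) * a * ?p\<^sup>2 + 2 / a * ?q\<^sup>2)
        = - a * c * ?p\<^sup>2 - k * ?p\<^sup>2 + 2 * c / a * ?q\<^sup>2"
      using assms(1) by (simp add: c_def field_simps)
    moreover have "a * (v \<bullet> (Q' *v v)) = a * (v \<bullet> (Q *v v)) + a * c * ?p\<^sup>2"
      by (simp add: Q'_apply power2_norm_eq_inner distrib_left)
    moreover have "2 * (v \<bullet> (Q' *v (M *v v)))
        = 2 * (v \<bullet> (Q *v (M *v v))) + c * (2 * (y ls v \<bullet> y ls (M *v v)))"
      by (simp add: Q'_apply)
    ultimately show ?thesis using Q(5)[of v] by linarith
  qed
  ultimately show ?case
    unfolding y_def by (intro exI[of _ Q'] exI[of _ "2 * c / a"] conjI impI allI)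
qed

text \<open>For a list from \<open>spectrum_list\<close> the remainder in
  \<open>cascade_lyapunov\<close> is zero, and finitely many eigenvalues in the open left half plane
  keep a common distance from the imaginary axis.\<close>

lemma hurwitz_lyapunov:
  fixes M :: "real^'n^'n"
  assumes "hurwitz M"
  obtains Q a where "positive_definite Q" "a > 0"
    "\<And>v. 2 * (v \<bullet> (Q *v (M *v v))) \<le> - a * (v \<bullet> (Q *v v))"
proof -
  obtain ls where ls: "spectrum_list (cmat M) ls" using exists_spectrum_list by blast
  have neg: "\<forall>l\<in>set ls. Re l < 0"
    using ls assms by (auto simp: spectrum_list_def hurwitz_def eigenvalue_of_cmat)
  have "\<exists>a>0. \<forall>l\<in>set ls. Re l \<le> - a"
    using neg
  proof (induction ls)
    case (Cons l ls)
    then obtain a where "a > 0" "\<forall>l\<in>set ls. Re l \<le> - a" by auto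
    moreover have "min a (- Re l) > 0" using Cons.prems calculation by auto
    ultimately show ?case
      by (intro exI[of _ "min a (- Re l)"] conjI ballI) (auto simp: min_def split: if_splits)
  qed (auto intro: exI[of _ 1])
  then obtain a where a: "a > 0" "\<forall>l\<in>set ls. Re l \<le> - a" by blast
  have 0: "linear_factors (cmat M) ls v = 0" for v
    using ls by (simp add: spectrum_list_def)
  have "ls \<noteq> []" using 0[of 1] by auto
  with cascade_lyapunov[OF a, of M] obtain Q where Q: "transpose Q = Q"
      "\<forall>v. v \<noteq> 0 \<longrightarrow> v \<bullet> (Q *v v) > 0"
      "\<forall>v. 2 * (v \<bullet> (Q *v (M *v v))) \<le> - a * (v \<bullet> (Q *v v))"
    by (auto simp: 0)
  show ?thesis
    by (rule that[of Q a]) (use Q a in \<open>auto simp: positive_definite_def\<close>)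
qed

text \<open>All entries of a spectrum list are zero here, so its product of factors is a power of
  \<open>A\<close>.\<close>

lemma nilpotent_of_zero_spectrum:
  fixes A :: "real^'n^'n"
  assumes "\<And>l. eigenvalue_of A l \<Longrightarrow> l = 0"
  obtains r where "\<And>v. ((*v) A ^^ r) v = 0"
proof -
  obtain ls where ls: "spectrum_list (cmat A) ls" using exists_spectrum_list by blast
  have z: "\<forall>l\<in>set ls. l = 0"
    using ls assms by (auto simp: spectrum_list_def eigenvalue_of_cmat)
  have "linear_factors (cmat A) ls (cvec v) = cvec (((*v) A ^^ length ls) v)" for v
    using z by (induction ls) (auto simp: cvec_mult)
  then have "((*v) A ^^ length ls) v = 0" for v
    using ls by (simp add: spectrum_list_def)
  then show ?thesis using that by blast
qed

section \<open>Semidefinite forms, factorisation and traces\<close>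

lemma quadratic_nonneg_discriminant:
  fixes a b c :: real
  assumes "\<And>t. a + 2 * t * b + t\<^sup>2 * c \<ge> 0"
  shows "b\<^sup>2 \<le> a * c"
proof (cases "c = 0")
  case True
  have "b = 0"
  proof (rule ccontr)
    assume "b \<noteq> 0"
    then show False using assms[of "- (a + 1) / (2 * b)"] True by (simp add: field_simps)
  qed
  then show ?thesis using True by simp
next
  case False
  have "c \<ge> 0"
  proof (rule ccontr)
    assume "\<not> c \<ge> 0"
    then have c: "c < 0" by simp
    \<comment> \<open>So large that \<open>- c * t\<close> exceeds
      \<open>\<bar>a\<bar> + 2 * \<bar>b\<bar>\<close>: with \<open>t \<ge> 1\<close> the quadratic
      term then outweighs the other two.\<close>
    define t where "t = 1 + \<bar>a\<bar> / - c + 2 * \<bar>b\<bar> / - c"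
    have "\<bar>a\<bar> / - c \<ge> 0" "2 * \<bar>b\<bar> / - c \<ge> 0" using c by (simp_all del: divide_minus_right)
    then have t1: "t \<ge> 1" unfolding t_def by linarith
    have t2: "- c * t = - c + \<bar>a\<bar> + 2 * \<bar>b\<bar>" using c
      by (simp add: t_def field_simps)
    note t = t1 t2
    have "- c * t\<^sup>2 = t * (- c * t)" by (simp add: power2_eq_square)
    also have "\<dots> = t * (- c + \<bar>a\<bar> + 2 * \<bar>b\<bar>)" by (simp only: t(2))
    also have "\<dots> \<ge> t * (- c) + \<bar>a\<bar> + 2 * t * \<bar>b\<bar>"
      using mult_right_mono[OF t(1), of "\<bar>a\<bar>"] by (simp add: algebra_simps)
    finally have "- c * t\<^sup>2 > \<bar>a\<bar> + 2 * t * \<bar>b\<bar>"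
      using mult_pos_pos[of t "- c"] t(1) c by linarith
    moreover have "2 * t * b \<le> 2 * t * \<bar>b\<bar>" using t(1) by (simp add: mult_left_mono)
    ultimately show False using assms[of t] by (simp add: mult.commute)
  qed
  then have c: "c > 0" using False by simp
  have "0 \<le> a + 2 * (- b / c) * b + (- b / c)\<^sup>2 * c" by (rule assms)
  also have "\<dots> = a - b\<^sup>2 / c" using c by (simp add: field_simps power2_eq_square)
  finally show ?thesis using c by (simp add: field_simps)
qed

lemma semidefinite_cauchy_schwarz:
  fixes S :: "real^'n^'n"
  assumes "transpose S = S" and "\<And>v. v \<bullet> (S *v v) \<ge> 0"
  shows "(v \<bullet> (S *v w))\<^sup>2 \<le> (v \<bullet> (S *v v)) * (w \<bullet> (S *v w))"
proof (rule quadratic_nonneg_discriminant)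
  fix t :: real
  have sym: "w \<bullet> (S *v v) = v \<bullet> (S *v w)"
    by (metis assms(1) inner_commute inner_matrix_left)
  have "0 \<le> (v + t *\<^sub>R w) \<bullet> (S *v (v + t *\<^sub>R w))" by (rule assms(2))
  also have "\<dots> = v \<bullet> (S *v v) + 2 * t * (v \<bullet> (S *v w)) + t\<^sup>2 * (w \<bullet> (S *v w))"
    by (simp add: matrix_vector_right_distrib matrix_vector_mult_scaleR inner_add_left
        inner_add_right sym power2_eq_square algebra_simps)
  finally show "0 \<le> v \<bullet> (S *v v) + 2 * t * (v \<bullet> (S *v w)) + t\<^sup>2 * (w \<bullet> (S *v w))" .
qed

text \<open>Cholesky elimination, by induction on a set \<open>J\<close> that contains the nonzero
  rows. If a diagonal entry vanishes, the Cauchy-Schwarz inequality kills its whole row; otherwise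
  subtracting the rank one matrix \<open>s s^T\<close> clears row \<open>j\<close>, and the same
  inequality keeps the Schur complement semidefinite.\<close>

lemma cholesky_aux:
  fixes S :: "real^'n^'n"
  assumes "finite J" and "transpose S = S" and "\<And>v. v \<bullet> (S *v v) \<ge> 0" and "\<And>i. i \<notin> J \<Longrightarrow> S $ i = 0"
  shows "\<exists>G::real^'n^'n. (\<forall>i. i \<notin> J \<longrightarrow> G $ i = 0) \<and> S = transpose G ** G"
  using assms
proof (induction J arbitrary: S)
  case empty
  then have "S = 0" by (simp add: vec_eq_iff)
  then show ?case
    by (intro exI[of _ 0]) (simp add: matrix_matrix_mult_def transpose_def vec_eq_iff)
next
  case (insert j J)
  have sym: "S $ k $ l = S $ l $ k" for k l
    using insert.prems(1) by (metis transpose_def vec_lambda_beta)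
  have entry: "axis j 1 \<bullet> (S *v v) = S $ j \<bullet> v" for v
    by (simp add: inner_axis' matrix_vector_mul_component)
  have diag: "axis j 1 \<bullet> (S *v axis j 1) = S $ j $ j"
    by (simp add: entry inner_axis)
  have cs: "(S $ j \<bullet> v)\<^sup>2 \<le> S $ j $ j * (v \<bullet> (S *v v))" for v
    using semidefinite_cauchy_schwarz[OF insert.prems(1,2), of "axis j 1" v]
    by (simp only: entry) (simp add: inner_axis)
  show ?case
  proof (cases "S $ j $ j = 0")
    case True
    then have "S $ j \<bullet> v = 0" for v using cs[of v] by simp
    then have "S $ j = 0" by (metis inner_eq_zero_iff)
    then have "\<And>i. i \<notin> J \<Longrightarrow> S $ i = 0" using insert.prems(3) by (metis insertE)
    from insert.IH[OF insert.prems(1,2) this] show ?thesis by auto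
  next
    case False
    then have pos: "S $ j $ j > 0" using insert.prems(2)[of "axis j 1"] by (simp add: diag)
    define s where "s = (1 / sqrt (S $ j $ j)) *\<^sub>R S $ j"
    have ss: "s $ k * s $ l = S $ j $ k * S $ j $ l / S $ j $ j" for k l
      using pos by (simp add: s_def)
    define S' where "S' = (\<chi> k l. S $ k $ l - s $ k * s $ l)"
    have "transpose S' = S'"
      by (simp add: S'_def transpose_def vec_eq_iff sym mult.commute)
    moreover have "v \<bullet> (S' *v v) \<ge> 0" for v
    proof -
      have "S' *v v = S *v v - (s \<bullet> v) *\<^sub>R s"
        by (simp add: S'_def vec_eq_iff matrix_vector_mult_def inner_vec_def left_diff_distrib
            right_diff_distrib sum_subtractf sum_distrib_left sum_distrib_right mult_ac)
      then have "v \<bullet> (S' *v v) = v \<bullet> (S *v v) - (s \<bullet> v)\<^sup>2"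
        by (simp add: inner_diff_right power2_eq_square inner_commute)
      moreover have "(s \<bullet> v)\<^sup>2 = (S $ j \<bullet> v)\<^sup>2 / S $ j $ j"
        using pos by (simp add: s_def power_divide)
      moreover have "(S $ j \<bullet> v)\<^sup>2 / S $ j $ j \<le> v \<bullet> (S *v v)"
        using cs[of v] pos by (simp add: divide_le_eq mult.commute)
      ultimately show ?thesis by simp
    qed
    moreover have "S' $ i = 0" if "i \<notin> J" for i
    proof (cases "i = j")
      case True
      then show ?thesis using pos by (simp add: S'_def vec_eq_iff ss)
    next
      case False
      then have "S $ i = 0" using that insert.prems(3) by simp
      then show ?thesis using sym[of j i] by (simp add: S'_def vec_eq_iff ss)
    qed
    ultimately obtain G :: "real^'n^'n" where G: "\<forall>i. i \<notin> J \<longrightarrow> G $ i = 0" "S' = transpose G ** G"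
      using insert.IH[of S'] by blast
    define G' :: "real^'n^'n" where "G' = (\<chi> i. if i = j then s else G $ i)"
    have "S $ k $ l = (transpose G' ** G') $ k $ l" for k l
    proof -
      have "(transpose G' ** G') $ k $ l = (\<Sum>i\<in>UNIV. G' $ i $ k * G' $ i $ l)"
        by (simp add: matrix_matrix_mult_def transpose_def)
      also have "\<dots> = s $ k * s $ l + (\<Sum>i\<in>UNIV - {j}. G $ i $ k * G $ i $ l)"
        by (subst sum.remove[of _ j]) (auto simp: G'_def)
      also have "(\<Sum>i\<in>UNIV - {j}. G $ i $ k * G $ i $ l) = (\<Sum>i\<in>UNIV. G $ i $ k * G $ i $ l)"
        using G(1) insert.hyps(2) by (subst (2) sum.remove[of _ j]) auto
      also have "\<dots> = S' $ k $ l" by (simp add: G(2) matrix_matrix_mult_def transpose_def)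
      finally show ?thesis by (simp add: S'_def)
    qed
    then have "S = transpose G' ** G'" by (simp add: vec_eq_iff)
    moreover have "\<forall>i. i \<notin> insert j J \<longrightarrow> G' $ i = 0" using G(1) by (simp add: G'_def)
    ultimately show ?thesis by blast
  qed
qed

text \<open>\<open>G\<close> serves as a change of coordinates \<open>w = G v\<close>, with inverse
  \<open>H\<close>, in which the form of \<open>P\<close> is the Euclidean one.\<close>

lemma positive_definite_factor:
  fixes P :: "real^'n^'n"
  assumes "positive_definite P"
  obtains G H :: "real^'n^'n" where "P = transpose G ** G" "G ** H = mat 1" "H ** G = mat 1"
proof -
  have nonneg: "v \<bullet> (P *v v) \<ge> 0" for v
    using assms by (cases "v = 0") (auto simp: positive_definite_def less_imp_le)
  obtain G :: "real^'n^'n" where G: "P = transpose G ** G"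
    using cholesky_aux[of UNIV P] assms nonneg by (auto simp: positive_definite_def)
  have "v = 0" if "G *v v = 0" for v
  proof -
    have "v \<bullet> (P *v v) = 0"
      by (simp add: G matrix_vector_mul_assoc[symmetric] that)
    then show ?thesis using assms by (force simp: positive_definite_def)
  qed
  then obtain H :: "real^'n^'n" where "H ** G = mat 1" using matrix_left_invertible_ker by blast
  then show ?thesis using that[OF G] matrix_left_right_inverse by blast
qed

text \<open>In coordinates where the Lyapunov form of \<open>M\<close> is the Euclidean norm,
  \<open>M\<close> becomes \<open>N = G M H\<close> with a negative quadratic form. Every diagonal
  entry of \<open>N\<close> is then negative, and similarity preserves the trace.\<close>

lemma trace_hurwitz_neg:
  fixes M :: "real^'n^'n"
  assumes "hurwitz M"
  shows "trace M < 0"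
proof -
  obtain Q a where Q: "positive_definite Q" "a > 0"
    "\<And>v. 2 * (v \<bullet> (Q *v (M *v v))) \<le> - a * (v \<bullet> (Q *v v))"
    using hurwitz_lyapunov[OF assms] by blast
  obtain G H :: "real^'n^'n" where GH: "Q = transpose G ** G" "G ** H = mat 1" "H ** G = mat 1"
    using positive_definite_factor[OF Q(1)] by blast
  define N where "N = G ** (M ** H)"
  have "N $ i $ i < 0" for i
  proof -
    define v where "v = H *v axis i 1"
    have Gv: "G *v v = axis i 1" by (simp add: v_def matrix_vector_mul_assoc GH)
    have "v \<noteq> 0" using Gv by auto
    then have "v \<bullet> (Q *v (M *v v)) < 0"
      using Q(1) Q(3)[of v] Q(2) by (simp add: positive_definite_def) (smt (verit) mult_pos_pos)
    moreover have "v \<bullet> (Q *v (M *v v)) = (G *v v) \<bullet> (G *v (M *v v))"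
      by (simp add: GH(1) matrix_vector_mul_assoc[symmetric] inner_matrix_left)
    moreover have "G *v (M *v v) = N *v axis i 1"
      by (simp add: N_def v_def matrix_vector_mul_assoc matrix_mul_assoc)
    moreover have "axis i 1 \<bullet> (N *v axis i 1) = N $ i $ i"
      by (simp add: inner_axis' matrix_vector_mul_component inner_axis)
    ultimately show ?thesis by (simp add: Gv)
  qed
  then have "trace N < 0" unfolding trace_def by (intro sum_strict_mono[of UNIV _ "\<lambda>_. 0", simplified]) auto
  moreover have "trace N = trace M"
    unfolding N_def by (subst trace_mul_sym) (simp add: matrix_mul_assoc[symmetric] GH)
  ultimately show ?thesis by simp
qed

text \<open>Both \<open>A - e I\<close> and \<open>- A - e I\<close> are Hurwitz for every
  \<open>e > 0\<close>, so the trace of \<open>A\<close> is at most \<open>CARD('n) * e\<close> in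
  absolute value.\<close>

lemma trace_zero_of_zero_spectrum:
  fixes A :: "real^'n^'n"
  assumes "\<And>l. eigenvalue_of A l \<Longrightarrow> l = 0"
  shows "trace A = 0"
proof -
  have neg: "trace (s *\<^sub>R A - mat e) < 0" if "e > 0" "s = 1 \<or> s = -1" for s e :: real
  proof (rule trace_hurwitz_neg, unfold hurwitz_def, intro allI impI)
    fix l assume "eigenvalue_of (s *\<^sub>R A - mat e) l"
    then obtain v where v: "v \<noteq> 0" "cmat (s *\<^sub>R A - mat e) *v v = l *s v"
      by (auto simp: eigenvalue_of_cmat)
    have "cmat (s *\<^sub>R A - mat e) *v v = of_real s *s (cmat A *v v) - of_real e *s v"
    proof -
      have "cmat (s *\<^sub>R A - mat e) = cmat (s *\<^sub>R A) - mat (of_real e)"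
        by (simp add: vec_eq_iff cmat_def mat_def)
      moreover have "cmat (s *\<^sub>R A) *v v = of_real s *s (cmat A *v v)"
        by (simp add: vec_eq_iff cmat_def matrix_vector_mult_def sum_distrib_left mult.assoc)
      moreover have "mat (of_real e :: complex) *v v = of_real e *s v"
        by (simp add: vec_eq_iff matrix_vector_mult_def mat_def if_distrib if_distribR
            cong del: if_weak_cong)
      ultimately show ?thesis by (simp add: matrix_vector_mult_diff_rdistrib)
    qed
    then have "of_real s *s (cmat A *v v) = (l + of_real e) *s v"
      using v(2) by (simp add: vector_sadd_rdistrib algebra_simps)
    then have "of_real s *s (of_real s *s (cmat A *v v)) = (of_real s * (l + of_real e)) *s v"
      by (simp add: vector_smult_assoc distrib_left vector_add_ldistrib vector_sadd_rdistrib)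
    then have "cmat A *v v = (of_real s * (l + of_real e)) *s v"
      using that(2) by (auto simp: vector_smult_assoc)
    then have "of_real s * (l + of_real e) = 0" using assms v(1) eigenvalue_of_cmat by blast
    then have "l = - of_real e" using that(2) by (auto simp: add_eq_0_iff)
    then show "Re l < 0" using that(1) by simp
  qed
  have tr: "trace (s *\<^sub>R A - mat e) = s * trace A - real CARD('n) * e" for s e :: real
    by (simp add: trace_def mat_def sum_subtractf sum_distrib_left)
  have "\<bar>trace A\<bar> \<le> e" if "e > 0" for e
    using neg[of "e / real CARD('n)" 1] neg[of "e / real CARD('n)" "-1"] that unfolding tr by simp
  then show ?thesis using field_le_epsilon[of "\<bar>trace A\<bar>" 0] by simp
qed

text \<open>With \<open>l = s * s\<close> the operator \<open>A A - l I\<close> factors as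
  \<open>(A - s I) (A + s I)\<close>. Either \<open>(A + s I) v\<close> vanishes and
  \<open>- s\<close> is an eigenvalue of \<open>A\<close>, or it is an eigenvector for
  \<open>s\<close>. This is what gives the trace of \<open>A ** A\<close>.\<close>

lemma zero_spectrum_square:
  fixes A :: "real^'n^'n"
  assumes "\<And>l. eigenvalue_of A l \<Longrightarrow> l = 0" and "eigenvalue_of (A ** A) l"
  shows "l = 0"
proof -
  obtain v where v: "v \<noteq> 0" "cmat (A ** A) *v v = l *s v"
    using assms(2) by (auto simp: eigenvalue_of_cmat)
  have "cmat (A ** A) = cmat A ** cmat A"
    by (simp add: cmat_def matrix_matrix_mult_def vec_eq_iff)
  then have AA: "cmat A *v (cmat A *v v) = l *s v" using v(2) by (simp add: matrix_vector_mul_assoc)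
  define s where "s = csqrt l"
  have l: "l = s * s" using power2_csqrt[of l] by (simp add: s_def power2_eq_square)
  define w where "w = cmat A *v v + s *s v"
  have "s = 0"
  proof (cases "w = 0")
    case True
    then have "cmat A *v v = (- s) *s v"
      unfolding w_def by (metis add_eq_0_iff2 vector_smult_lneg)
    then have "- s = 0" using assms(1) v(1) eigenvalue_of_cmat by blast
    then show ?thesis by simp
  next
    case False
    have "cmat A *v w = s *s w"
      by (simp add: w_def matrix_vector_right_distrib AA l vector_scalar_commute vector_add_ldistrib
          vector_smult_assoc add.commute)
    then show ?thesis using assms(1) False eigenvalue_of_cmat by blast
  qed
  then show ?thesis by (simp add: l)
qed

section \<open>The parametric Lyapunov equation\<close>

lemma inner_eq_trace:
  fixes X Y :: "real^'n^'m"
  shows "X \<bullet> Y = trace (X ** transpose Y)"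
  by (simp add: inner_vec_def trace_def matrix_matrix_mult_def transpose_def)

lemma trace_transpose: "trace (transpose X) = trace X"
  by (simp add: trace_def transpose_def)

lemma trace_scaleR: "trace (c *\<^sub>R (X::real^'n^'n)) = c * trace X"
  by (simp add: trace_def sum_distrib_left)

lemma norm_mat_1: "norm (mat 1 :: real^'n^'n) = sqrt (real CARD('n))"
  by (simp add: norm_eq_sqrt_inner inner_eq_trace trace_I)

lemma norm_transpose_mult_vector_le:
  fixes X :: "real^'m^'n"
  shows "norm (transpose X *v v) \<le> norm X * norm v"
  using norm_matrix_vector_le[of "transpose X" v] by (simp add: norm_transpose)

lemma gram_form:
  fixes G :: "real^'n^'n"
  assumes "P = transpose G ** G"
  shows "v \<bullet> (P *v w) = (G *v v) \<bullet> (G *v w)"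
  by (simp add: assms matrix_vector_mul_assoc[symmetric] inner_matrix_left)

lemma gram_form_norm:
  fixes G :: "real^'n^'n"
  assumes "P = transpose G ** G"
  shows "(norm (G *v v))\<^sup>2 = v \<bullet> (P *v v)"
  by (simp add: gram_form[OF assms] power2_norm_eq_inner)

text \<open>In the coordinates \<open>w = G v\<close> the Riccati equation becomes
  \<open>X + transpose X = b b\<^sup>T - g I\<close> with \<open>X = G A H\<close> and \<open>b = G B\<close>; since \<open>tr X = tr X\<^sup>2 = 0\<close>, this
  determines the Frobenius norms of \<open>b\<close> and \<open>X\<close>.\<close>

lemma riccati_normal_form:
  fixes A P G H :: "real^'n^'n" and B :: "real^'m^'n"
  assumes sol: "parametric_lyapunov_solution A B g P"
    and P: "P = transpose G ** G" and GH: "G ** H = mat 1"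
  shows "transpose (G ** A ** H) + G ** A ** H
    = (G ** B) ** transpose (G ** B) - g *\<^sub>R mat 1"
proof (rule matrix_eqI_inner)
  fix v w :: "real^'n"
  define v' w' where "v' = H *v v" and "w' = H *v w"
  have G: "G *v v' = v" "G *v w' = w"
    by (simp_all add: v'_def w'_def matrix_vector_mul_assoc GH)
  have eq: "transpose A ** P + P ** A - P ** B ** transpose B ** P = - (g *\<^sub>R P)"
    using sol by (simp add: parametric_lyapunov_solution_def)
  have P_sym: "transpose P = P" by (simp add: P matrix_transpose_mul)
  have "v' \<bullet> ((transpose A ** P + P ** A - P ** B ** transpose B ** P) *v w')
      = (G *v (A *v v')) \<bullet> w + v \<bullet> (G *v (A *v w'))
        - (transpose (G ** B) *v v) \<bullet> (transpose (G ** B) *v w)"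
  proof -
    have "v' \<bullet> ((transpose A ** P) *v w') = (A *v v') \<bullet> (P *v w')"
      by (simp add: inner_matrix_left matrix_vector_mul_assoc)
    moreover have "v' \<bullet> ((P ** A) *v w') = v' \<bullet> (P *v (A *v w'))"
      by (simp add: matrix_vector_mul_assoc)
    moreover have "v' \<bullet> ((P ** B ** transpose B ** P) *v w')
        = (transpose B *v (P *v v')) \<bullet> (transpose B *v (P *v w'))"
      by (simp add: matrix_vector_mul_assoc[symmetric] inner_matrix_left P_sym)
    moreover have "transpose B *v (P *v u) = transpose (G ** B) *v (G *v u)" for u
      by (simp add: P matrix_transpose_mul matrix_vector_mul_assoc[symmetric])
    ultimately show ?thesis
      by (simp add: matrix_vector_mult_add_rdistrib matrix_vector_mult_diff_rdistrib
          inner_add_right inner_diff_right gram_form[OF P] G)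
  qed
  moreover have "v' \<bullet> ((- (g *\<^sub>R P)) *v w') = - (g * (v \<bullet> w))"
    using gram_form[OF P, of v' w']
    by (simp add: G flip: scaleR_minus_left scaleR_matrix_vector_assoc)
  ultimately have "(G *v (A *v v')) \<bullet> w + v \<bullet> (G *v (A *v w'))
        - (transpose (G ** B) *v v) \<bullet> (transpose (G ** B) *v w) = - (g * (v \<bullet> w))"
    by (simp only: eq)
  moreover have "v \<bullet> (transpose (G ** A ** H) *v w) = (G *v (A *v v')) \<bullet> w"
    by (simp add: inner_matrix_left[symmetric] v'_def matrix_vector_mul_assoc matrix_mul_assoc)
  moreover have "v \<bullet> ((G ** A ** H) *v w) = v \<bullet> (G *v (A *v w'))"
    by (simp add: w'_def matrix_vector_mul_assoc matrix_mul_assoc)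
  moreover have "v \<bullet> (((G ** B) ** transpose (G ** B)) *v w)
      = (transpose (G ** B) *v v) \<bullet> (transpose (G ** B) *v w)"
    by (simp add: matrix_vector_mul_assoc[symmetric] inner_matrix_left)
  ultimately show "v \<bullet> ((transpose (G ** A ** H) + G ** A ** H) *v w)
      = v \<bullet> (((G ** B) ** transpose (G ** B) - g *\<^sub>R mat 1) *v w)"
    by (simp add: matrix_vector_mult_add_rdistrib matrix_vector_mult_diff_rdistrib
        inner_add_right inner_diff_right flip: scaleR_matrix_vector_assoc)
qed

lemma riccati_normal_form_norms:
  fixes A P G H :: "real^'n^'n" and B :: "real^'m^'n"
  assumes sol: "parametric_lyapunov_solution A B g P" and g: "g > 0"
    and P: "P = transpose G ** G" and GH: "G ** H = mat 1" and HG: "H ** G = mat 1"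
    and tr: "trace A = 0" "trace (A ** A) = 0"
  shows "(norm (G ** B))\<^sup>2 = real CARD('n) * g"
    and "norm (G ** A ** H) \<le> 2 * real CARD('n) * g"
proof -
  define X b where "X = G ** A ** H" and "b = G ** B"
  have nf: "transpose X + X = b ** transpose b - g *\<^sub>R mat 1"
    using riccati_normal_form[OF sol P GH] by (simp add: X_def b_def)
  have trX: "trace X = 0"
    unfolding X_def by (subst trace_mul_sym) (simp add: matrix_mul_assoc HG tr)
  have "X ** X = G ** (A ** A ** H)"
    by (metis X_def matrix_mul_assoc HG matrix_mul_rid)
  then have trXX: "trace (X ** X) = 0"
    by (metis trace_mul_sym matrix_mul_assoc HG matrix_mul_rid tr(2))
  have "(norm b)\<^sup>2 = trace (b ** transpose b)"
    by (simp add: power2_norm_eq_inner inner_eq_trace)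
  also have "b ** transpose b = transpose X + X + g *\<^sub>R mat 1"
    using nf by simp
  also have "trace \<dots> = real CARD('n) * g"
    by (simp add: trace_add trace_transpose trX trace_scaleR trace_I)
  finally show b: "(norm (G ** B))\<^sup>2 = real CARD('n) * g" by (simp add: b_def)
  \<comment> \<open>The vanishing trace of \<open>X ** X\<close> says that \<open>X\<close> is
    orthogonal to its transpose in the Frobenius inner product. So \<open>X\<close> itself, and not
    merely its symmetric part, is controlled by the normal form.\<close>
  have "(norm (transpose X + X))\<^sup>2 = 2 * (norm X)\<^sup>2"
  proof -
    have "transpose X \<bullet> transpose X = X \<bullet> X"
      by (metis norm_transpose power2_norm_eq_inner)
    moreover have "X \<bullet> transpose X = 0" using trXX by (simp add: inner_eq_trace)
    moreover have "transpose X \<bullet> X = 0" using calculation(2) by (metis inner_commute)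
    ultimately show ?thesis
      by (simp add: power2_norm_eq_inner inner_add_left inner_add_right)
  qed
  then have "(norm X)\<^sup>2 \<le> (norm (transpose X + X))\<^sup>2" by simp
  then have "norm X \<le> norm (transpose X + X)" by (rule power2_le_imp_le) simp
  also have "\<dots> \<le> norm (b ** transpose b) + norm (g *\<^sub>R (mat 1 :: real^'n^'n))"
    unfolding nf by (rule norm_triangle_ineq4)
  also have "norm (b ** transpose b) \<le> real CARD('n) * g"
    using norm_matrix_mult_le[of b "transpose b"] b
    by (simp add: norm_transpose b_def power2_eq_square)
  also have "norm (g *\<^sub>R (mat 1 :: real^'n^'n)) \<le> real CARD('n) * g"
  proof -
    have "sqrt (real CARD('n)) \<le> real CARD('n)"
      by (rule real_le_lsqrt) (auto simp: power2_eq_square Suc_leI)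
    then show ?thesis using g by (simp add: norm_mat_1 mult.commute)
  qed
  finally show "norm (G ** A ** H) \<le> 2 * real CARD('n) * g" by (simp add: X_def mult_ac)
qed

text \<open>Both quantities are read off in the coordinates \<open>w = G v\<close>: there
  \<open>B^T P v = b^T w\<close> with \<open>b = G B\<close>, and \<open>G A v = X w\<close> with
  \<open>X = G A H\<close>.\<close>

lemma riccati_bounds:
  fixes A :: "real^'n^'n" and B :: "real^'m^'n"
  assumes sol: "parametric_lyapunov_solution A B g P" and g: "g > 0"
    and tr: "trace A = 0" "trace (A ** A) = 0"
  shows "(norm (transpose B *v (P *v v)))\<^sup>2 \<le> real CARD('n) * g * (v \<bullet> (P *v v))"
    and "(A *v v) \<bullet> (P *v (A *v v)) \<le> 4 * (real CARD('n))\<^sup>2 * g\<^sup>2 * (v \<bullet> (P *v v))"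
proof -
  have "positive_definite P" using sol by (simp add: parametric_lyapunov_solution_def)
  then obtain G H :: "real^'n^'n" where P: "P = transpose G ** G"
      and GH: "G ** H = mat 1" and HG: "H ** G = mat 1"
    by (rule positive_definite_factor)
  note norms = riccati_normal_form_norms[OF sol g P GH HG tr]
  have "transpose B *v (P *v v) = transpose (G ** B) *v (G *v v)"
    by (simp add: P matrix_transpose_mul matrix_vector_mul_assoc[symmetric])
  then have "norm (transpose B *v (P *v v)) \<le> norm (G ** B) * norm (G *v v)"
    using norm_transpose_mult_vector_le[of "G ** B" "G *v v"] by simp
  then have "(norm (transpose B *v (P *v v)))\<^sup>2 \<le> (norm (G ** B) * norm (G *v v))\<^sup>2"
    by (rule power_mono) simp
  then show "(norm (transpose B *v (P *v v)))\<^sup>2 \<le> real CARD('n) * g * (v \<bullet> (P *v v))"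
    by (simp add: power_mult_distrib norms(1) gram_form_norm[OF P])
  have "(G ** A ** H) *v (G *v v) = G *v (A *v v)"
    by (metis HG matrix_mul_assoc matrix_mul_rid matrix_vector_mul_assoc)
  then have "norm (G *v (A *v v)) \<le> norm (G ** A ** H) * norm (G *v v)"
    by (metis norm_matrix_vector_le)
  also have "\<dots> \<le> (2 * real CARD('n) * g) * norm (G *v v)"
    by (rule mult_right_mono[OF norms(2)]) simp
  finally have "(norm (G *v (A *v v)))\<^sup>2 \<le> ((2 * real CARD('n) * g) * norm (G *v v))\<^sup>2"
    by (rule power_mono) simp
  then show "(A *v v) \<bullet> (P *v (A *v v)) \<le> 4 * (real CARD('n))\<^sup>2 * g\<^sup>2 * (v \<bullet> (P *v v))"
    by (simp add: power_mult_distrib gram_form_norm[OF P])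
qed

section \<open>The inverse of P as the solution of a linear Lyapunov equation\<close>

definition lyapunov_op :: "real^'n^'n \<Rightarrow> real^'n^'n \<Rightarrow> real^'n^'n" where
  "lyapunov_op A X = A ** X + X ** transpose A"

lemma linear_lyapunov_op: "linear (lyapunov_op A)"
  by (rule linearI)
    (auto simp: lyapunov_op_def matrix_add_rdistrib matrix_add_ldistrib matrix_scalar_ac
      scalar_matrix_assoc scaleR_add_right)

lemma linear_funpow:
  fixes f :: "'a::real_vector \<Rightarrow> 'a"
  shows "linear f \<Longrightarrow> linear (f ^^ k)"
proof (induction k)
  case 0
  have "f ^^ 0 = (\<lambda>x. x)" by auto
  then show ?case by (simp only: linear_ident)
next
  case (Suc k)
  then show ?case by (simp only: funpow.simps linear_compose)
qed

lemma norm_lyapunov_op_funpow_le: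
  "norm ((lyapunov_op A ^^ k) X) \<le> (2 * norm A) ^ k * norm X"
proof (induction k)
  case (Suc k)
  let ?Y = "(lyapunov_op A ^^ k) X"
  have "norm (lyapunov_op A ?Y) \<le> norm (A ** ?Y) + norm (?Y ** transpose A)"
    unfolding lyapunov_op_def by (rule norm_triangle_ineq)
  also have "\<dots> \<le> 2 * norm A * norm ?Y"
    using norm_matrix_mult_le[of A ?Y] norm_matrix_mult_le[of ?Y "transpose A"]
    by (simp add: norm_transpose mult.commute)
  also have "\<dots> \<le> 2 * norm A * ((2 * norm A) ^ k * norm X)"
    by (rule mult_left_mono[OF Suc]) simp
  finally show ?case by (simp add: mult.assoc)
qed simp

lemma lyapunov_op_nilpotent:
  fixes A :: "real^'n^'n"
  assumes nil: "\<And>v. ((*v) A ^^ r) v = 0"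
  shows "(lyapunov_op A ^^ (2 * r)) X = 0"
proof -
  define L where "L X = A ** X" for X :: "real^'n^'n"
  define R where "R X = X ** transpose A" for X :: "real^'n^'n"
  have Lv: "(L ^^ i) X *v v = ((*v) A ^^ i) (X *v v)" for i X v
    by (induction i) (auto simp: L_def matrix_vector_mul_assoc[symmetric])
  have L0: "(L ^^ i) X = 0" if "i \<ge> r" for i X
  proof -
    have "((*v) A ^^ i) w = 0" for w
    proof -
      have "((*v) A ^^ i) w = ((*v) A ^^ r) (((*v) A ^^ (i - r)) w)"
        using that by (metis funpow_add le_add_diff_inverse o_apply)
      then show ?thesis by (simp add: nil)
    qed
    then show ?thesis by (simp add: matrix_eq Lv)
  qed
  have RL: "(R ^^ i) X = transpose ((L ^^ i) (transpose X))" for i X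
    by (induction i) (auto simp: R_def L_def matrix_transpose_mul)
  have R0: "(R ^^ i) X = 0" if "i \<ge> r" for i X
    by (simp add: RL L0[OF that]) (simp add: transpose_def vec_eq_iff)
  have comm: "R ((L ^^ i) X) = (L ^^ i) (R X)" for i X
    by (induction i) (simp_all add: R_def L_def flip: matrix_mul_assoc)
  have lin0: "(lyapunov_op A ^^ m) 0 = 0" for m
    using linear_0[OF linear_funpow[OF linear_lyapunov_op]] .
  \<comment> \<open>Left and right multiplication commute, and a term with
    \<open>i + j \<ge> 2 * r\<close> has \<open>i \<ge> r\<close> or \<open>j \<ge> r\<close>.
    Counting the outstanding applications in \<open>m\<close> replaces the binomial
    expansion.\<close>
  have "(lyapunov_op A ^^ m) ((L ^^ i) ((R ^^ j) Y)) = 0" if "i + j + m \<ge> 2 * r" for m i j Y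
    using that
  proof (induction m arbitrary: i j)
    case 0
    then consider "i \<ge> r" | "j \<ge> r" by linarith
    then show ?case
    proof cases
      case 1
      then show ?thesis by (simp add: L0)
    next
      case 2
      have "(L ^^ i) 0 = 0" by (induction i) (auto simp: L_def matrix_matrix_mult_def vec_eq_iff)
      then show ?thesis by (simp add: R0[OF 2])
    qed
  next
    case (Suc m)
    let ?Z = "(L ^^ i) ((R ^^ j) Y)"
    have "lyapunov_op A ?Z = (L ^^ Suc i) ((R ^^ j) Y) + (L ^^ i) ((R ^^ Suc j) Y)"
      using comm[of i "(R ^^ j) Y"] by (simp add: lyapunov_op_def L_def R_def)
    then have "(lyapunov_op A ^^ Suc m) ?Z
        = (lyapunov_op A ^^ m) ((L ^^ Suc i) ((R ^^ j) Y))
          + (lyapunov_op A ^^ m) ((L ^^ i) ((R ^^ Suc j) Y))"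
      by (simp only: funpow_Suc_right o_apply linear_add[OF linear_funpow[OF linear_lyapunov_op]])
    also have "\<dots> = 0" using Suc.IH[of "Suc i" j] Suc.IH[of i "Suc j"] Suc.prems by simp
    finally show ?case .
  qed
  from this[of 0 0 "2 * r" X] show ?thesis by simp
qed

text \<open>The geometric series for the inverse of \<open>T + g I\<close> terminates. Its partial
  sums applied to \<open>R\<close> telescope to \<open>X\<close> up to a term with
  \<open>T ^^ m\<close>.\<close>

lemma neumann_series_nilpotent:
  fixes T :: "'a::real_vector \<Rightarrow> 'a"
  assumes T: "linear T" and nil: "\<And>X. (T ^^ m) X = 0" and g: "g \<noteq> 0" and eq: "T X + g *\<^sub>R X = R"
  shows "X = (\<Sum>k<m. ((-1) ^ k / g ^ Suc k) *\<^sub>R (T ^^ k) R)"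
proof -
  have "(\<Sum>k<m. ((-1) ^ k / g ^ Suc k) *\<^sub>R (T ^^ k) R) = X - ((-1) ^ m / g ^ m) *\<^sub>R (T ^^ m) X" for m
  proof (induction m)
    case (Suc m)
    have "(T ^^ m) R = (T ^^ Suc m) X + g *\<^sub>R (T ^^ m) X"
      unfolding eq[symmetric] funpow_Suc_right o_apply
      by (simp add: linear_add[OF linear_funpow[OF T]] linear_scale[OF linear_funpow[OF T]])
    then have "((-1) ^ m / g ^ Suc m) *\<^sub>R (T ^^ m) R
        = ((-1) ^ m / g ^ m) *\<^sub>R (T ^^ m) X - ((-1) ^ Suc m / g ^ Suc m) *\<^sub>R (T ^^ Suc m) X"
      using g by (simp add: scaleR_add_right)
    then show ?case using Suc by simp
  qed simp
  then show ?thesis by (simp add: nil)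
qed

text \<open>Multiplying the Riccati equation by the inverse \<open>W\<close> on both sides makes it
  linear: the quadratic term becomes the constant \<open>B B^T\<close>. The explicit dependence of
  the solution on \<open>g\<close> rests on this.\<close>

lemma riccati_inverse_equation:
  fixes A P W :: "real^'n^'n" and B :: "real^'m^'n"
  assumes sol: "parametric_lyapunov_solution A B g P"
    and W: "W ** P = mat 1" "P ** W = mat 1"
  shows "lyapunov_op A W + g *\<^sub>R W = B ** transpose B"
proof -
  have eq: "transpose A ** P + P ** A - P ** B ** transpose B ** P = - (g *\<^sub>R P)"
    using sol by (simp add: parametric_lyapunov_solution_def)
  have sub: "W ** (X - Y) ** W = W ** X ** W - W ** Y ** W" for X Y :: "real^'n^'n"
    by (metis (no_types) add_diff_cancel_right' diff_add_cancel matrix_add_ldistrib matrix_add_rdistrib)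
  have "W ** (transpose A ** P + P ** A - P ** B ** transpose B ** P) ** W = W ** (- (g *\<^sub>R P)) ** W"
    by (simp only: eq)
  moreover have "W ** (transpose A ** P + P ** A) ** W = W ** transpose A + A ** W"
  proof -
    have "W ** (transpose A ** P) ** W = W ** transpose A"
      by (metis W(2) matrix_mul_assoc matrix_mul_rid)
    moreover have "W ** (P ** A) ** W = A ** W" by (simp add: matrix_mul_assoc W(1))
    ultimately show ?thesis by (simp add: matrix_add_ldistrib matrix_add_rdistrib)
  qed
  moreover have "W ** (P ** B ** transpose B ** P) ** W = B ** transpose B"
    by (metis W matrix_mul_assoc matrix_mul_rid matrix_mul_lid)
  moreover have "W ** (- (g *\<^sub>R P)) ** W = - (g *\<^sub>R W)"
    by (metis (no_types) W(1) matrix_mul_lid matrix_scalar_ac scalar_matrix_assoc scaleR_minus_left)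
  ultimately show ?thesis by (simp add: sub lyapunov_op_def algebra_simps)
qed

text \<open>Only \<open>W\<close> is known to be differentiable. The identity
  \<open>P h - P g = - P h (W h - W g) P g\<close> first bounds \<open>P\<close> near
  \<open>g\<close>, then gives its continuity, and finally the derivative.\<close>

lemma has_vector_derivative_matrix_inverse:
  fixes W P :: "real \<Rightarrow> real^'n^'n"
  assumes S: "open S" "g \<in> S" and inv: "\<And>h. h \<in> S \<Longrightarrow> P h ** W h = mat 1"
    and W': "(W has_vector_derivative W') (at g)"
  shows "(P has_vector_derivative - (P g ** W' ** P g)) (at g)"
proof -
  have ev: "eventually (\<lambda>h. h \<in> S) (at g)" using S by (simp add: eventually_at_in_open')
  have inv': "W h ** P h = mat 1" if "h \<in> S" for h
    using inv[OF that] matrix_left_right_inverse by blast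
  have diff: "P h - P g = - (P h ** (W h - W g) ** P g)" if "h \<in> S" for h
  proof -
    have "P h ** (W h - W g) ** P g = P h ** W h ** P g - P h ** (W g ** P g)"
      by (metis (no_types, opaque_lifting) add_diff_cancel_right' diff_add_cancel matrix_add_ldistrib
          matrix_add_rdistrib matrix_mul_assoc)
    then show ?thesis by (simp add: inv[OF that] inv'[OF S(2)])
  qed
  have nle: "norm (X ** Y ** Z) \<le> norm X * norm Y * norm Z" for X Y Z :: "real^'n^'n"
    using norm_matrix_mult_le[of "X ** Y" Z] norm_matrix_mult_le[of X Y]
    by (meson mult_right_mono norm_ge_zero order_trans)
  have Wc: "(W \<longlongrightarrow> W g) (at g)"
    using has_vector_derivative_continuous[OF W'] by (simp add: isCont_def)
  have "((\<lambda>h. norm (W h - W g) * norm (P g)) \<longlongrightarrow> 0) (at g)"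
    using tendsto_mult_left_zero[OF tendsto_norm_zero[OF LIM_zero[OF Wc]]] .
  then have "eventually (\<lambda>h. norm (W h - W g) * norm (P g) < 1 / 2) (at g)"
    by (rule order_tendstoD) simp
  \<comment> \<open>The identity has \<open>P h\<close> on both sides; once the other two factors
    have product below 1/2, the right-hand occurrence can be absorbed.\<close>
  then have bdd: "eventually (\<lambda>h. norm (P h) \<le> 2 * norm (P g)) (at g)"
    using ev
  proof eventually_elim
    case (elim h)
    have "norm (P h) \<le> norm (P g) + norm (P h - P g)"
      using norm_triangle_ineq[of "P g" "P h - P g"] by simp
    also have "norm (P h - P g) \<le> norm (P h) * norm (W h - W g) * norm (P g)"
      using nle[of "P h" "W h - W g" "P g"] diff[OF elim(2)] by simp
    also have "\<dots> \<le> norm (P h) * (1 / 2)"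
      unfolding mult.assoc by (rule mult_left_mono) (use elim(1) in auto)
    finally show ?case by simp
  qed
  have Pc: "((\<lambda>h. P h - P g) \<longlongrightarrow> 0) (at g)"
  proof (rule Lim_null_comparison)
    show "eventually (\<lambda>h. norm (P h - P g) \<le> 2 * norm (P g) * (norm (W h - W g) * norm (P g))) (at g)"
      using bdd ev
    proof eventually_elim
      case (elim h)
      have "norm (P h - P g) \<le> norm (P h) * norm (W h - W g) * norm (P g)"
        using nle[of "P h" "W h - W g" "P g"] diff[OF elim(2)] by simp
      also have "\<dots> \<le> 2 * norm (P g) * (norm (W h - W g) * norm (P g))"
        unfolding mult.assoc[of "norm (P h)"] by (rule mult_right_mono[OF elim(1)]) simp
      finally show ?case .
    qed
    show "((\<lambda>h. 2 * norm (P g) * (norm (W h - W g) * norm (P g))) \<longlongrightarrow> 0) (at g)"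
      using tendsto_mult_right_zero[OF tendsto_mult_left_zero[OF tendsto_norm_zero[OF LIM_zero[OF Wc]]]] .
  qed
  define rW where "rW h = (1 / norm (h - g)) *\<^sub>R (W h - (W g + (h - g) *\<^sub>R W'))" for h
  have rW: "(rW \<longlongrightarrow> 0) (at g)"
    using W' unfolding has_vector_derivative_def has_derivative_at2 rW_def by blast
  define D where "D = - (P g ** W' ** P g)"
  have "((\<lambda>h. (1 / norm (h - g)) *\<^sub>R (P h - (P g + (h - g) *\<^sub>R D))) \<longlongrightarrow> 0) (at g)"
  proof (rule Lim_null_comparison)
    show "((\<lambda>h. 2 * norm (P g) * norm (rW h) * norm (P g) + norm (P h - P g) * norm W' * norm (P g))
        \<longlongrightarrow> 0) (at g)"
      using tendsto_add[OF tendsto_mult_left_zero[OF tendsto_mult_right_zero[OF tendsto_norm_zero[OF rW]]]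
          tendsto_mult_left_zero[OF tendsto_mult_left_zero[OF tendsto_norm_zero[OF Pc]]]]
      by simp
    show "eventually (\<lambda>h. norm ((1 / norm (h - g)) *\<^sub>R (P h - (P g + (h - g) *\<^sub>R D)))
        \<le> 2 * norm (P g) * norm (rW h) * norm (P g) + norm (P h - P g) * norm W' * norm (P g)) (at g)"
      using bdd ev eventually_neq_at_within[of g g UNIV]
    proof eventually_elim
      case (elim h)
      have hg: "norm (h - g) > 0" using elim(3) by simp
      have W_eq: "W h - W g = norm (h - g) *\<^sub>R rW h + (h - g) *\<^sub>R W'"
        using hg by (simp add: rW_def)
      have "P h - P g = - (norm (h - g) *\<^sub>R (P h ** rW h ** P g)) - (h - g) *\<^sub>R (P h ** W' ** P g)"
        unfolding diff[OF elim(2)] W_eq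
        by (simp add: matrix_add_ldistrib matrix_add_rdistrib matrix_scalar_ac scalar_matrix_assoc)
      moreover have "P h ** W' ** P g = (P h - P g) ** W' ** P g + P g ** W' ** P g"
        by (simp flip: matrix_add_rdistrib)
      ultimately have "P h - (P g + (h - g) *\<^sub>R D)
          = - (norm (h - g) *\<^sub>R (P h ** rW h ** P g)) - (h - g) *\<^sub>R ((P h - P g) ** W' ** P g)"
        by (simp add: D_def algebra_simps)
      then have "norm (P h - (P g + (h - g) *\<^sub>R D))
          \<le> norm (- (norm (h - g) *\<^sub>R (P h ** rW h ** P g)))
            + norm ((h - g) *\<^sub>R ((P h - P g) ** W' ** P g))"
        by (simp only: norm_triangle_ineq4)
      then have "norm (P h - (P g + (h - g) *\<^sub>R D))
          \<le> norm (h - g) * norm (P h ** rW h ** P g) + norm (h - g) * norm ((P h - P g) ** W' ** P g)"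
        by simp
      also have "\<dots> \<le> norm (h - g) * (2 * norm (P g) * norm (rW h) * norm (P g))
          + norm (h - g) * (norm (P h - P g) * norm W' * norm (P g))"
      proof (intro add_mono mult_left_mono)
        show "norm (P h ** rW h ** P g) \<le> 2 * norm (P g) * norm (rW h) * norm (P g)"
          using nle[of "P h" "rW h" "P g"] elim(1)
          by (meson mult_right_mono norm_ge_zero order_trans)
      qed (use nle in auto)
      finally have "norm (P h - (P g + (h - g) *\<^sub>R D)) \<le> norm (h - g)
          * (2 * norm (P g) * norm (rW h) * norm (P g) + norm (P h - P g) * norm W' * norm (P g))"
        by (simp only: distrib_left)
      then show ?case using hg by (simp add: divide_le_eq mult.commute[of _ "\<bar>h - g\<bar>"])
    qed
  qed
  then show ?thesis
    unfolding has_vector_derivative_def has_derivative_at2 D_def[symmetric]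
    by (simp add: bounded_linear_scaleR_left)
qed


text \<open>Along every controlled trajectory \<open>w \<bullet> x\<close> is constant, so steering
  from 0 to \<open>w\<close> gives \<open>w \<bullet> w = 0\<close>. This is the Hautus test at the
  eigenvalue 0.\<close>

lemma controllable_hautus:
  fixes A :: "real^'n^'n" and B :: "real^'m^'n"
  assumes "controllable A B" and A: "transpose A *v w = 0" and B: "transpose B *v w = 0"
  shows "w = 0"
proof -
  obtain T and u :: "real \<Rightarrow> real^'m" and x :: "real \<Rightarrow> real^'n" where T: "T > 0" "x 0 = 0" "x T = w"
    and x: "\<And>t. t \<in> {0..T} \<Longrightarrow>
      ((\<lambda>s. A *v x s + B *v u s) has_integral (x t - x 0)) {0..t}"
    using assms(1)[unfolded controllable_def, THEN spec[of _ 0], THEN spec[of _ w]] by blast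
  have "((\<lambda>s. w \<bullet> (A *v x s + B *v u s)) has_integral (w \<bullet> (w - 0))) {0..T}"
    using has_integral_linear[OF x[of T] bounded_linear_inner_right[of w]] T by (simp add: o_def)
  moreover have "w \<bullet> (A *v x s + B *v u s) = 0" for s
    by (simp add: inner_add_right inner_matrix_right A B)
  ultimately have "((\<lambda>s. 0::real) has_integral (w \<bullet> w)) {0..T}" by simp
  then have "w \<bullet> w = 0" using has_integral_unique has_integral_0 by blast
  then show ?thesis by simp
qed

text \<open>A limit \<open>X\<close> of \<open>P / \<bar>P\<bar>\<close> satisfies \<open>A\<^sup>T X + X A \<ge> \<delta> X B B\<^sup>T X\<close>. Climbing the kernels of the powers of
  \<open>A\<close>, controllability then forces \<open>X = 0\<close>.\<close>

lemma degenerate_riccati_zero: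
  fixes A X :: "real^'n^'n" and B :: "real^'m^'n"
  assumes contr: "controllable A B" and nil: "\<And>v. ((*v) A ^^ r) v = 0"
    and sym: "transpose X = X" and d: "\<delta> > 0"
    and ineq: "\<And>v. \<delta> * (norm (transpose B *v (X *v v)))\<^sup>2 \<le> v \<bullet> ((transpose A ** X + X ** A) *v v)"
  shows "X = 0"
proof -
  define R where "R = transpose A ** X + X ** A"
  have R_sym: "transpose R = R"
  proof (rule matrix_eqI_inner)
    fix v w
    have "v \<bullet> (R *v w) = (A *v v) \<bullet> (X *v w) + (X *v v) \<bullet> (A *v w)" for v w
      using inner_matrix_right[of v X "A *v w"]
      by (simp add: R_def matrix_vector_mult_add_rdistrib inner_add_right
          matrix_vector_mul_assoc[symmetric] inner_matrix_left sym)
    then have "v \<bullet> (R *v w) = w \<bullet> (R *v v)" for v w by (simp add: inner_commute)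
    then show "v \<bullet> (transpose R *v w) = v \<bullet> (R *v w)"
      by (metis inner_commute inner_matrix_right transpose_transpose)
  qed
  have R_nonneg: "v \<bullet> (R *v v) \<ge> 0" for v
    using ineq[of v] d by (smt (verit) R_def zero_le_mult_iff zero_le_power2)
  \<comment> \<open>As \<open>A v\<close> lies in the smaller kernel, \<open>X A v = 0\<close> and
    hence \<open>v \<bullet> R v = 0\<close>. Since \<open>R\<close> is semidefinite,
    \<open>R v = 0\<close>, that is \<open>A^T X v = 0\<close>, while \<open>ineq\<close> gives
    \<open>B^T X v = 0\<close>; the Hautus test then applies to \<open>X v\<close>.\<close>
  have "((*v) A ^^ j) v = 0 \<Longrightarrow> X *v v = 0" for j v
  proof (induction j arbitrary: v)
    case (Suc j)
    have "((*v) A ^^ j) (A *v v) = 0" using Suc.prems by (simp add: funpow_swap1)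
    then have XAv: "X *v (A *v v) = 0" by (rule Suc.IH)
    have Rv: "R *v v = transpose A *v (X *v v)"
      by (simp add: R_def matrix_vector_mult_add_rdistrib XAv flip: matrix_vector_mul_assoc)
    have "v \<bullet> (R *v v) = (X *v (A *v v)) \<bullet> v"
      unfolding Rv by (metis inner_commute inner_matrix_left inner_matrix_right sym)
    then have vRv: "v \<bullet> (R *v v) = 0" by (simp add: XAv)
    have "(w \<bullet> (R *v v))\<^sup>2 \<le> 0" for w
      using semidefinite_cauchy_schwarz[OF R_sym R_nonneg, of w v] by (simp add: vRv)
    then have "R *v v = 0" by (metis inner_eq_zero_iff power2_less_eq_zero_iff)
    moreover have "transpose B *v (X *v v) = 0"
      using ineq[of v] vRv d by (simp add: R_def[symmetric] mult_le_0_iff)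
    ultimately show ?case using controllable_hautus[OF contr] Rv by metis
  qed simp
  then have "X *v v = 0" for v using nil by blast
  then show ?thesis by (simp add: matrix_eq)
qed

text \<open>Otherwise the norm of \<open>P\<close> stays above some \<delta> along a sequence
  tending to 0. For the normalised \<open>Y = P / \<bar>P\<bar>\<close> the quadratic term is
  \<open>\<bar>P\<bar> Y B B^T Y\<close>, which dominates \<open>\<delta> Y B B^T Y\<close> whether
  or not \<open>P\<close> is bounded. Compactness of the unit sphere gives a limit of norm one,
  against \<open>degenerate_riccati_zero\<close>.\<close>

lemma riccati_solution_vanishes:
  fixes A :: "real^'n^'n" and B :: "real^'m^'n"
  assumes contr: "controllable A B" and nil: "\<And>v. ((*v) A ^^ r) v = 0"
    and sol: "\<And>g. g > 0 \<Longrightarrow> parametric_lyapunov_solution A B g (P g)"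
  shows "(P \<longlongrightarrow> 0) (at_right 0)"
proof (rule ccontr)
  assume "\<not> (P \<longlongrightarrow> 0) (at_right 0)"
  then obtain \<delta> where d: "\<delta> > 0" and "\<not> eventually (\<lambda>g. norm (P g) < \<delta>) (at_right 0)"
    by (auto simp: tendsto_iff dist_norm)
  then have "\<exists>g. 0 < g \<and> g < inverse (real (Suc k)) \<and> norm (P g) \<ge> \<delta>" for k
    unfolding eventually_at_right_field
    by (metis inverse_positive_iff_positive not_le of_nat_0_less_iff zero_less_Suc)
  then obtain g where g: "\<And>k. 0 < g k" "\<And>k. g k < inverse (real (Suc k))" "\<And>k. norm (P (g k)) \<ge> \<delta>"
    by metis
  have g0: "g \<longlonglongrightarrow> 0"
    by (rule tendsto_sandwich[OF _ _ tendsto_const LIMSEQ_inverse_real_of_nat])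
      (use g in \<open>auto intro!: always_eventually less_imp_le\<close>)
  define Y where "Y k = (1 / norm (P (g k))) *\<^sub>R P (g k)" for k
  have nP: "norm (P (g k)) > 0" for k using g(3)[of k] d by (rule order_less_le_trans[rotated])
  then have "\<forall>k. Y k \<in> sphere 0 1" by (simp add: Y_def)
  then obtain X s where X: "X \<in> sphere 0 1" and s: "strict_mono (s :: nat \<Rightarrow> nat)" "(Y \<circ> s) \<longlonglongrightarrow> X"
    using compact_sphere[of "0 :: real^'n^'n" 1] unfolding compact_def by metis
  have ine: "\<delta> * (norm (transpose B *v (Y k *v v)))\<^sup>2
      \<le> v \<bullet> ((transpose A ** Y k + Y k ** A + g k *\<^sub>R Y k) *v v)" for k v
  proof -
    let ?P = "P (g k)" and ?n = "norm (P (g k))"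
    have eq: "transpose A ** ?P + ?P ** A - ?P ** B ** transpose B ** ?P = - (g k *\<^sub>R ?P)"
      and sym: "transpose ?P = ?P"
      using sol[OF g(1)[of k]] by (auto simp: parametric_lyapunov_solution_def positive_definite_def)
    have "transpose A ** ?P + ?P ** A + g k *\<^sub>R ?P = ?P ** B ** transpose B ** ?P"
      using eq by (simp add: algebra_simps)
    then have "v \<bullet> ((transpose A ** ?P + ?P ** A + g k *\<^sub>R ?P) *v v)
        = (norm (transpose B *v (?P *v v)))\<^sup>2"
      by (simp add: power2_norm_eq_inner inner_matrix_left sym flip: matrix_vector_mul_assoc)
    moreover have "transpose A ** Y k + Y k ** A + g k *\<^sub>R Y k
        = (1 / ?n) *\<^sub>R (transpose A ** ?P + ?P ** A + g k *\<^sub>R ?P)"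
      by (simp add: Y_def scaleR_add_right matrix_scalar_ac scalar_matrix_assoc)
    ultimately have "v \<bullet> ((transpose A ** Y k + Y k ** A + g k *\<^sub>R Y k) *v v)
        = (norm (transpose B *v (?P *v v)))\<^sup>2 / ?n"
      by (simp flip: scaleR_matrix_vector_assoc)
    also have "transpose B *v (?P *v v) = ?n *\<^sub>R (transpose B *v (Y k *v v))"
      using nP[of k] by (simp add: Y_def matrix_vector_mult_scaleR flip: scaleR_matrix_vector_assoc)
    also have "(norm (?n *\<^sub>R (transpose B *v (Y k *v v))))\<^sup>2 / ?n
        = ?n * (norm (transpose B *v (Y k *v v)))\<^sup>2"
      using nP[of k] by (simp add: power_mult_distrib power2_eq_square)
    finally show ?thesis using mult_right_mono[OF g(3)[of k]] by simp
  qed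
  note mv = bounded_bilinear.tendsto[OF bounded_bilinear_matrix_vector_mult]
  note mm = bounded_bilinear.tendsto[OF bounded_bilinear_matrix_matrix_mult]
  have Ys: "(\<lambda>k. Y (s k)) \<longlonglongrightarrow> X" using s(2) by (simp add: o_def)
  have gs: "(\<lambda>k. g (s k)) \<longlonglongrightarrow> 0"
    using LIMSEQ_subseq_LIMSEQ[OF g0 s(1)] by (simp add: o_def)
  have "\<delta> * (norm (transpose B *v (X *v v)))\<^sup>2
      \<le> v \<bullet> ((transpose A ** X + X ** A + 0 *\<^sub>R X) *v v)" for v
  proof (rule LIMSEQ_le)
    show "(\<lambda>k. \<delta> * (norm (transpose B *v (Y (s k) *v v)))\<^sup>2) \<longlonglongrightarrow> \<delta> * (norm (transpose B *v (X *v v)))\<^sup>2"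
      by (intro tendsto_intros mv Ys)
    show "(\<lambda>k. v \<bullet> ((transpose A ** Y (s k) + Y (s k) ** A + g (s k) *\<^sub>R Y (s k)) *v v))
        \<longlonglongrightarrow> v \<bullet> ((transpose A ** X + X ** A + 0 *\<^sub>R X) *v v)"
      by (intro tendsto_intros mv mm Ys gs)
  qed (use ine in auto)
  moreover have "transpose X = X"
  proof -
    have "(\<lambda>k. transpose (Y (s k))) \<longlonglongrightarrow> transpose X"
      by (rule bounded_linear.tendsto[OF bounded_linear_transpose Ys])
    moreover have "transpose (Y k) = Y k" for k
      using sol[OF g(1)[of k]]
      by (simp add: Y_def transpose_scalar parametric_lyapunov_solution_def positive_definite_def)
    ultimately show ?thesis using Ys LIMSEQ_unique by auto
  qed
  ultimately have "X = 0" using degenerate_riccati_zero[OF contr nil _ d] by simp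
  then show False using X by simp
qed

text \<open>The inverse \<open>H H^T\<close> of \<open>P\<close> solves the linear Lyapunov
  equation, whose operator is nilpotent. So \<open>W\<close> is an explicit polynomial in
  \<open>1 / g\<close>, from which the differentiability of \<open>P\<close> in \<open>g\<close> and
  its lower bound are derived.\<close>

lemma riccati_inverse_formula:
  fixes A :: "real^'n^'n" and B :: "real^'m^'n"
  assumes nil: "\<And>v. ((*v) A ^^ r) v = 0" and g: "g > 0"
    and sol: "parametric_lyapunov_solution A B g P"
    and W: "W = (\<Sum>k<2*r. ((-1) ^ k / g ^ Suc k) *\<^sub>R (lyapunov_op A ^^ k) (B ** transpose B))"
  shows "P ** W = mat 1" and "W ** P = mat 1" and "\<And>v. v \<bullet> (W *v v) \<ge> 0" and "transpose W = W"
proof -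
  have "positive_definite P" using sol by (simp add: parametric_lyapunov_solution_def)
  then obtain G H :: "real^'n^'n" where P: "P = transpose G ** G"
      and GH: "G ** H = mat 1" and HG: "H ** G = mat 1"
    by (rule positive_definite_factor)
  have TT: "transpose G ** transpose H = mat 1" "transpose H ** transpose G = mat 1"
    by (metis HG GH matrix_transpose_mul transpose_mat)+
  have "P ** (H ** transpose H) = transpose G ** (G ** H) ** transpose H"
    by (simp add: P matrix_mul_assoc)
  then have PW: "P ** (H ** transpose H) = mat 1" by (simp add: GH TT)
  then have WP: "(H ** transpose H) ** P = mat 1" using matrix_left_right_inverse by blast
  have "H ** transpose H = W"
    unfolding W
    by (rule neumann_series_nilpotent[OF linear_lyapunov_op lyapunov_op_nilpotent[OF nil]])
      (use g riccati_inverse_equation[OF sol WP PW] in auto)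
  moreover have "v \<bullet> ((H ** transpose H) *v v) \<ge> 0" for v
    by (simp add: inner_matrix_right[of v H] flip: matrix_vector_mul_assoc)
  ultimately show "P ** W = mat 1" "W ** P = mat 1" "\<And>v. v \<bullet> (W *v v) \<ge> 0" "transpose W = W"
    using PW WP by (auto simp: matrix_transpose_mul)
qed

text \<open>\<open>W'\<close> is the derivative of \<open>W\<close> in \<open>g\<close>,
  characterised by the differentiated equation. In the coordinates of \<open>P\<close> it becomes
  \<open>Z = G W' G^T\<close> with \<open>lyapunov_op X Z + g Z = - I\<close>. As the norm of
  \<open>X\<close> is at most \<open>2 n g\<close>, the factor \<open>g^k\<close> from the k-th
  power cancels against \<open>1 / g^(k + 1)\<close> in the Neumann series, and \<open>c / g\<close>
  is left.\<close>

lemma riccati_derivative_bounds: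
  fixes A :: "real^'n^'n" and B :: "real^'m^'n"
  assumes nil: "\<And>v. ((*v) A ^^ r) v = 0" and tr: "trace A = 0" "trace (A ** A) = 0"
    and g: "g > 0" and sol: "parametric_lyapunov_solution A B g P"
    and W: "P ** W = mat 1" and W': "lyapunov_op A W' + W + g *\<^sub>R W' = 0"
    and c: "c = (\<Sum>k<2*r. (4 * real CARD('n)) ^ k * sqrt (real CARD('n)))"
  shows "\<bar>v \<bullet> ((P ** W' ** P) *v v)\<bar> \<le> c / g * (v \<bullet> (P *v v))"
    and "(norm (transpose B *v ((P ** W' ** P) *v v)))\<^sup>2 \<le> real CARD('n) * c\<^sup>2 / g * (v \<bullet> (P *v v))"
proof -
  have "positive_definite P" using sol by (simp add: parametric_lyapunov_solution_def)
  then obtain G H :: "real^'n^'n" where P: "P = transpose G ** G"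
      and GH: "G ** H = mat 1" and HG: "H ** G = mat 1"
    by (rule positive_definite_factor)
  note norms = riccati_normal_form_norms[OF sol g P GH HG tr]
  define X where "X = G ** A ** H"
  define Z where "Z = G ** W' ** transpose G"
  have TT: "transpose G ** transpose H = mat 1" "transpose H ** transpose G = mat 1"
    by (metis HG GH matrix_transpose_mul transpose_mat)+
  have WG: "G ** W ** transpose G = mat 1"
  proof -
    have "W ** P = mat 1" using W matrix_left_right_inverse by blast
    then have "(G ** W ** transpose G) ** G ** H = G ** H"
      by (metis P matrix_mul_assoc matrix_mul_rid)
    then show ?thesis by (simp add: GH flip: matrix_mul_assoc)
  qed
  have "lyapunov_op X Z = G ** lyapunov_op A W' ** transpose G"
  proof -
    have "X ** Z = G ** (A ** W') ** transpose G"
      unfolding X_def Z_def by (metis HG matrix_mul_assoc matrix_mul_rid)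
    moreover have "Z ** transpose X = G ** (W' ** transpose A) ** transpose G"
      unfolding X_def Z_def matrix_transpose_mul by (metis TT(1) matrix_mul_assoc matrix_mul_rid)
    ultimately show ?thesis by (simp add: lyapunov_op_def matrix_add_ldistrib matrix_add_rdistrib)
  qed
  also have "lyapunov_op A W' = (-1) *\<^sub>R W + (- g) *\<^sub>R W'"
  proof -
    have "lyapunov_op A W' = - (W + g *\<^sub>R W')"
      using W' by (simp only: eq_neg_iff_add_eq_0 add.assoc)
    then show ?thesis by simp
  qed
  also have "G ** ((-1) *\<^sub>R W + (- g) *\<^sub>R W') ** transpose G
      = (-1) *\<^sub>R (G ** W ** transpose G) + (- g) *\<^sub>R Z"
    unfolding Z_def matrix_add_ldistrib matrix_add_rdistrib matrix_scalar_ac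
    by (simp only: scalar_matrix_assoc[symmetric])
  finally have XZ: "lyapunov_op X Z + g *\<^sub>R Z = - mat 1" by (simp add: WG)
  have "((*v) X ^^ i) v = G *v (((*v) A ^^ i) (H *v v))" for i v
  proof (induction i)
    case 0
    then show ?case by (simp add: matrix_vector_mul_assoc GH)
  next
    case (Suc i)
    have "X *v (G *v w) = G *v (A *v w)" for w
      unfolding X_def by (metis HG matrix_mul_assoc matrix_mul_rid matrix_vector_mul_assoc)
    then show ?case using Suc by simp
  qed
  then have nilX: "((*v) X ^^ r) v = 0" for v by (simp add: nil)
  have "Z = (\<Sum>k<2*r. ((-1) ^ k / g ^ Suc k) *\<^sub>R (lyapunov_op X ^^ k) (- mat 1))"
    by (rule neumann_series_nilpotent[OF linear_lyapunov_op lyapunov_op_nilpotent[OF nilX]])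
      (use g XZ in auto)
  then have "norm Z \<le> (\<Sum>k<2*r. norm (((-1) ^ k / g ^ Suc k) *\<^sub>R (lyapunov_op X ^^ k) (- mat 1)))"
    by (rule ssubst) (rule norm_sum)
  also have "\<dots> \<le> (\<Sum>k<2*r. (4 * real CARD('n)) ^ k * sqrt (real CARD('n)) / g)"
  proof (rule sum_mono)
    fix k
    have "norm ((lyapunov_op X ^^ k) (- mat 1)) \<le> (2 * norm X) ^ k * sqrt (real CARD('n))"
      using norm_lyapunov_op_funpow_le[of k X "- mat 1"] by (simp add: norm_mat_1)
    also have "\<dots> \<le> (4 * real CARD('n) * g) ^ k * sqrt (real CARD('n))"
      by (intro mult_right_mono power_mono) (use norms(2) in \<open>auto simp: X_def mult_ac\<close>)
    finally have "norm ((lyapunov_op X ^^ k) (- mat 1)) / g ^ Suc k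
        \<le> (4 * real CARD('n) * g) ^ k * sqrt (real CARD('n)) / g ^ Suc k"
      by (rule divide_right_mono) (use g in simp)
    then show "norm (((-1) ^ k / g ^ Suc k) *\<^sub>R (lyapunov_op X ^^ k) (- mat 1))
        \<le> (4 * real CARD('n)) ^ k * sqrt (real CARD('n)) / g"
      using g by (simp add: power_mult_distrib power_abs)
  qed
  finally have Z: "norm Z \<le> c / g" by (simp add: c sum_divide_distrib)
  have PWP: "(P ** W' ** P) *v v = transpose G *v (Z *v (G *v v))"
    by (simp add: P Z_def flip: matrix_vector_mul_assoc)
  have ZG: "norm (Z *v (G *v v)) \<le> c / g * norm (G *v v)"
    using norm_matrix_vector_le[of Z "G *v v"] mult_right_mono[OF Z norm_ge_zero[of "G *v v"]] by simp
  have "\<bar>v \<bullet> ((P ** W' ** P) *v v)\<bar> = \<bar>(G *v v) \<bullet> (Z *v (G *v v))\<bar>"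
    unfolding PWP by (simp add: inner_matrix_left)
  also have "\<dots> \<le> norm (G *v v) * norm (Z *v (G *v v))" by (rule Cauchy_Schwarz_ineq2)
  also have "\<dots> \<le> norm (G *v v) * (c / g * norm (G *v v))" by (rule mult_left_mono[OF ZG]) simp
  also have "\<dots> = c / g * (v \<bullet> (P *v v))"
    by (simp add: gram_form_norm[OF P, symmetric] power2_eq_square)
  finally show "\<bar>v \<bullet> ((P ** W' ** P) *v v)\<bar> \<le> c / g * (v \<bullet> (P *v v))" .
  have "transpose B *v ((P ** W' ** P) *v v) = transpose (G ** B) *v (Z *v (G *v v))"
    unfolding PWP by (simp add: matrix_transpose_mul flip: matrix_vector_mul_assoc)
  then have "norm (transpose B *v ((P ** W' ** P) *v v)) \<le> norm (G ** B) * norm (Z *v (G *v v))"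
    using norm_transpose_mult_vector_le[of "G ** B" "Z *v (G *v v)"] by simp
  also have "\<dots> \<le> norm (G ** B) * (c / g * norm (G *v v))" by (rule mult_left_mono[OF ZG]) simp
  finally have "(norm (transpose B *v ((P ** W' ** P) *v v)))\<^sup>2
      \<le> (norm (G ** B) * (c / g * norm (G *v v)))\<^sup>2"
    by (rule power_mono) simp
  also have "\<dots> = real CARD('n) * c\<^sup>2 / g * (v \<bullet> (P *v v))"
    unfolding power_mult_distrib norms(1) gram_form_norm[OF P] power_divide
    using g by (simp add: power2_eq_square[of g])
  finally show "(norm (transpose B *v ((P ** W' ** P) *v v)))\<^sup>2
      \<le> real CARD('n) * c\<^sup>2 / g * (v \<bullet> (P *v v))" .
qed


lemma parametric_lyapunov_family:
  fixes A :: "real^'n^'n" and B :: "real^'m^'n"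
  assumes contr: "controllable A B" and spec: "\<And>l. eigenvalue_of A l \<Longrightarrow> l = 0"
    and sol: "\<And>g. g > 0 \<Longrightarrow> parametric_lyapunov_solution A B g (P g)"
  obtains c N D where "c > 0"
    and "\<And>g v. g > 0 \<Longrightarrow> (norm (transpose B *v (P g *v v)))\<^sup>2 \<le> c * g * (v \<bullet> (P g *v v))"
    and "\<And>g v. g > 0 \<Longrightarrow> (A *v v) \<bullet> (P g *v (A *v v)) \<le> c * g\<^sup>2 * (v \<bullet> (P g *v v))"
    and "\<And>g. g > 0 \<Longrightarrow> (P has_vector_derivative D g) (at g)"
    and "\<And>g v. g > 0 \<Longrightarrow> \<bar>v \<bullet> (D g *v v)\<bar> \<le> c / g * (v \<bullet> (P g *v v))"
    and "\<And>g v. g > 0 \<Longrightarrow> (norm (transpose B *v (D g *v v)))\<^sup>2 \<le> c / g * (v \<bullet> (P g *v v))"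
    and "\<And>g v. 0 < g \<Longrightarrow> g \<le> 1 \<Longrightarrow> g ^ N * (v \<bullet> v) \<le> c * (v \<bullet> (P g *v v))"
    and "(P \<longlongrightarrow> 0) (at_right 0)"
proof -
  obtain r where nil: "\<And>v. ((*v) A ^^ r) v = 0" using nilpotent_of_zero_spectrum[OF spec] by blast
  have tr: "trace A = 0" "trace (A ** A) = 0"
    using trace_zero_of_zero_spectrum[OF spec]
      trace_zero_of_zero_spectrum[OF zero_spectrum_square[OF spec]] by auto
  define M where "M k = (lyapunov_op A ^^ k) (B ** transpose B)" for k
  define W where "W g = (\<Sum>k<2*r. ((-1) ^ k / g ^ Suc k) *\<^sub>R M k)" for g
  define W' where "W' g = (\<Sum>k<2*r. ((-1) ^ k * (- real (Suc k)) / g ^ (k + 2)) *\<^sub>R M k)" for g :: real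
  have W_def': "W g = (\<Sum>k<2*r. ((-1) ^ k / g ^ Suc k) *\<^sub>R (lyapunov_op A ^^ k) (B ** transpose B))" for g
    by (simp add: W_def M_def)
  note Winv = riccati_inverse_formula[OF nil _ sol W_def']
  have dW: "(W has_vector_derivative W' g) (at g)" if "g > 0" for g
  proof -
    have "((\<lambda>g. ((-1) ^ k / g ^ Suc k) *\<^sub>R M k) has_vector_derivative
        ((-1) ^ k * (- real (Suc k)) / g ^ (k + 2)) *\<^sub>R M k) (at g)" for k
    proof -
      have "((\<lambda>g. (-1) ^ k / g ^ Suc k) has_real_derivative
          (0 * g ^ Suc k - (-1) ^ k * (real (Suc k) * g ^ k)) / (g ^ Suc k * g ^ Suc k)) (at g)"
        using DERIV_divide[OF DERIV_const[of "(-1) ^ k" "at g"] DERIV_pow[of "Suc k" g UNIV]] that by simp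
      also have "(0 * g ^ Suc k - (-1) ^ k * (real (Suc k) * g ^ k)) / (g ^ Suc k * g ^ Suc k)
          = (-1) ^ k * (- real (Suc k)) / g ^ (k + 2)"
        using that by (simp add: divide_simps del: of_nat_Suc)
      finally show ?thesis
        using has_vector_derivative_scaleR[OF _ has_vector_derivative_const] by fastforce
    qed
    then show ?thesis unfolding W_def[abs_def] W'_def by (intro has_vector_derivative_sum)
  qed
  define D where "D g = - (P g ** W' g ** P g)" for g
  have dP: "(P has_vector_derivative D g) (at g)" if "g > 0" for g
    unfolding D_def
    by (rule has_vector_derivative_matrix_inverse[OF open_greaterThan[of 0] _ Winv(1) dW])
      (use that in auto)
  \<comment> \<open>Obtained by differentiating
    \<open>lyapunov_op A (W h) + h *\<^sub>R W h = B ** transpose B\<close>, whose right side is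
    constant.\<close>
  have W'_eq: "lyapunov_op A (W' g) + W g + g *\<^sub>R W' g = 0" if "g > 0" for g
  proof -
    have "bounded_linear (lyapunov_op A)"
      using linear_lyapunov_op linear_conv_bounded_linear by blast
    from bounded_linear.has_vector_derivative[OF this dW[OF that]]
    have "((\<lambda>h. lyapunov_op A (W h) + h *\<^sub>R W h) has_vector_derivative
        lyapunov_op A (W' g) + (g *\<^sub>R W' g + 1 *\<^sub>R W g)) (at g)"
      by (intro has_vector_derivative_add has_vector_derivative_scaleR dW[OF that] DERIV_ident)
    moreover have "((\<lambda>h. lyapunov_op A (W h) + h *\<^sub>R W h) has_vector_derivative 0) (at g)"
    proof (rule has_vector_derivative_transform_within_open[OF has_vector_derivative_const
          open_greaterThan[of 0]])
      show "B ** transpose B = lyapunov_op A (W h) + h *\<^sub>R W h" if "h \<in> {0<..}" for h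
        using riccati_inverse_equation[OF sol, of h "W h"] Winv(1,2)[of h] that by simp
    qed (use that in simp)
    ultimately show ?thesis
      using vector_derivative_unique_at by (fastforce simp: algebra_simps)
  qed
  define c where "c = (\<Sum>k<2*r. (4 * real CARD('n)) ^ k * sqrt (real CARD('n)))"
  note Db = riccati_derivative_bounds[OF nil tr _ sol Winv(1) W'_eq c_def]
  define n where "n = real CARD('n)"
  define S where "S = (\<Sum>k<2*r. norm (M k))"
  have WS: "norm (W g) \<le> S / g ^ (2 * r)" if "0 < g" "g \<le> 1" for g
  proof -
    have "norm (W g) \<le> (\<Sum>k<2*r. norm (M k) / g ^ (2 * r))"
      unfolding W_def
    proof (rule sum_norm_le)
      fix k assume k: "k \<in> {..<2 * r}"
      then have "g ^ (2 * r) \<le> g ^ Suc k" using that by (intro power_decreasing) auto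
      then have "norm (M k) / g ^ Suc k \<le> norm (M k) / g ^ (2 * r)"
        using that by (intro divide_left_mono) auto
      then show "norm (((-1) ^ k / g ^ Suc k) *\<^sub>R M k) \<le> norm (M k) / g ^ (2 * r)"
        using that by (simp add: power_abs)
    qed
    then show ?thesis by (simp add: S_def sum_divide_distrib)
  qed
  \<comment> \<open>Cauchy-Schwarz for the form of \<open>W g\<close>, applied to \<open>v\<close>
    and \<open>P g *v v\<close>, whose pairing is \<open>v \<bullet> v\<close>. The pole of
    \<open>W\<close> at 0 has order at most \<open>2 * r\<close>, which is the origin of the
    exponent \<open>N\<close>.\<close>
  have low: "g ^ (2 * r) * (v \<bullet> v) \<le> S * (v \<bullet> (P g *v v))" if g: "0 < g" "g \<le> 1" for g v
  proof (cases "v = 0")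
    case False
    let ?z = "P g *v v"
    have "W g *v ?z = v" using Winv(2)[OF g(1) g(1)] by (simp add: matrix_vector_mul_assoc)
    then have "(v \<bullet> v)\<^sup>2 \<le> (v \<bullet> (W g *v v)) * (?z \<bullet> v)"
      using semidefinite_cauchy_schwarz[OF Winv(4)[OF g(1) g(1)] Winv(3)[OF g(1) g(1)], of v ?z] by simp
    also have "\<dots> \<le> (norm (W g) * (v \<bullet> v)) * (?z \<bullet> v)"
    proof (rule mult_right_mono)
      have "v \<bullet> (W g *v v) \<le> norm v * norm (W g *v v)" by (rule norm_cauchy_schwarz)
      also have "\<dots> \<le> norm v * (norm (W g) * norm v)"
        by (rule mult_left_mono[OF norm_matrix_vector_le]) simp
      finally show "v \<bullet> (W g *v v) \<le> norm (W g) * (v \<bullet> v)"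
        by (simp add: power2_norm_eq_inner[symmetric] power2_eq_square mult_ac)
      show "0 \<le> ?z \<bullet> v"
        using sol[OF g(1)] False
        by (simp add: parametric_lyapunov_solution_def positive_definite_def inner_commute less_imp_le)
    qed
    finally have "(v \<bullet> v) * (v \<bullet> v) \<le> (norm (W g) * (?z \<bullet> v)) * (v \<bullet> v)"
      by (simp add: power2_eq_square mult_ac)
    then have "v \<bullet> v \<le> norm (W g) * (?z \<bullet> v)" using False by simp
    also have "\<dots> \<le> S / g ^ (2 * r) * (?z \<bullet> v)"
      using WS[OF g] sol[OF g(1)] False
      by (intro mult_right_mono)
        (auto simp: parametric_lyapunov_solution_def positive_definite_def inner_commute less_imp_le)
    finally show ?thesis using g(1) by (simp add: field_simps inner_commute)
  qed simp
  have Pnn: "v \<bullet> (P g *v v) \<ge> 0" if "g > 0" for g v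
    using sol[OF that] by (cases "v = 0")
      (auto simp: parametric_lyapunov_solution_def positive_definite_def less_imp_le)
  \<comment> \<open>A sum of nonnegative constants, so that a single one serves all the bounds; the
    1 makes it positive.\<close>
  define C where "C = n + 4 * n\<^sup>2 + c + n * c\<^sup>2 + S + 1"
  have nn: "n \<ge> 0" "4 * n\<^sup>2 \<ge> 0" "c \<ge> 0" "n * c\<^sup>2 \<ge> 0" "S \<ge> 0"
    by (auto simp: n_def c_def S_def intro!: sum_nonneg)
  then have C: "n \<le> C" "4 * n\<^sup>2 \<le> C" "c \<le> C" "n * c\<^sup>2 \<le> C" "S \<le> C" "C > 0"
    unfolding C_def by linarith+
  have up: "a * (v \<bullet> (P g *v v)) \<le> b * (v \<bullet> (P g *v v))" if "a \<le> b" "g > 0" for a b g v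
    by (rule mult_right_mono[OF that(1) Pnn[OF that(2)]])
  show ?thesis
  proof (rule that[of C D "2 * r"])
    fix g :: real and v assume g: "g > 0"
    show "(norm (transpose B *v (P g *v v)))\<^sup>2 \<le> C * g * (v \<bullet> (P g *v v))"
      by (rule order_trans[OF riccati_bounds(1)[OF sol[OF g] g tr] up[OF _ g]])
        (use C g in \<open>simp add: n_def\<close>)
    show "(A *v v) \<bullet> (P g *v (A *v v)) \<le> C * g\<^sup>2 * (v \<bullet> (P g *v v))"
      by (rule order_trans[OF riccati_bounds(2)[OF sol[OF g] g tr] up[OF _ g]])
        (use C g in \<open>simp add: n_def\<close>)
    have neg: "D g *v v = - ((P g ** W' g ** P g) *v v)"
      unfolding D_def by (metis add.right_inverse add_eq_0_iff matrix_vector_mult_0 matrix_vector_mult_add_rdistrib)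
    show "\<bar>v \<bullet> (D g *v v)\<bar> \<le> C / g * (v \<bullet> (P g *v v))"
      unfolding neg inner_minus_right abs_minus_cancel
      by (rule order_trans[OF Db(1)[OF g g g g g] up[OF _ g]])
        (use C g in \<open>simp add: divide_right_mono\<close>)
    show "(norm (transpose B *v (D g *v v)))\<^sup>2 \<le> C / g * (v \<bullet> (P g *v v))"
    proof -
      have "transpose B *v (D g *v v) = - (transpose B *v ((P g ** W' g ** P g) *v v))"
        unfolding neg by (metis add.right_inverse add_eq_0_iff matrix_vector_mult_0_right matrix_vector_right_distrib)
      then have "(norm (transpose B *v (D g *v v)))\<^sup>2
          = (norm (transpose B *v ((P g ** W' g ** P g) *v v)))\<^sup>2" by simp
      also have "\<dots> \<le> C / g * (v \<bullet> (P g *v v))"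
        by (rule order_trans[OF Db(2)[OF g g g g g] up[OF _ g]])
          (use C g in \<open>simp add: divide_right_mono n_def\<close>)
      finally show ?thesis .
    qed
    assume "g \<le> 1"
    then show "g ^ (2 * r) * (v \<bullet> v) \<le> C * (v \<bullet> (P g *v v))"
      by (rule order_trans[OF low[OF g] up[OF _ g]]) (use C in simp)
  qed (use C dP riccati_solution_vanishes[OF contr nil sol] in auto)
qed

section \<open>The closed loop\<close>

text \<open>At the infimum \<open>t0\<close> of the times where \<open>f\<close> is not positive,
  continuity gives \<open>f t0 = 0\<close> with \<open>f > 0\<close> before. A proof of
  \<open>no_cross\<close> may therefore use positivity on the whole past.\<close>

lemma first_crossing:
  fixes f :: "real \<Rightarrow> real"
  assumes cont: "continuous_on {a..b} f" and pos: "f a > 0"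
    and no_cross: "\<And>t. a < t \<Longrightarrow> t \<le> b \<Longrightarrow> (\<And>s. a \<le> s \<Longrightarrow> s < t \<Longrightarrow> f s > 0) \<Longrightarrow> f t \<noteq> 0"
    and t: "t \<in> {a..b}"
  shows "f t > 0"
proof (rule ccontr)
  assume "\<not> f t > 0"
  define S where "S = {a..b} \<inter> f -` {..0}"
  have S: "closed S"
    unfolding S_def by (rule continuous_closed_preimage[OF cont]) auto
  have ne: "S \<noteq> {}" using t \<open>\<not> f t > 0\<close> by (auto simp: S_def)
  have bdd: "bdd_below S" by (rule bdd_belowI[of _ a]) (auto simp: S_def)
  define t0 where "t0 = Inf S"
  have "t0 \<in> S" unfolding t0_def by (rule closed_contains_Inf[OF ne bdd S])
  then have t0: "a \<le> t0" "t0 \<le> b" "f t0 \<le> 0" by (auto simp: S_def)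
  have before: "f s > 0" if "a \<le> s" "s < t0" for s
  proof (rule ccontr)
    assume "\<not> f s > 0"
    then have "s \<in> S" using that t0 by (auto simp: S_def)
    then have "t0 \<le> s" unfolding t0_def by (rule cInf_lower[OF _ bdd])
    then show False using that by simp
  qed
  have "a < t0" using t0 pos by (cases "a = t0") auto
  have "f t0 = 0"
  proof (rule ccontr)
    assume "f t0 \<noteq> 0"
    then have "f t0 < 0" using t0 by simp
    then obtain s where "a \<le> s" "s \<le> t0" "f s = 0"
      using IVT2'[of f t0 0 a] pos t0 continuous_on_subset[OF cont, of "{a..t0}"] by auto
    then show False using before[of s] \<open>f t0 < 0\<close> by (cases "s = t0") auto
  qed
  then show False using no_cross[OF \<open>a < t0\<close> t0(2)] before by blast
qed

lemma derivative_nonpos_at_crossing: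
  fixes f :: "real \<Rightarrow> real"
  assumes "(f has_real_derivative l) (at t)" and "a < t" and "\<And>s. a \<le> s \<Longrightarrow> s < t \<Longrightarrow> f s > 0" and "f t = 0"
  shows "l \<le> 0"
proof (rule ccontr)
  assume "\<not> l \<le> 0"
  then obtain d where d: "d > 0" "\<And>h. 0 < h \<Longrightarrow> h < d \<Longrightarrow> f (t - h) < f t"
    using DERIV_pos_inc_left[OF assms(1)] by auto
  define h where "h = min (d / 2) (t - a)"
  have "0 < h" "h < d" "a \<le> t - h" "t - h < t" using d(1) assms(2) by (auto simp: h_def)
  then show False using d(2)[of h] assms(3)[of "t - h"] assms(4) by simp
qed

text \<open>Integrating an exponential majorant gains the factor \<open>1 / l\<close>, so a large
  \<open>l\<close> makes the increment small compared with the majorant. This takes the place of a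
  Gronwall inequality.\<close>

lemma has_integral_exp_bound:
  fixes f :: "real \<Rightarrow> 'a::euclidean_space"
  assumes f: "(f has_integral I) {0..t}" and t: "0 \<le> t" and l: "l > 0"
    and le: "\<And>s. s \<in> {0..t} \<Longrightarrow> norm (f s) \<le> k * exp (l * s)"
  shows "norm I \<le> k / l * (exp (l * t) - 1)"
proof -
  have g: "((\<lambda>s. k * exp (l * s)) has_integral (k / l * exp (l * t) - k / l * exp (l * 0))) {0..t}"
    using l by (intro fundamental_theorem_of_calculus t)
      (auto intro!: derivative_eq_intros simp flip: has_real_derivative_iff_has_vector_derivative)
  have "norm (integral {0..t} f) \<le> integral {0..t} (\<lambda>s. k * exp (l * s))"
    using f g le by (intro integral_norm_bound_integral) (auto simp: has_integral_integrable)
  then show ?thesis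
    unfolding integral_unique[OF f] integral_unique[OF g] by (simp add: right_diff_distrib)
qed

lemma continuous_on_atLeastI:
  fixes f :: "real \<Rightarrow> 'a::topological_space"
  assumes "\<And>T. T > a \<Longrightarrow> continuous_on {a..T} f"
  shows "continuous_on {a..} f"
  unfolding continuous_on_eq_continuous_within
proof
  fix t assume t: "t \<in> {a..}"
  have "at t within {a..} = at t within {a..t + 1}"
    by (rule at_within_nhd[of _ "{..<t + 1}"]) auto
  then show "continuous (at t within {a..}) f"
    using assms[of "t + 1"] t by (simp add: continuous_on_eq_continuous_within)
qed

lemma at_within_atLeast:
  fixes t :: real
  assumes "a < t"
  shows "at t within {a..} = at t"
proof (rule at_within_interior)
  show "t \<in> interior {a..}"
    by (rule interiorI[of "{a<..}"]) (use assms in auto)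
qed

lemma positive_definite_lower_bound:
  fixes Q :: "real^'n^'n"
  assumes "positive_definite Q"
  obtains q where "q > 0" "\<And>v. q * (v \<bullet> v) \<le> v \<bullet> (Q *v v)"
proof -
  obtain G H :: "real^'n^'n" where Q: "Q = transpose G ** G" and HG: "H ** G = mat 1"
    using positive_definite_factor[OF assms] by metis
  define k where "k = (norm H)\<^sup>2 + 1"
  have k: "k > 0" by (simp add: k_def add_nonneg_pos)
  have "v \<bullet> v \<le> k * (v \<bullet> (Q *v v))" for v
  proof -
    have "norm v \<le> norm H * norm (G *v v)"
      using norm_matrix_vector_le[of H "G *v v"] by (simp add: matrix_vector_mul_assoc HG)
    then have "(norm v)\<^sup>2 \<le> (norm H * norm (G *v v))\<^sup>2" by (rule power_mono) simp
    also have "\<dots> \<le> k * (norm (G *v v))\<^sup>2" by (simp add: power_mult_distrib k_def mult_right_mono)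
    finally show ?thesis unfolding gram_form_norm[OF Q] by (simp add: power2_norm_eq_inner)
  qed
  then show ?thesis using k by (intro that[of "1 / k"]) (simp_all add: divide_le_eq mult.commute)
qed

lemma quadratic_form_le: "v \<bullet> ((P::real^'n^'n) *v v) \<le> norm P * (norm v)\<^sup>2"
proof -
  have "v \<bullet> (P *v v) \<le> norm v * norm (P *v v)" by (rule norm_cauchy_schwarz)
  also have "\<dots> \<le> norm v * (norm P * norm v)" by (rule mult_left_mono[OF norm_matrix_vector_le]) simp
  finally show ?thesis by (simp add: power2_eq_square mult_ac)
qed

text \<open>The properties of the schedule, of the family \<open>P\<close> and of the error form on
  which the stability argument rests. \<open>\<gamma>_slow\<close> makes the barriers fall more
  slowly than the nominal decay, \<open>\<gamma>_ratio\<close> compares them across one delay, and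
  \<open>delay_cont\<close> makes trajectories differentiable after time \<open>r\<close>.\<close>

locale delayed_loop =
  fixes A :: "real^'n^'n" and q :: nat and Bi :: "nat \<Rightarrow> real^'m^'n" and B :: "real^'m^'n"
    and C :: "real^'n^'p" and L :: "real^'p^'n" and \<tau> :: "nat \<Rightarrow> real \<Rightarrow> real" and r :: real
    and \<gamma> \<gamma>' :: "real \<Rightarrow> real" and P D :: "real \<Rightarrow> real^'n^'n" and c :: real and N :: nat
    and Q :: "real^'n^'n" and a q0 :: real
  assumes B_sum: "B = (\<Sum>i=1..q. Bi i)"
    and r_pos: "r > 0"
    and delay: "\<And>i t. i \<in> {1..q} \<Longrightarrow> t \<ge> 0 \<Longrightarrow> 0 \<le> \<tau> i t \<and> \<tau> i t \<le> r"
    and delay_cont: "\<And>i. i \<in> {1..q} \<Longrightarrow> continuous_on {0..} (\<tau> i)"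
    and \<gamma>_pos: "\<And>t. t \<ge> 0 \<Longrightarrow> \<gamma> t > 0"
    and \<gamma>_deriv: "\<And>t. t \<ge> 0 \<Longrightarrow> (\<gamma> has_real_derivative \<gamma>' t) (at t within {0..})"
    and \<gamma>_antimono: "\<And>s t. 0 \<le> s \<Longrightarrow> s \<le> t \<Longrightarrow> \<gamma> t \<le> \<gamma> s"
    and \<gamma>_lim: "(\<gamma> \<longlongrightarrow> 0) at_top"
    and \<gamma>_slow: "((\<lambda>t. \<gamma>' t / (\<gamma> t)\<^sup>2) \<longlongrightarrow> 0) at_top"
    and \<gamma>_ratio: "((\<lambda>t. \<gamma> (t - r) / \<gamma> t) \<longlongrightarrow> 1) at_top"
    and riccati: "\<And>g. g > 0 \<Longrightarrow> parametric_lyapunov_solution A B g (P g)"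
    and c_pos: "c > 0"
    and BP_le: "\<And>g v. g > 0 \<Longrightarrow> (norm (transpose B *v (P g *v v)))\<^sup>2 \<le> c * g * (v \<bullet> (P g *v v))"
    and APA_le: "\<And>g v. g > 0 \<Longrightarrow> (A *v v) \<bullet> (P g *v (A *v v)) \<le> c * g\<^sup>2 * (v \<bullet> (P g *v v))"
    and P_deriv: "\<And>g. g > 0 \<Longrightarrow> (P has_vector_derivative D g) (at g)"
    and D_le: "\<And>g v. g > 0 \<Longrightarrow> \<bar>v \<bullet> (D g *v v)\<bar> \<le> c / g * (v \<bullet> (P g *v v))"
    and BD_le: "\<And>g v. g > 0 \<Longrightarrow> (norm (transpose B *v (D g *v v)))\<^sup>2 \<le> c / g * (v \<bullet> (P g *v v))"
    and P_lower: "\<And>g v. 0 < g \<Longrightarrow> g \<le> 1 \<Longrightarrow> g ^ N * (v \<bullet> v) \<le> c * (v \<bullet> (P g *v v))"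
    and P_lim: "(P \<longlongrightarrow> 0) (at_right 0)"
    and Q_sym: "transpose Q = Q" and a_pos: "a > 0" and q0_pos: "q0 > 0"
    and Q_lower: "\<And>v. q0 * (v \<bullet> v) \<le> v \<bullet> (Q *v v)"
    and Q_lyapunov: "\<And>v. 2 * (v \<bullet> (Q *v ((A - L ** C) *v v))) \<le> - a * (v \<bullet> (Q *v v))"
begin

section \<open>Estimates at one instant, for arbitrary vectors\<close>

definition K :: "real \<Rightarrow> real^'n^'m" where "K t = - (transpose B ** P (\<gamma> t))"

definition \<beta> :: real where "\<beta> = (\<Sum>i=1..q. norm (Bi i))"

lemma \<beta>_nonneg: "\<beta> \<ge> 0" unfolding \<beta>_def by (rule sum_nonneg) simp

lemma norm_input_sum_le:
  assumes "\<And>i. i \<in> {1..q} \<Longrightarrow> norm (w i) \<le> k"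
  shows "norm (\<Sum>i=1..q. Bi i *v w i) \<le> \<beta> * k"
proof -
  have "norm (\<Sum>i=1..q. Bi i *v w i) \<le> (\<Sum>i=1..q. norm (Bi i) * k)"
  proof (rule sum_norm_le)
    fix i assume "i \<in> {1..q}"
    then show "norm (Bi i *v w i) \<le> norm (Bi i) * k"
      using norm_matrix_vector_le[of "Bi i" "w i"] mult_left_mono[OF assms, of i "norm (Bi i)"]
      by force
  qed
  then show ?thesis by (simp add: \<beta>_def sum_distrib_right)
qed

lemma P_sym: "g > 0 \<Longrightarrow> transpose (P g) = P g"
  using riccati[of g] by (simp add: parametric_lyapunov_solution_def positive_definite_def)

lemma P_nonneg: "g > 0 \<Longrightarrow> v \<bullet> (P g *v v) \<ge> 0"
  using riccati[of g] by (cases "v = 0")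
    (auto simp: parametric_lyapunov_solution_def positive_definite_def less_imp_le)

lemma P_inner_commute: "g > 0 \<Longrightarrow> v \<bullet> (P g *v w) = w \<bullet> (P g *v v)"
  by (metis P_sym inner_commute inner_matrix_left)

text \<open>Cauchy-Schwarz for the form of \<open>P g\<close> with the vectors
  \<open>P g *v v\<close> and \<open>v\<close>. The factor \<open>norm (P g)\<close> tends to zero
  with \<open>g\<close> and makes the delay terms small.\<close>

lemma norm_P_apply_le:
  assumes g: "g > 0"
  shows "(norm (P g *v v))\<^sup>2 \<le> norm (P g) * (v \<bullet> (P g *v v))"
proof (cases "P g *v v = 0")
  case False
  let ?z = "P g *v v"
  have "((norm ?z)\<^sup>2)\<^sup>2 \<le> (?z \<bullet> (P g *v ?z)) * (v \<bullet> (P g *v v))"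
    using semidefinite_cauchy_schwarz[OF P_sym[OF g] P_nonneg[OF g], of ?z v]
    by (simp add: power2_norm_eq_inner)
  also have "\<dots> \<le> (norm (P g) * (norm ?z)\<^sup>2) * (v \<bullet> (P g *v v))"
    by (rule mult_right_mono[OF quadratic_form_le P_nonneg[OF g]])
  finally have "(norm ?z)\<^sup>2 * (norm ?z)\<^sup>2 \<le> (norm (P g) * (v \<bullet> (P g *v v))) * (norm ?z)\<^sup>2"
    by (simp add: power2_eq_square mult_ac)
  then show ?thesis by (rule mult_right_le_imp_le) (use False in simp)
qed (use P_nonneg[OF g] in simp)

lemma P_form_diff_le:
  assumes g: "g > 0"
  shows "(v - w) \<bullet> (P g *v (v - w)) \<le> 2 * (v \<bullet> (P g *v v)) + 2 * (w \<bullet> (P g *v w))"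
  using P_nonneg[OF g, of "v + w"] P_inner_commute[OF g, of v w]
  by (simp add: matrix_vector_right_distrib matrix_vector_mult_diff_distrib inner_add_left
      inner_add_right inner_diff_left inner_diff_right)

text \<open>Here \<open>f\<close> is the square root of V and the \<open>w i\<close> are the delayed
  inputs, close to the nominal \<open>- B^T P v\<close>. With the nominal input the Riccati equation
  yields the rate \<open>- g * f^2\<close> minus a square. The input deviation and the drift of
  \<open>P\<close> may each use up a quarter of \<open>g * f^2\<close>, so half remains.\<close>

lemma state_form_rate_le:
  assumes g: "g > 0" and f: "f \<ge> 0" "v \<bullet> (P g *v v) = f\<^sup>2" and p: "norm (P g) \<le> p"
    and w: "\<And>i. i \<in> {1..q} \<Longrightarrow> norm (w i + transpose B *v (P g *v v)) \<le> \<sigma> * g * f"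
    and small: "2 * sqrt p * \<beta> * \<sigma> \<le> 1 / 4" and h: "\<bar>h\<bar> \<le> \<epsilon> * g\<^sup>2" "\<epsilon> * c \<le> 1 / 4"
  shows "2 * (v \<bullet> (P g *v (A *v v + (\<Sum>i=1..q. Bi i *v w i)))) + h * (v \<bullet> (D g *v v)) \<le> - (g * f\<^sup>2 / 2)"
proof -
  let ?b = "transpose B *v (P g *v v)"
  have "v \<bullet> ((transpose A ** P g + P g ** A - P g ** B ** transpose B ** P g) *v v)
      = v \<bullet> ((- (g *\<^sub>R P g)) *v v)"
    using riccati[OF g] by (simp add: parametric_lyapunov_solution_def)
  moreover have "v \<bullet> ((transpose A ** P g) *v v) = v \<bullet> (P g *v (A *v v))"
    by (simp add: inner_matrix_right[of v "transpose A"] P_inner_commute[OF g]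
        flip: matrix_vector_mul_assoc)
  moreover have "v \<bullet> ((P g ** B ** transpose B ** P g) *v v) = (norm ?b)\<^sup>2"
    by (simp add: inner_matrix_right[of v "P g"] P_sym[OF g] power2_norm_eq_inner
        inner_matrix_right[of _ B] flip: matrix_vector_mul_assoc)
  moreover have "v \<bullet> ((- (g *\<^sub>R P g)) *v v) = - (g * f\<^sup>2)"
    using f(2) by (simp flip: scaleR_minus_left scaleR_matrix_vector_assoc)
  moreover have "v \<bullet> ((P g ** A) *v v) = v \<bullet> (P g *v (A *v v))"
    by (simp flip: matrix_vector_mul_assoc)
  ultimately have PA: "2 * (v \<bullet> (P g *v (A *v v))) = (norm ?b)\<^sup>2 - g * f\<^sup>2"
    by (simp add: matrix_vector_mult_add_rdistrib matrix_vector_mult_diff_rdistrib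
        inner_add_right inner_diff_right)
  have sumB: "(\<Sum>i=1..q. Bi i *v z) = B *v z" for z
    unfolding B_sum by (induction q) (simp_all add: matrix_vector_mult_add_rdistrib)
  have "(\<Sum>i=1..q. Bi i *v w i) = (\<Sum>i=1..q. Bi i *v (w i + ?b)) - B *v ?b"
    by (simp only: matrix_vector_right_distrib sum.distrib sumB) simp
  then have "v \<bullet> (P g *v (\<Sum>i=1..q. Bi i *v w i))
      = (P g *v v) \<bullet> (\<Sum>i=1..q. Bi i *v (w i + ?b)) - (norm ?b)\<^sup>2"
    by (simp add: inner_matrix_right[of v "P g"] P_sym[OF g] inner_diff_right
        inner_matrix_right[of _ B] power2_norm_eq_inner)
  moreover have "(P g *v v) \<bullet> (\<Sum>i=1..q. Bi i *v (w i + ?b)) \<le> (sqrt p * f) * (\<beta> * (\<sigma> * g * f))"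
  proof -
    have "(norm (P g *v v))\<^sup>2 \<le> norm (P g) * f\<^sup>2" using norm_P_apply_le[OF g, of v] f(2) by simp
    also have "\<dots> \<le> p * f\<^sup>2" by (rule mult_right_mono[OF p]) simp
    finally have "norm (P g *v v) \<le> sqrt (p * f\<^sup>2)" by (rule real_le_rsqrt)
    also have "\<dots> = sqrt p * f" using f(1) by (simp add: real_sqrt_mult)
    finally have "norm (P g *v v) \<le> sqrt p * f" .
    moreover have "norm (\<Sum>i=1..q. Bi i *v (w i + ?b)) \<le> \<beta> * (\<sigma> * g * f)"
      by (rule norm_input_sum_le[OF w])
    moreover have "0 \<le> sqrt p * f"
      using f(1) order_trans[OF norm_ge_zero p] by simp
    ultimately have "norm (P g *v v) * norm (\<Sum>i=1..q. Bi i *v (w i + ?b))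
        \<le> (sqrt p * f) * (\<beta> * (\<sigma> * g * f))"
      by (intro mult_mono) auto
    then show ?thesis using norm_cauchy_schwarz order_trans by blast
  qed
  moreover have "2 * ((sqrt p * f) * (\<beta> * (\<sigma> * g * f))) \<le> 1 / 4 * (g * f\<^sup>2)"
  proof -
    have "0 \<le> g * f\<^sup>2" using g by simp
    from mult_right_mono[OF small this] show ?thesis by (simp add: power2_eq_square mult_ac)
  qed
  moreover have "h * (v \<bullet> (D g *v v)) \<le> 1 / 4 * (g * f\<^sup>2)"
  proof -
    have "h * (v \<bullet> (D g *v v)) \<le> \<bar>h\<bar> * \<bar>v \<bullet> (D g *v v)\<bar>" by (metis abs_ge_self abs_mult)
    also have "\<dots> \<le> (\<epsilon> * g\<^sup>2) * (c / g * f\<^sup>2)"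
      using h(1) D_le[OF g, of v] f(2) by (intro mult_mono) auto
    also have "\<dots> = (\<epsilon> * c) * (g * f\<^sup>2)" using g by (simp add: power2_eq_square)
    also have "\<dots> \<le> 1 / 4 * (g * f\<^sup>2)" by (rule mult_right_mono[OF h(2)]) (use g in simp)
    finally show ?thesis .
  qed
  moreover have "0 \<le> (norm ?b)\<^sup>2" by simp
  moreover have "2 * (v \<bullet> (P g *v (A *v v + (\<Sum>i=1..q. Bi i *v w i))))
      = (norm ?b)\<^sup>2 - g * f\<^sup>2 + 2 * (v \<bullet> (P g *v (\<Sum>i=1..q. Bi i *v w i)))"
    by (simp only: matrix_vector_right_distrib inner_add_right distrib_left PA)
  ultimately show ?thesis by linarith
qed

text \<open>\<open>w\<close> is the total delayed input and \<open>F\<close> stands for \<gamma>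
  times the barrier of V. Young's inequality with weight \<open>a * q0\<close> splits the forcing
  into two terms, each at most a quarter of the decay \<open>a * \<kappa> * F\<close>. The number
  160 is 4 times 4 times 10: both factors 4 stem from this splitting, 10 from the bound on the
  input.\<close>

lemma error_form_rate_le:
  assumes w: "(norm w)\<^sup>2 \<le> 10 * \<beta>\<^sup>2 * c * F" and E: "v \<bullet> (Q *v v) = \<kappa> * F" and F: "F \<ge> 0"
    and \<kappa>: "160 * (norm Q)\<^sup>2 * \<beta>\<^sup>2 * c / (a\<^sup>2 * q0) \<le> \<kappa>"
  shows "2 * (v \<bullet> (Q *v ((A - L ** C) *v v + w))) \<le> - (a / 2) * (\<kappa> * F)"
proof -
  let ?d = "a * q0"
  have d: "?d > 0" using a_pos q0_pos by simp
  have "2 * (v \<bullet> (Q *v w)) \<le> 2 * (norm v * (norm Q * norm w))"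
    using order_trans[OF norm_cauchy_schwarz mult_left_mono[OF norm_matrix_vector_le norm_ge_zero], of v Q w]
    by simp
  also have "\<dots> \<le> ?d / 4 * (norm v)\<^sup>2 + 4 / ?d * (norm Q * norm w)\<^sup>2"
  proof -
    let ?X = "norm v" and ?Y = "norm Q * norm w"
    have "0 \<le> (?d * ?X - 4 * ?Y)\<^sup>2 / (4 * ?d)" using d by simp
    also have "\<dots> = ?d / 4 * ?X\<^sup>2 + 4 / ?d * ?Y\<^sup>2 - 2 * (?X * ?Y)"
      using a_pos q0_pos by (simp add: power2_diff divide_simps) (simp add: power2_eq_square algebra_simps)
    finally show ?thesis by simp
  qed
  also have "?d / 4 * (norm v)\<^sup>2 \<le> a / 4 * (\<kappa> * F)"
    using mult_left_mono[OF Q_lower[of v], of "a / 4"] a_pos E by (simp add: power2_norm_eq_inner)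
  also have "4 / ?d * (norm Q * norm w)\<^sup>2 \<le> a / 4 * (\<kappa> * F)"
  proof -
    have "4 / ?d * (norm Q * norm w)\<^sup>2 \<le> 4 / ?d * ((norm Q)\<^sup>2 * (10 * \<beta>\<^sup>2 * c * F))"
      unfolding power_mult_distrib using d w by (intro mult_left_mono) auto
    also have "\<dots> = a / 4 * (160 * (norm Q)\<^sup>2 * \<beta>\<^sup>2 * c / (a\<^sup>2 * q0) * F)"
      using a_pos q0_pos by (simp add: power2_eq_square[of a])
    also have "\<dots> \<le> a / 4 * (\<kappa> * F)" using mult_right_mono[OF \<kappa> F] a_pos by (intro mult_left_mono) auto
    finally show ?thesis .
  qed
  finally have "2 * (v \<bullet> (Q *v w)) \<le> a / 4 * (\<kappa> * F) + a / 4 * (\<kappa> * F)" by simp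
  moreover have "2 * (v \<bullet> (Q *v ((A - L ** C) *v v))) \<le> - (a * (\<kappa> * F))"
    using Q_lyapunov[of v] E by simp
  ultimately show ?thesis
    unfolding matrix_vector_right_distrib inner_add_right distrib_left by linarith
qed

text \<open>Squared constant for the speed of the feedback signal. The summands belong to the drift
  of \<open>P\<close>, to \<open>A\<close> and to the output injection; 3 comes from squaring a sum
  of three terms, 20 from \<open>h^3 \<le> 4 g^2\<close> and
  \<open>z \<bullet> P z \<le> 5 F\<close>.\<close>

definition input_rate :: "real \<Rightarrow> real" where
  "input_rate \<kappa> = 3 * (20 * c + 20 * c\<^sup>2 + 4 * c * (norm (L ** C))\<^sup>2 * \<kappa> / q0)"

text \<open>\<open>h\<close> is the value of \<gamma> at some time in the delay window and
  \<open>g\<close> the current one, so the bound is expressed by current quantities. The first two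
  terms are of order \<open>h^(3/2)\<close>; the injected error, which carries
  \<open>sqrt h * sqrt g\<close>, decides the order \<open>g\<close>.\<close>

lemma feedback_derivative_le:
  assumes h: "0 < h" "h \<le> 1" "h \<le> 2 * g" and \<kappa>: "\<kappa> \<ge> 0" and F: "F \<ge> 0"
    and h': "\<bar>h'\<bar> \<le> h\<^sup>2" and z: "z \<bullet> (P h *v z) \<le> 5 * F" and e: "(norm e)\<^sup>2 \<le> 2 * \<kappa> * g * F / q0"
    and p: "norm (P h) \<le> 1"
  shows "(norm (transpose B *v (h' *\<^sub>R (D h *v z) + P h *v (A *v z + (L ** C) *v e))))\<^sup>2
    \<le> input_rate \<kappa> * g\<^sup>2 * F"
proof -
  let ?t1 = "h' *\<^sub>R (transpose B *v (D h *v z))" and ?t2 = "transpose B *v (P h *v (A *v z))"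
    and ?t3 = "transpose B *v (P h *v ((L ** C) *v e))"
  have g: "g > 0" using h by linarith
  have h2: "h\<^sup>2 \<le> 4 * g\<^sup>2" using power_mono[OF h(3), of 2] h(1) by (simp add: power_mult_distrib)
  have h3: "h ^ 3 \<le> 4 * g\<^sup>2"
    using h2 mult_right_mono[OF h(2), of "h\<^sup>2"] by (simp add: power3_eq_cube power2_eq_square)
  have t1: "(norm ?t1)\<^sup>2 \<le> 20 * c * g\<^sup>2 * F"
  proof -
    have "(norm ?t1)\<^sup>2 = \<bar>h'\<bar>\<^sup>2 * (norm (transpose B *v (D h *v z)))\<^sup>2"
      by (simp add: power_mult_distrib)
    also have "\<dots> \<le> (h\<^sup>2)\<^sup>2 * (c / h * (5 * F))"
    proof (intro mult_mono power_mono)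
      show "(norm (transpose B *v (D h *v z)))\<^sup>2 \<le> c / h * (5 * F)"
        using BD_le[OF h(1), of z] mult_left_mono[OF z, of "c / h"] c_pos h(1) by simp
    qed (use h' in auto)
    also have "\<dots> = h ^ 3 * (5 * c * F)"
      using h(1) by (simp add: power2_eq_square power3_eq_cube)
    also have "\<dots> \<le> 4 * g\<^sup>2 * (5 * c * F)"
      by (rule mult_right_mono[OF h3]) (use c_pos F in simp)
    finally show ?thesis by (simp add: mult_ac)
  qed
  have t2: "(norm ?t2)\<^sup>2 \<le> 20 * c\<^sup>2 * g\<^sup>2 * F"
  proof -
    have "(norm ?t2)\<^sup>2 \<le> c * h * ((A *v z) \<bullet> (P h *v (A *v z)))" by (rule BP_le[OF h(1)])
    also have "\<dots> \<le> c * h * (c * h\<^sup>2 * (z \<bullet> (P h *v z)))"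
      by (rule mult_left_mono[OF APA_le[OF h(1)]]) (use c_pos h in simp)
    also have "\<dots> \<le> c * h * (c * h\<^sup>2 * (5 * F))"
      by (intro mult_left_mono z) (use c_pos h in simp_all)
    also have "\<dots> = h ^ 3 * (5 * c\<^sup>2 * F)" by (simp add: power2_eq_square power3_eq_cube)
    also have "\<dots> \<le> 4 * g\<^sup>2 * (5 * c\<^sup>2 * F)"
      by (rule mult_right_mono[OF h3]) (use c_pos F in simp)
    finally show ?thesis by (simp add: mult_ac)
  qed
  have t3: "(norm ?t3)\<^sup>2 \<le> 4 * c * (norm (L ** C))\<^sup>2 * \<kappa> / q0 * g\<^sup>2 * F"
  proof -
    let ?y = "(L ** C) *v e"
    have "?y \<bullet> (P h *v ?y) \<le> norm (P h) * (norm ?y)\<^sup>2" by (rule quadratic_form_le)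
    also have "\<dots> \<le> 1 * (norm ?y)\<^sup>2" by (rule mult_right_mono[OF p]) simp
    also have "(norm ?y)\<^sup>2 \<le> (norm (L ** C) * norm e)\<^sup>2"
      by (rule power_mono[OF norm_matrix_vector_le]) simp
    also have "\<dots> \<le> (norm (L ** C))\<^sup>2 * (2 * \<kappa> * g * F / q0)"
      unfolding power_mult_distrib by (rule mult_left_mono[OF e]) simp
    finally have y: "?y \<bullet> (P h *v ?y) \<le> (norm (L ** C))\<^sup>2 * (2 * \<kappa> * g * F / q0)" by simp
    have "(norm ?t3)\<^sup>2 \<le> c * h * (?y \<bullet> (P h *v ?y))" by (rule BP_le[OF h(1)])
    also have "\<dots> \<le> c * (2 * g) * ((norm (L ** C))\<^sup>2 * (2 * \<kappa> * g * F / q0))"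
      by (intro mult_mono y h) (use c_pos h g P_nonneg[OF h(1)] in simp_all)
    finally show ?thesis by (simp add: power2_eq_square[of g] mult_ac)
  qed
  have "transpose B *v (h' *\<^sub>R (D h *v z) + P h *v (A *v z + (L ** C) *v e)) = ?t1 + ?t2 + ?t3"
    by (simp add: matrix_vector_right_distrib matrix_vector_mult_scaleR add.assoc)
  also have "(norm (?t1 + ?t2 + ?t3))\<^sup>2 \<le> 3 * ((norm ?t1)\<^sup>2 + (norm ?t2)\<^sup>2 + (norm ?t3)\<^sup>2)"
  proof -
    let ?a = "norm ?t1" and ?b = "norm ?t2" and ?c = "norm ?t3"
    have "norm (?t1 + ?t2 + ?t3) \<le> ?a + ?b + ?c"
      by (meson add_right_mono norm_triangle_ineq order_trans)
    then have "(norm (?t1 + ?t2 + ?t3))\<^sup>2 \<le> (?a + ?b + ?c)\<^sup>2" by (rule power_mono) simp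
    moreover have "0 \<le> (?a - ?b)\<^sup>2 + (?b - ?c)\<^sup>2 + (?a - ?c)\<^sup>2" by simp
    ultimately show ?thesis by (simp add: power2_eq_square algebra_simps)
  qed
  also have "\<dots> \<le> 3 * (20 * c * g\<^sup>2 * F + 20 * c\<^sup>2 * g\<^sup>2 * F
      + 4 * c * (norm (L ** C))\<^sup>2 * \<kappa> / q0 * g\<^sup>2 * F)"
    by (intro mult_left_mono add_mono t1 t2 t3) simp
  also have "\<dots> = input_rate \<kappa> * g\<^sup>2 * F"
    by (simp add: input_rate_def distrib_left distrib_right)
  finally show ?thesis .
qed

text \<open>The observer state is \<open>v - e\<close>. The condition
  \<open>4 * p * \<kappa> \<le> q0\<close> keeps the form of \<open>e\<close> below
  \<open>F / 2\<close>, and 5 is twice 2 plus twice 1/2.\<close>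

lemma estimate_form_le:
  assumes h: "0 < h" and g: "0 \<le> g" "g \<le> 1" and \<kappa>: "\<kappa> \<ge> 0" "4 * p * \<kappa> \<le> q0" and F: "F \<ge> 0"
    and v: "v \<bullet> (P h *v v) \<le> 2 * F" and e: "(norm e)\<^sup>2 \<le> 2 * \<kappa> * g * F / q0"
    and p: "norm (P h) \<le> p"
  shows "(v - e) \<bullet> (P h *v (v - e)) \<le> 5 * F"
proof -
  have p0: "p \<ge> 0" using p norm_ge_zero order_trans by blast
  have "e \<bullet> (P h *v e) \<le> norm (P h) * (norm e)\<^sup>2" by (rule quadratic_form_le)
  also have "\<dots> \<le> p * (2 * \<kappa> * g * F / q0)" by (intro mult_mono p e p0) simp
  also have "\<dots> = (4 * p * \<kappa> / q0) * (g * (F / 2))" by simp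
  also have "\<dots> \<le> 1 * (1 * (F / 2))"
    using \<kappa> q0_pos p0 F g by (intro mult_mono) auto
  finally have "e \<bullet> (P h *v e) \<le> F / 2" by simp
  then show ?thesis using P_form_diff_le[OF h, of v e] v by linarith
qed


lemma P_\<gamma>_deriv:
  assumes t: "t > 0"
  shows "((\<lambda>t. P (\<gamma> t)) has_vector_derivative \<gamma>' t *\<^sub>R D (\<gamma> t)) (at t)"
proof -
  have "(\<gamma> has_real_derivative \<gamma>' t) (at t)"
    using \<gamma>_deriv[of t] t by (simp add: at_within_atLeast)
  then have "(\<gamma> has_vector_derivative \<gamma>' t) (at t)"
    by (simp only: has_real_derivative_iff_has_vector_derivative)
  from vector_diff_chain_at[OF this P_deriv[OF \<gamma>_pos]] t
  show ?thesis by (simp add: o_def)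
qed

lemma P_\<gamma>_cont: "continuous_on {0..} (\<lambda>t. P (\<gamma> t))"
proof -
  have "continuous_on {0..} \<gamma>"
    unfolding continuous_on_eq_continuous_within using \<gamma>_deriv DERIV_continuous by fastforce
  moreover have "continuous_on {0<..} P"
    using P_deriv has_vector_derivative_continuous
    by (intro continuous_at_imp_continuous_on) fastforce
  ultimately show ?thesis
    using \<gamma>_pos by (intro continuous_on_compose2[of "{0<..}" P "{0..}" \<gamma>]) auto
qed

lemma K_cont: "continuous_on {0..} K"
  unfolding K_def[abs_def]
  by (intro continuous_on_minus bounded_bilinear.continuous_on[OF bounded_bilinear_matrix_matrix_mult]
      continuous_on_const P_\<gamma>_cont)

lemma feedback_eq: "K t *v v = - (transpose B *v (P (\<gamma> t) *v v))"
  unfolding K_def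
  using matrix_vector_mult_diff_rdistrib[of 0 "transpose B ** P (\<gamma> t)" v]
  by (simp add: matrix_vector_mul_assoc)

end

text \<open>\<open>\<eta>\<close> bounds all initial data at once. As a parameter it allows bounds
  that are linear in the size of the data, with constants common to all trajectories.\<close>

locale loop_trajectory = delayed_loop A q Bi B C L \<tau> r \<gamma> \<gamma>' P D c N Q a q0
  for A :: "real^'n^'n" and q and Bi :: "nat \<Rightarrow> real^'m^'n" and B and C :: "real^'n^'p" and L \<tau> r
    \<gamma> \<gamma>' P D c N Q a q0 +
  fixes u0 :: "real \<Rightarrow> real^'m" and x \<xi> :: "real \<Rightarrow> real^'n" and \<eta> :: real
  assumes solution: "closed_loop_solution A q Bi C L \<tau> K u0 x \<xi>"
    and \<eta>_pos: "\<eta> > 0" and x_init: "norm (x 0) \<le> \<eta>" and \<xi>_init: "norm (\<xi> 0) \<le> \<eta>"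
    and history: "\<And>\<theta>. -r \<le> \<theta> \<Longrightarrow> \<theta> < 0 \<Longrightarrow> norm (u0 \<theta>) \<le> \<eta>"
begin

section \<open>Regularity and growth of a closed-loop trajectory\<close>

definition u :: "real \<Rightarrow> real^'m" where "u t = (if t < 0 then u0 t else K t *v \<xi> t)"

definition e :: "real \<Rightarrow> real^'n" where "e t = x t - \<xi> t"

definition x' :: "real \<Rightarrow> real^'n" where "x' s = A *v x s + (\<Sum>i=1..q. Bi i *v u (s - \<tau> i s))"

definition \<xi>' :: "real \<Rightarrow> real^'n" where "\<xi>' t = A *v \<xi> t + (L ** C) *v e t"

lemma x_integral: "t \<ge> 0 \<Longrightarrow> (x' has_integral (x t - x 0)) {0..t}"
  using solution by (simp add: closed_loop_solution_def Let_def x'_def[abs_def] u_def[abs_def])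

lemma \<xi>_deriv: "t \<ge> 0 \<Longrightarrow> (\<xi> has_vector_derivative \<xi>' t) (at t within {0..})"
  using solution
  by (simp add: closed_loop_solution_def Let_def \<xi>'_def e_def matrix_vector_mult_diff_distrib
      flip: matrix_vector_mul_assoc)

lemma \<xi>_cont: "continuous_on {0..} \<xi>"
  unfolding continuous_on_eq_continuous_within
  using \<xi>_deriv has_vector_derivative_continuous by fastforce

lemma x_cont: "continuous_on {0..} x"
proof (rule continuous_on_atLeastI)
  fix T :: real assume T: "T > 0"
  have "continuous_on {0..T} (\<lambda>t. x 0 + integral {0..t} x')"
    by (intro continuous_intros indefinite_integral_continuous_1 has_integral_integrable[OF x_integral])
      (use T in simp)
  moreover have "x 0 + integral {0..t} x' = x t" if "t \<in> {0..T}" for t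
    using integral_unique[OF x_integral[of t]] that by simp
  ultimately show "continuous_on {0..T} x" by (rule continuous_on_eq)
qed

lemma e_cont: "continuous_on {0..} e"
  unfolding e_def[abs_def] by (intro continuous_intros x_cont \<xi>_cont)

text \<open>On the start-up interval \<gamma> need not be small and the history still acts, so the
  trajectory is only compared with an exponential, by means of the integrated equations.\<close>

lemma finite_time_bound:
  assumes k: "\<And>s. s \<in> {0..T} \<Longrightarrow> norm (K s) \<le> k" "k \<ge> 1"
    and c1: "c1 = norm A + \<beta> * k + 2 * norm (L ** C) + 1" and t: "t \<in> {0..T}"
  shows "norm (x t) \<le> 2 * \<eta> * exp (4 * c1 * t)" and "norm (\<xi> t) \<le> 2 * \<eta> * exp (4 * c1 * t)"
proof -
  \<comment> \<open>The rate \<open>4 * c1\<close> is chosen so that integrating a derivative of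
    size \<open>c1 * m\<close> contributes at most \<open>m t / 4\<close>. The initial value
    contributes at most \<open>m t / 2\<close>, so the majorant is never touched.\<close>
  define m where "m s = 2 * \<eta> * exp (4 * c1 * s)" for s
  have c1_pos: "c1 > 0"
    unfolding c1 using \<beta>_nonneg k(2) by (intro add_nonneg_pos add_nonneg_nonneg mult_nonneg_nonneg) auto
  have m_mono: "m s \<le> m s'" if "s \<le> s'" for s s'
    using that c1_pos \<eta>_pos by (simp add: m_def)
  have m0: "m 0 = 2 * \<eta>" by (simp add: m_def)
  define f where "f s = min (m s - norm (x s)) (m s - norm (\<xi> s))" for s
  have "f t > 0"
  proof (rule first_crossing[of 0 T f t])
    show "continuous_on {0..T} f"
      unfolding f_def[abs_def] m_def[abs_def]
      by (intro continuous_intros continuous_on_subset[OF x_cont] continuous_on_subset[OF \<xi>_cont]) auto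
    show "f 0 > 0" using x_init \<xi>_init \<eta>_pos by (simp add: f_def m0)
    show "t \<in> {0..T}" by (rule t)
    fix t assume t: "0 < t" "t \<le> T" and before: "\<And>s. 0 \<le> s \<Longrightarrow> s < t \<Longrightarrow> f s > 0"
    show "f t \<noteq> 0"
    proof
      assume ft: "f t = 0"
      have le: "norm (x s) \<le> m s" "norm (\<xi> s) \<le> m s" if "0 \<le> s" "s \<le> t" for s
        using before[of s] that ft by (cases "s = t"; simp add: f_def min_def split: if_splits)+
      have u_le: "norm (u s') \<le> k * m s" if s: "0 \<le> s" "s \<le> t" "- r \<le> s'" "s' \<le> s" for s s'
      proof (cases "s' < 0")
        case True
        have "norm (u s') \<le> \<eta>" using history[of s'] s True by (simp add: u_def)
        also have "\<dots> \<le> m 0" using \<eta>_pos by (simp add: m0)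
        also have "\<dots> \<le> m s" using s by (intro m_mono)
        also have "\<dots> \<le> k * m s"
          using mult_right_mono[OF k(2), of "m s"] \<eta>_pos by (simp add: m_def)
        finally show ?thesis .
      next
        case False
        have "norm (u s') \<le> norm (K s') * norm (\<xi> s')"
          using False by (simp add: u_def norm_matrix_vector_le)
        also have "\<dots> \<le> k * m s"
          using k False s t le(2)[of s'] m_mono[of s' s] by (intro mult_mono) auto
        finally show ?thesis .
      qed
      have x'_le: "norm (x' s) \<le> (2 * \<eta> * c1) * exp (4 * c1 * s)" if s: "s \<in> {0..t}" for s
      proof -
        have "norm (x' s) \<le> norm (A *v x s) + norm (\<Sum>i=1..q. Bi i *v u (s - \<tau> i s))"
          unfolding x'_def by (rule norm_triangle_ineq)
        also have "norm (A *v x s) \<le> norm A * m s"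
          using norm_matrix_vector_le[of A "x s"] mult_left_mono[OF le(1)[of s], of "norm A"] s by simp
        also have "norm (\<Sum>i=1..q. Bi i *v u (s - \<tau> i s)) \<le> \<beta> * (k * m s)"
        proof (rule norm_input_sum_le)
          fix i assume "i \<in> {1..q}"
          then show "norm (u (s - \<tau> i s)) \<le> k * m s"
            using delay[of i s] s by (intro u_le) auto
        qed
        also have "norm A * m s + \<beta> * (k * m s) \<le> c1 * m s"
          using \<eta>_pos by (simp add: c1 m_def algebra_simps)
        finally show ?thesis by (simp add: m_def mult_ac)
      qed
      have \<xi>'_le: "norm (\<xi>' s) \<le> (2 * \<eta> * c1) * exp (4 * c1 * s)" if s: "s \<in> {0..t}" for s
      proof -
        have "norm (\<xi>' s) \<le> norm (A *v \<xi> s) + norm ((L ** C) *v e s)"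
          unfolding \<xi>'_def by (rule norm_triangle_ineq)
        also have "norm (A *v \<xi> s) \<le> norm A * m s"
          using norm_matrix_vector_le[of A "\<xi> s"] mult_left_mono[OF le(2)[of s], of "norm A"] s by simp
        also have "norm ((L ** C) *v e s) \<le> norm (L ** C) * (2 * m s)"
        proof -
          have "norm (e s) \<le> 2 * m s"
            using norm_triangle_ineq4[of "x s" "\<xi> s"] le[of s] s by (simp add: e_def)
          then show ?thesis
            using norm_matrix_vector_le[of "L ** C" "e s"] by (meson mult_left_mono norm_ge_zero order_trans)
        qed
        also have "norm A * m s + norm (L ** C) * (2 * m s) \<le> c1 * m s"
          using \<eta>_pos \<beta>_nonneg k(2) by (simp add: c1 m_def algebra_simps)
        finally show ?thesis by (simp add: m_def mult_ac)
      qed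
      have quarter: "2 * \<eta> * c1 / (4 * c1) * (exp (4 * c1 * t) - 1) \<le> m t / 4"
        using c1_pos \<eta>_pos by (simp add: m_def algebra_simps)
      have half: "\<eta> \<le> m t / 2" using m_mono[of 0 t] t by (simp add: m0)
      have "norm (x t - x 0) \<le> m t / 4"
        by (rule order_trans[OF has_integral_exp_bound[OF x_integral _ _ x'_le] quarter])
          (use t c1_pos in auto)
      then have "norm (x t) < m t"
        using norm_triangle_ineq[of "x 0" "x t - x 0"] x_init half \<eta>_pos by simp
      moreover have "(\<xi>' has_integral (\<xi> t - \<xi> 0)) {0..t}"
        by (rule fundamental_theorem_of_calculus)
          (use t in \<open>auto intro: has_vector_derivative_within_subset[OF \<xi>_deriv]\<close>)
      then have "norm (\<xi> t - \<xi> 0) \<le> m t / 4"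
        by (intro order_trans[OF has_integral_exp_bound[OF _ _ _ \<xi>'_le] quarter])
          (use t c1_pos in auto)
      then have "norm (\<xi> t) < m t"
        using norm_triangle_ineq[of "\<xi> 0" "\<xi> t - \<xi> 0"] \<xi>_init half \<eta>_pos by simp
      ultimately show False using ft by (simp add: f_def min_def split: if_splits)
    qed
  qed
  then show "norm (x t) \<le> 2 * \<eta> * exp (4 * c1 * t)" "norm (\<xi> t) \<le> 2 * \<eta> * exp (4 * c1 * t)"
    by (simp_all add: f_def m_def)
qed


lemma feedback_deriv:
  assumes t: "t > 0"
  shows "((\<lambda>t. K t *v \<xi> t) has_vector_derivative
    - (transpose B *v (\<gamma>' t *\<^sub>R (D (\<gamma> t) *v \<xi> t) + P (\<gamma> t) *v \<xi>' t))) (at t)"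
proof -
  have "(\<xi> has_vector_derivative \<xi>' t) (at t)"
    using \<xi>_deriv[of t] t by (simp add: at_within_atLeast)
  from has_vector_derivative_matrix_vector_mult[OF P_\<gamma>_deriv[OF t] this]
  have "((\<lambda>t. P (\<gamma> t) *v \<xi> t) has_vector_derivative
      (\<gamma>' t *\<^sub>R (D (\<gamma> t) *v \<xi> t) + P (\<gamma> t) *v \<xi>' t)) (at t)"
    by (simp add: add.commute flip: scaleR_matrix_vector_assoc)
  from bounded_linear.has_vector_derivative[OF matrix_vector_mul_bounded_linear[of "transpose B"] this]
  show ?thesis unfolding feedback_eq[abs_def] by (rule has_vector_derivative_minus)
qed

lemma u_eq: "t \<ge> 0 \<Longrightarrow> u t = K t *v \<xi> t"
  by (simp add: u_def)

text \<open>After time \<open>r\<close> the delayed input no longer sees the history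
  \<open>u0\<close>: the integrand is continuous, so the integrated equation can be
  differentiated.\<close>

lemma x_deriv:
  assumes t: "t > r"
  shows "(x has_vector_derivative x' t) (at t)"
proof -
  define f where "f s = A *v x s + (\<Sum>i=1..q. Bi i *v (K (s - \<tau> i s) *v \<xi> (s - \<tau> i s)))" for s
  have t0: "t > 0" using t r_pos by simp
  have "continuous_on {r..} f"
    unfolding f_def[abs_def]
  proof (intro continuous_on_add continuous_on_sum
      bounded_bilinear.continuous_on[OF bounded_bilinear_matrix_vector_mult] continuous_on_const)
    show "continuous_on {r..} x" by (rule continuous_on_subset[OF x_cont]) (use r_pos in auto)
    fix i assume i: "i \<in> {1..q}"
    have "continuous_on {r..} (\<lambda>s. s - \<tau> i s)"
      using r_pos by (intro continuous_intros continuous_on_subset[OF delay_cont[OF i]]) auto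
    moreover have "(\<lambda>s. s - \<tau> i s) ` {r..} \<subseteq> {0..}"
    proof
      fix y assume "y \<in> (\<lambda>s. s - \<tau> i s) ` {r..}"
      then obtain s where "s \<ge> r" "y = s - \<tau> i s" by auto
      then show "y \<in> {0..}" using delay[OF i, of s] r_pos by simp
    qed
    ultimately show "continuous_on {r..} (\<lambda>s. K (s - \<tau> i s))"
      "continuous_on {r..} (\<lambda>s. \<xi> (s - \<tau> i s))"
      by (auto intro: continuous_on_compose2[OF K_cont] continuous_on_compose2[OF \<xi>_cont])
  qed
  then have "continuous (at t within {r..}) f"
    using t by (simp add: continuous_on_eq_continuous_within)
  then have "isCont f t" using t by (simp add: at_within_atLeast)
  moreover have x'_eq: "x' s = f s" if "s > r" for s
  proof -
    have "u (s - \<tau> i s) = K (s - \<tau> i s) *v \<xi> (s - \<tau> i s)" if "i \<in> {1..q}" for i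
      using delay[OF that, of s] \<open>s > r\<close> r_pos by (intro u_eq) simp
    then show ?thesis unfolding x'_def f_def by (metis (no_types, lifting) sum.cong)
  qed
  then have "eventually (\<lambda>s. x' s = f s) (nhds t)"
    using eventually_nhds_in_open[of "{r<..}" t] t by (auto elim: eventually_mono)
  ultimately have "isCont x' t" using isCont_cong by blast
  then have "((\<lambda>s. integral {0..s} x') has_vector_derivative x' t) (at t within {0..t + 1} - {})"
    using t0 by (intro integral_has_vector_derivative_continuous_at has_integral_integrable[OF x_integral])
      (auto simp: continuous_at_imp_continuous_within)
  then have "((\<lambda>s. integral {0..s} x') has_vector_derivative x' t) (at t)"
    using t0 by (simp add: at_within_Icc_at)
  then have "((\<lambda>s. x 0 + integral {0..s} x') has_vector_derivative 0 + x' t) (at t)"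
    by (intro has_vector_derivative_add has_vector_derivative_const)
  then have "((\<lambda>s. x 0 + integral {0..s} x') has_vector_derivative x' t) (at t)" by simp
  then show ?thesis
  proof (rule has_vector_derivative_transform_within_open[of _ _ _ "{0<..}"])
    show "x 0 + integral {0..s} x' = x s" if "s \<in> {0<..}" for s
      using integral_unique[OF x_integral[of s]] that by simp
  qed (use t0 in auto)
qed

definition V :: "real \<Rightarrow> real" where "V t = x t \<bullet> (P (\<gamma> t) *v x t)"

definition E :: "real \<Rightarrow> real" where "E t = e t \<bullet> (Q *v e t)"

lemma V_deriv:
  assumes t: "t > r"
  shows "(V has_real_derivative
    2 * (x t \<bullet> (P (\<gamma> t) *v x' t)) + \<gamma>' t * (x t \<bullet> (D (\<gamma> t) *v x t))) (at t)"
proof -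
  have t0: "t > 0" using t r_pos by simp
  have "((\<lambda>t. P (\<gamma> t) *v x t) has_vector_derivative
      P (\<gamma> t) *v x' t + (\<gamma>' t *\<^sub>R D (\<gamma> t)) *v x t) (at t)"
    by (rule has_vector_derivative_matrix_vector_mult[OF P_\<gamma>_deriv[OF t0] x_deriv[OF t]])
  from bounded_bilinear.has_vector_derivative[OF bounded_bilinear_inner x_deriv[OF t] this]
  have "(V has_vector_derivative x t \<bullet> (P (\<gamma> t) *v x' t + (\<gamma>' t *\<^sub>R D (\<gamma> t)) *v x t)
      + x' t \<bullet> (P (\<gamma> t) *v x t)) (at t)"
    by (simp add: V_def[abs_def])
  then show ?thesis
    using P_inner_commute[OF \<gamma>_pos, of t "x' t" "x t"] t0
    by (simp add: has_real_derivative_iff_has_vector_derivative inner_add_right algebra_simps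
        flip: scaleR_matrix_vector_assoc)
qed

lemma E_deriv:
  assumes t: "t > r"
  shows "(E has_real_derivative 2 * (e t \<bullet> (Q *v
    ((A - L ** C) *v e t + (\<Sum>i=1..q. Bi i *v u (t - \<tau> i t)))))) (at t)"
proof -
  have t0: "t > 0" using t r_pos by simp
  have "(\<xi> has_vector_derivative \<xi>' t) (at t)"
    using \<xi>_deriv[of t] t0 by (simp add: at_within_atLeast)
  from has_vector_derivative_diff[OF x_deriv[OF t] this]
  have e: "(e has_vector_derivative x' t - \<xi>' t) (at t)" by (simp add: e_def[abs_def])
  from bounded_bilinear.has_vector_derivative[OF bounded_bilinear_inner e
      bounded_linear.has_vector_derivative[OF matrix_vector_mul_bounded_linear[of Q] e]]
  have "(E has_vector_derivative e t \<bullet> (Q *v (x' t - \<xi>' t)) + (x' t - \<xi>' t) \<bullet> (Q *v e t)) (at t)"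
    by (simp add: E_def[abs_def])
  moreover have "(x' t - \<xi>' t) \<bullet> (Q *v e t) = e t \<bullet> (Q *v (x' t - \<xi>' t))"
    by (metis Q_sym inner_commute inner_matrix_left)
  moreover have "x' t - \<xi>' t = (A - L ** C) *v e t + (\<Sum>i=1..q. Bi i *v u (t - \<tau> i t))"
    by (simp add: x'_def \<xi>'_def e_def matrix_vector_mult_diff_rdistrib matrix_vector_mult_diff_distrib)
  ultimately show ?thesis by (simp add: has_real_derivative_iff_has_vector_derivative)
qed

end

section \<open>The barrier argument for V and E\<close>

context loop_trajectory
begin

lemma V_cont: "continuous_on {0..} V"
proof -
  have "continuous_on {0..} (\<lambda>t. P (\<gamma> t))"
    by (rule P_\<gamma>_cont)
  then show ?thesis
    unfolding V_def[abs_def]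
    by (intro continuous_on_inner x_cont
        bounded_bilinear.continuous_on[OF bounded_bilinear_matrix_vector_mult])
qed

lemma E_cont: "continuous_on {0..} E"
  unfolding E_def[abs_def]
  by (intro continuous_on_inner e_cont continuous_on_const
      bounded_bilinear.continuous_on[OF bounded_bilinear_matrix_vector_mult])

lemma input_rate_nonneg: "\<kappa> \<ge> 0 \<Longrightarrow> input_rate \<kappa> \<ge> 0"
  using c_pos q0_pos by (simp add: input_rate_def)

text \<open>The constants are not circular: \<open>\<kappa>\<close>, the ratio of the two barriers
  up to \<gamma>, depends on the system only; \<open>\<sigma>\<close> measures the input deviation
  in terms of \<open>\<kappa>\<close>; \<open>p\<close> is small in terms of both, and
  \<open>\<epsilon>\<close> in terms of \<open>m\<close>, \<open>c\<close> and \<open>a\<close>. The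
  scale \<open>k0\<close> is free, so the size of the data does not influence
  \<open>T\<close>.\<close>

lemma decay_estimate:
  assumes T: "T \<ge> r"
    and late: "\<And>s. s \<ge> T - r \<Longrightarrow> norm (P (\<gamma> s)) \<le> p \<and> \<gamma> s \<le> 1 \<and> \<bar>\<gamma>' s\<bar> \<le> \<epsilon> * (\<gamma> s)\<^sup>2"
    and ratio: "\<And>t. t \<ge> T \<Longrightarrow> (\<gamma> (t - r) / \<gamma> t) ^ Suc m \<le> 2"
    and p: "p \<le> 1" "4 * p * \<kappa> \<le> q0" "2 * sqrt p * \<beta> * \<sigma> \<le> 1 / 4"
    and \<sigma>: "\<sigma> = r * sqrt (input_rate \<kappa>) + sqrt (2 * c * \<kappa> / q0)"
    and \<epsilon>: "\<epsilon> \<le> 1" "\<epsilon> * c \<le> 1 / 4" "real m * \<epsilon> \<le> 1 / 4" "real (Suc m) * \<epsilon> \<le> a / 4"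
    and \<kappa>: "\<kappa> > 0" "160 * (norm Q)\<^sup>2 * \<beta>\<^sup>2 * c / (a\<^sup>2 * q0) \<le> \<kappa>"
    and k0: "k0 > 0"
    and init: "\<And>s. 0 \<le> s \<Longrightarrow> s \<le> T \<Longrightarrow> V s < k0 * \<gamma> s ^ m \<and> E s < \<kappa> * k0 * \<gamma> s ^ Suc m"
    and t: "t \<ge> T"
  shows "V t < k0 * \<gamma> t ^ m \<and> E t < \<kappa> * k0 * \<gamma> t ^ Suc m"
proof -
  define f1 where "f1 t = k0 * \<gamma> t ^ m - V t" for t
  define f2 where "f2 t = \<kappa> * k0 * \<gamma> t ^ Suc m - E t" for t
  define f where "f t = min (f1 t) (f2 t)" for t
  have T0: "T \<ge> 0" using T r_pos by simp
  have \<gamma>_cont: "continuous_on {0..} \<gamma>"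
    unfolding continuous_on_eq_continuous_within using \<gamma>_deriv DERIV_continuous by fastforce
  have "f t > 0"
  proof (rule first_crossing[of T t f t])
    have sub: "{T..t} \<subseteq> {0..}" using T0 by auto
    show "continuous_on {T..t} f"
      unfolding f_def[abs_def] f1_def[abs_def] f2_def[abs_def]
      by (intro continuous_intros continuous_on_subset[OF V_cont sub]
          continuous_on_subset[OF E_cont sub] continuous_on_subset[OF \<gamma>_cont sub])
    show "f T > 0" using init[of T] T0 by (simp add: f_def f1_def f2_def)
    show "t \<in> {T..t}" using t by simp
  next
    fix t assume t: "T < t" and before: "\<And>s. T \<le> s \<Longrightarrow> s < t \<Longrightarrow> f s > 0"
    show "f t \<noteq> 0"
    proof
      assume ft: "f t = 0"
      have tr: "t > r" and t0: "t > 0" using t T r_pos by auto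
      define g where "g = \<gamma> t"
      \<comment> \<open>The current barrier values are \<open>F\<close> for V and
        \<open>\<kappa> * g * F\<close> for E.\<close>
      define F where "F = k0 * g ^ m"
      have g: "0 < g" "g \<le> 1" using \<gamma>_pos[of t] late[of t] t t0 r_pos by (auto simp: g_def)
      have F: "F > 0" using k0 g by (simp add: F_def)
      have pre: "f1 s > 0 \<and> f2 s > 0" if "0 \<le> s" "s < t" for s
      proof (cases "s \<le> T")
        case True
        then show ?thesis using init[of s] that by (simp add: f1_def f2_def)
      next
        case False
        then show ?thesis using before[of s] that by (simp add: f_def)
      qed
      have VE: "V s \<le> k0 * \<gamma> s ^ m" "E s \<le> \<kappa> * k0 * \<gamma> s ^ Suc m" if "0 \<le> s" "s \<le> t" for s
      proof -
        have "f1 s \<ge> 0 \<and> f2 s \<ge> 0"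
        proof (cases "s = t")
          case True
          then show ?thesis using ft by (simp add: f_def min_def split: if_splits)
        next
          case False
          then show ?thesis using pre[of s] that by simp
        qed
        then show "V s \<le> k0 * \<gamma> s ^ m" "E s \<le> \<kappa> * k0 * \<gamma> s ^ Suc m" by (simp_all add: f1_def f2_def)
      qed
      \<comment> \<open>Within one delay \<gamma> exceeds its current value at most by a factor
        \<open>\<rho>\<close> with \<open>\<rho> ^ Suc m \<le> 2\<close>, so the barriers in the
        window are at most twice the current ones. This is the Razumikhin-type information about the
        past.\<close>
      have window: "0 < \<gamma> s" "\<gamma> s \<le> 2 * g" "V s \<le> 2 * F" "E s \<le> 2 * \<kappa> * g * F"
        if s: "t - r \<le> s" "s \<le> t" for s
      proof -
        have s0: "s \<ge> 0" "t - r \<ge> 0" using s tr by auto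
        define \<rho> where "\<rho> = \<gamma> (t - r) / g"
        have \<rho>1: "\<rho> \<ge> 1" using \<gamma>_antimono[of "t - r" t] s0 r_pos g by (simp add: \<rho>_def g_def)
        have \<rho>S: "\<rho> ^ Suc m \<le> 2" using ratio[of t] t by (simp add: \<rho>_def g_def)
        have \<rho>m: "\<rho> ^ m \<le> 2"
          by (rule order_trans[OF power_increasing \<rho>S]) (use \<rho>1 in auto)
        have \<rho>: "\<rho> \<le> 2"
          using order_trans[OF power_increasing[of 1 "Suc m" \<rho>] \<rho>S] \<rho>1 by simp
        show gs: "0 < \<gamma> s" using \<gamma>_pos s0 by simp
        have le: "\<gamma> s \<le> \<rho> * g" using \<gamma>_antimono[of "t - r" s] s0 s g by (simp add: \<rho>_def)
        also have "\<dots> \<le> 2 * g" using \<rho> g by simp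
        finally show "\<gamma> s \<le> 2 * g" .
        have "V s \<le> k0 * \<gamma> s ^ m" by (rule VE) (use s s0 in auto)
        also have "\<dots> \<le> k0 * (\<rho> * g) ^ m" using le gs k0 by (intro mult_left_mono power_mono) auto
        also have "\<dots> = \<rho> ^ m * F" by (simp add: F_def power_mult_distrib)
        also have "\<dots> \<le> 2 * F" by (rule mult_right_mono[OF \<rho>m]) (use F in simp)
        finally show "V s \<le> 2 * F" .
        have "E s \<le> \<kappa> * k0 * \<gamma> s ^ Suc m" by (rule VE) (use s s0 in auto)
        also have "\<dots> \<le> \<kappa> * k0 * (\<rho> * g) ^ Suc m"
          using le gs k0 \<kappa>(1) by (intro mult_left_mono power_mono) auto
        also have "\<dots> = \<rho> ^ Suc m * (\<kappa> * g * F)" by (simp add: F_def power_mult_distrib)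
        also have "\<dots> \<le> 2 * (\<kappa> * g * F)" by (rule mult_right_mono[OF \<rho>S]) (use F g \<kappa> in simp)
        finally show "E s \<le> 2 * \<kappa> * g * F" by simp
      qed
      have late': "norm (P (\<gamma> s)) \<le> p" "\<gamma> s \<le> 1" "\<bar>\<gamma>' s\<bar> \<le> \<epsilon> * (\<gamma> s)\<^sup>2" if "t - r \<le> s" for s
        using late[of s] that t by auto
      have e_le: "(norm (e s))\<^sup>2 \<le> 2 * \<kappa> * g * F / q0" if "t - r \<le> s" "s \<le> t" for s
        using Q_lower[of "e s"] window(4)[OF that] q0_pos
        by (simp add: E_def power2_norm_eq_inner le_divide_eq mult.commute)
      have z_le: "\<xi> s \<bullet> (P (\<gamma> s) *v \<xi> s) \<le> 5 * F" if s: "t - r \<le> s" "s \<le> t" for s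
        using estimate_form_le[OF window(1)[OF s] less_imp_le[OF g(1)] g(2) less_imp_le[OF \<kappa>(1)] p(2)
            less_imp_le[OF F] _ e_le[OF s] late'(1)[OF s(1)], of "x s"] window(3)[OF s]
        by (simp add: V_def e_def)
      have delayed: "t - r \<le> t - \<tau> i t" "t - \<tau> i t \<le> t" if "i \<in> {1..q}" for i
        using delay[OF that, of t] t0 by auto
      have d\<gamma>: "(\<gamma> has_real_derivative \<gamma>' t) (at t)"
        using \<gamma>_deriv[of t] t0 by (simp add: at_within_atLeast)
      have d_power: "((\<lambda>t. k * \<gamma> t ^ j) has_real_derivative k * (real j * g ^ (j - 1) * \<gamma>' t)) (at t)" for k j
        using DERIV_cmult[OF DERIV_power[OF d\<gamma>], of k j] by (simp add: g_def mult_ac)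
      \<comment> \<open>A barrier \<open>k * \<gamma>^j\<close> falls at a relative rate of at most
        \<open>j * \<epsilon> * g\<close>.\<close>
      have rate: "- (real j * \<epsilon> * (g * (k * g ^ j))) \<le> k * (real j * g ^ (j - 1) * \<gamma>' t)"
        if "k \<ge> 0" for j k
      proof (cases j)
        case (Suc i)
        have "- \<gamma>' t \<le> \<epsilon> * g\<^sup>2" using late'(3)[of t] r_pos by (simp add: g_def)
        then have "k * real j * g ^ i * - \<gamma>' t \<le> k * real j * g ^ i * (\<epsilon> * g\<^sup>2)"
          using that g by (intro mult_left_mono) auto
        then show ?thesis by (simp add: Suc power2_eq_square mult_ac)
      qed simp
      have "f1 t = 0 \<or> f2 t = 0" using ft by (auto simp: f_def min_def split: if_splits)
      then show False
      proof
        assume f1: "f1 t = 0"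
        define y where "y = sqrt F"
        have y: "y \<ge> 0" "y\<^sup>2 = F" using F by (auto simp: y_def)
        have Vt: "x t \<bullet> (P g *v x t) = y\<^sup>2" using f1 by (simp add: f1_def V_def F_def y(2) g_def)
        \<comment> \<open>The deviation from the nominal input has two sources: the change of the
          feedback \<open>w\<close> over a time of at most \<open>r\<close>, and the use of
          \<open>\<xi>\<close> in place of \<open>x\<close>. They give the two summands of
          \<open>\<sigma>\<close>.\<close>
        have input: "norm (u (t - \<tau> i t) + transpose B *v (P g *v x t)) \<le> \<sigma> * g * y"
          if i: "i \<in> {1..q}" for i
        proof -
          define s0 where "s0 = t - \<tau> i t"
          have s0: "t - r \<le> s0" "s0 \<le> t" "s0 \<ge> 0" using delayed[OF i] tr by (auto simp: s0_def)
          define w where "w s = K s *v \<xi> s" for s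
          define k where "k = sqrt (input_rate \<kappa>) * g * y"
          have k_nonneg: "k \<ge> 0" using g y input_rate_nonneg[of \<kappa>] \<kappa>(1) by (simp add: k_def)
          have "norm (w t - w s0) \<le> r * k"
          proof (cases "s0 = t")
            case False
            then have "s0 < t" using s0 by simp
            then have "norm (w t - w s0) \<le> k * t - k * s0"
            proof (rule differentiable_bound_general)
              have sub: "{s0..t} \<subseteq> {0..}" using s0 by auto
              show "continuous_on {s0..t} w"
                unfolding w_def[abs_def]
                by (intro bounded_bilinear.continuous_on[OF bounded_bilinear_matrix_vector_mult]
                    continuous_on_subset[OF K_cont sub] continuous_on_subset[OF \<xi>_cont sub])
              show "continuous_on {s0..t} ((*) k)" by (intro continuous_intros)
              fix s assume s: "s0 < s" "s < t"
              then have s': "t - r \<le> s" "s \<le> t" "s > 0" using s0 by auto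
              show "(w has_vector_derivative - (transpose B *v
                  (\<gamma>' s *\<^sub>R (D (\<gamma> s) *v \<xi> s) + P (\<gamma> s) *v \<xi>' s))) (at s)"
                unfolding w_def[abs_def] by (rule feedback_deriv[OF s'(3)])
              show "((*) k has_vector_derivative k) (at s)"
                by (auto intro!: derivative_eq_intros simp flip: has_real_derivative_iff_has_vector_derivative)
              have "\<bar>\<gamma>' s\<bar> \<le> (\<gamma> s)\<^sup>2"
                using late'(3)[OF s'(1)] mult_right_mono[OF \<epsilon>(1), of "(\<gamma> s)\<^sup>2"] by simp
              then have "(norm (transpose B *v
                  (\<gamma>' s *\<^sub>R (D (\<gamma> s) *v \<xi> s) + P (\<gamma> s) *v \<xi>' s)))\<^sup>2 \<le> input_rate \<kappa> * g\<^sup>2 * F"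
                unfolding \<xi>'_def using s' late'[OF s'(1)] \<kappa>(1) F p(1)
                by (intro feedback_derivative_le window z_le e_le) auto
              also have "\<dots> = k\<^sup>2"
                using input_rate_nonneg[of \<kappa>] \<kappa>(1) by (simp add: k_def power_mult_distrib y(2))
              finally have "norm (transpose B *v
                  (\<gamma>' s *\<^sub>R (D (\<gamma> s) *v \<xi> s) + P (\<gamma> s) *v \<xi>' s)) \<le> k"
                using k_nonneg by (rule power2_le_imp_le)
              then show "norm (- (transpose B *v
                  (\<gamma>' s *\<^sub>R (D (\<gamma> s) *v \<xi> s) + P (\<gamma> s) *v \<xi>' s))) \<le> k" by simp
            qed
            also have "\<dots> = (t - s0) * k" by (simp add: algebra_simps)
            also have "\<dots> \<le> r * k" using s0 k_nonneg by (intro mult_right_mono) auto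
            finally show ?thesis .
          qed (use r_pos k_nonneg in simp)
          moreover have "norm (transpose B *v (P g *v e t)) \<le> sqrt (2 * c * \<kappa> / q0) * g * y"
          proof (rule power2_le_imp_le)
            have "(norm (transpose B *v (P g *v e t)))\<^sup>2 \<le> c * g * (e t \<bullet> (P g *v e t))"
              by (rule BP_le[OF g(1)])
            also have "e t \<bullet> (P g *v e t) \<le> norm (P g) * (norm (e t))\<^sup>2" by (rule quadratic_form_le)
            also have "\<dots> \<le> 1 * (2 * \<kappa> * g * F / q0)"
              using late'(1)[of t] p(1) r_pos e_le[of t] by (intro mult_mono) (auto simp: g_def)
            finally have "(norm (transpose B *v (P g *v e t)))\<^sup>2 \<le> c * g * (1 * (2 * \<kappa> * g * F / q0))"
              using c_pos g by simp
            also have "\<dots> = (sqrt (2 * c * \<kappa> / q0) * g * y)\<^sup>2"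
              using c_pos \<kappa>(1) q0_pos by (simp add: power_mult_distrib y(2) power2_eq_square[of g])
            finally show "(norm (transpose B *v (P g *v e t)))\<^sup>2 \<le> (sqrt (2 * c * \<kappa> / q0) * g * y)\<^sup>2" .
            show "0 \<le> sqrt (2 * c * \<kappa> / q0) * g * y" using c_pos \<kappa>(1) q0_pos g y by simp
          qed
          moreover have "u s0 + transpose B *v (P g *v x t) = - (w t - w s0) + transpose B *v (P g *v e t)"
            using s0(3) by (simp add: u_eq w_def feedback_eq[of t] e_def g_def matrix_vector_mult_diff_distrib)
          ultimately have "norm (u s0 + transpose B *v (P g *v x t))
              \<le> r * k + sqrt (2 * c * \<kappa> / q0) * g * y"
            using norm_triangle_ineq[of "- (w t - w s0)" "transpose B *v (P g *v e t)"] by (simp only: norm_minus_cancel)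
          then show ?thesis by (simp add: s0_def[symmetric] \<sigma> k_def algebra_simps)
        qed
        \<comment> \<open>V falls at least at rate \<open>g * F / 2\<close> and its barrier at most
          at \<open>g * F / 4\<close>, so \<open>f1\<close> would have a positive derivative at its
          first zero.\<close>
        have "2 * (x t \<bullet> (P g *v x' t)) + \<gamma>' t * (x t \<bullet> (D g *v x t)) \<le> - (g * y\<^sup>2 / 2)"
          unfolding x'_def using late'[of t] r_pos
          by (intro state_form_rate_le[OF g(1) y(1) Vt _ input p(3) _ \<epsilon>(2)]) (auto simp: g_def)
        moreover have "(f1 has_real_derivative k0 * (real m * g ^ (m - 1) * \<gamma>' t)
            - (2 * (x t \<bullet> (P g *v x' t)) + \<gamma>' t * (x t \<bullet> (D g *v x t)))) (at t)"
          using DERIV_diff[OF d_power V_deriv[OF tr], of k0 m] by (simp only: f1_def[abs_def] g_def)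
        then have "k0 * (real m * g ^ (m - 1) * \<gamma>' t)
            - (2 * (x t \<bullet> (P g *v x' t)) + \<gamma>' t * (x t \<bullet> (D g *v x t))) \<le> 0"
          by (rule derivative_nonpos_at_crossing[OF _ t0]) (use pre f1 in auto)
        moreover have "real m * \<epsilon> * (g * F) \<le> 1 / 4 * (g * F)"
          by (rule mult_right_mono[OF \<epsilon>(3)]) (use g F in simp)
        moreover have "- (real m * \<epsilon> * (g * F)) \<le> k0 * (real m * g ^ (m - 1) * \<gamma>' t)"
          unfolding F_def by (rule rate) (use k0 in simp)
        moreover have "g * F > 0" using g F by simp
        ultimately show False unfolding y(2) by linarith
      next
        assume f2: "f2 t = 0"
        define G where "G = g * F"
        have G: "G > 0" using g F by (simp add: G_def)
        have Et: "e t \<bullet> (Q *v e t) = \<kappa> * G"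
          using f2 by (simp add: f2_def E_def F_def G_def g_def mult_ac)
        have "(norm (\<Sum>i=1..q. Bi i *v u (t - \<tau> i t)))\<^sup>2 \<le> 10 * \<beta>\<^sup>2 * c * G"
        proof -
          have "norm (u (t - \<tau> i t)) \<le> sqrt (10 * c * G)" if i: "i \<in> {1..q}" for i
          proof (rule real_le_rsqrt)
            define s where "s = t - \<tau> i t"
            have s: "t - r \<le> s" "s \<le> t" "s \<ge> 0" using delayed[OF i] tr by (auto simp: s_def)
            have "(norm (u s))\<^sup>2 = (norm (transpose B *v (P (\<gamma> s) *v \<xi> s)))\<^sup>2"
              by (simp add: u_eq[OF s(3)] feedback_eq)
            also have "\<dots> \<le> c * \<gamma> s * (\<xi> s \<bullet> (P (\<gamma> s) *v \<xi> s))" by (rule BP_le[OF window(1)[OF s(1,2)]])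
            also have "\<dots> \<le> c * (2 * g) * (5 * F)"
              using window(1,2)[OF s(1,2)] z_le[OF s(1,2)] c_pos g P_nonneg[OF window(1)[OF s(1,2)]]
              by (intro mult_mono) auto
            finally show "(norm (u (t - \<tau> i t)))\<^sup>2 \<le> 10 * c * G" by (simp add: s_def G_def)
          qed
          then have "norm (\<Sum>i=1..q. Bi i *v u (t - \<tau> i t)) \<le> \<beta> * sqrt (10 * c * G)"
            by (rule norm_input_sum_le)
          then have "(norm (\<Sum>i=1..q. Bi i *v u (t - \<tau> i t)))\<^sup>2 \<le> (\<beta> * sqrt (10 * c * G))\<^sup>2"
            by (rule power_mono) simp
          then show ?thesis using c_pos G by (simp add: power_mult_distrib mult_ac)
        qed
        \<comment> \<open>E falls at least at \<open>a / 2 * (\<kappa> * G)\<close> and its barrier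
          at most at \<open>a / 4 * (\<kappa> * G)\<close>. The error decays at a fixed rate, so the
          bound \<open>g \<le> 1\<close> suffices here.\<close>
        from error_form_rate_le[OF this Et less_imp_le[OF G] \<kappa>(2)]
        have "2 * (e t \<bullet> (Q *v ((A - L ** C) *v e t + (\<Sum>i=1..q. Bi i *v u (t - \<tau> i t)))))
            \<le> - (a / 2) * (\<kappa> * G)" .
        moreover have "(f2 has_real_derivative \<kappa> * k0 * (real (Suc m) * g ^ (Suc m - 1) * \<gamma>' t)
            - 2 * (e t \<bullet> (Q *v ((A - L ** C) *v e t + (\<Sum>i=1..q. Bi i *v u (t - \<tau> i t)))))) (at t)"
          using DERIV_diff[OF d_power E_deriv[OF tr], of "\<kappa> * k0" "Suc m"]
          by (simp only: f2_def[abs_def] g_def)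
        then have "\<kappa> * k0 * (real (Suc m) * g ^ (Suc m - 1) * \<gamma>' t)
            - 2 * (e t \<bullet> (Q *v ((A - L ** C) *v e t + (\<Sum>i=1..q. Bi i *v u (t - \<tau> i t))))) \<le> 0"
          by (rule derivative_nonpos_at_crossing[OF _ t0]) (use pre f2 in auto)
        moreover have "real (Suc m) * \<epsilon> * (g * (\<kappa> * G)) \<le> a / 4 * (1 * (\<kappa> * G))"
          using \<epsilon>(4) g \<kappa>(1) G a_pos by (intro mult_mono) auto
        moreover have "- (real (Suc m) * \<epsilon> * (g * (\<kappa> * G)))
            \<le> \<kappa> * k0 * (real (Suc m) * g ^ (Suc m - 1) * \<gamma>' t)"
          using rate[of "\<kappa> * k0" "Suc m"] \<kappa>(1) k0 by (simp add: G_def F_def mult_ac)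
        moreover have "a * (\<kappa> * G) > 0" using a_pos \<kappa>(1) G by simp
        ultimately show False by linarith
      qed
    qed
  qed
  then show ?thesis by (simp add: f_def f1_def f2_def)
qed

end

section \<open>Constants uniform over all trajectories\<close>

context delayed_loop
begin

lemma eventually_small_gain:
  assumes "p > 0" and "\<epsilon> > 0"
  obtains T where "T \<ge> 0"
    "\<And>s. s \<ge> T \<Longrightarrow> norm (P (\<gamma> s)) \<le> p \<and> \<gamma> s \<le> 1 \<and> \<bar>\<gamma>' s\<bar> \<le> \<epsilon> * (\<gamma> s)\<^sup>2"
proof -
  have pos: "eventually (\<lambda>s. \<gamma> s > 0) at_top"
    using eventually_ge_at_top[of 0] by eventually_elim (rule \<gamma>_pos)
  have "filterlim \<gamma> (at_right 0) at_top"
    by (rule tendsto_imp_filterlim_at_right[OF \<gamma>_lim pos])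
  from filterlim_compose[OF P_lim this] have "((\<lambda>s. P (\<gamma> s)) \<longlongrightarrow> 0) at_top" .
  from tendstoD[OF this assms(1)]
  have "eventually (\<lambda>s. norm (P (\<gamma> s)) < p) at_top" by simp
  moreover have "eventually (\<lambda>s. \<gamma> s < 1) at_top"
    by (rule order_tendstoD[OF \<gamma>_lim]) simp
  moreover from tendstoD[OF \<gamma>_slow assms(2)]
  have "eventually (\<lambda>s. \<bar>\<gamma>' s / (\<gamma> s)\<^sup>2\<bar> < \<epsilon>) at_top" by simp
  ultimately have "eventually (\<lambda>s. norm (P (\<gamma> s)) \<le> p \<and> \<gamma> s \<le> 1 \<and> \<bar>\<gamma>' s\<bar> \<le> \<epsilon> * (\<gamma> s)\<^sup>2) at_top"
    using pos by eventually_elim (auto simp: divide_less_eq)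
  then obtain T where T: "\<And>s. s \<ge> T \<Longrightarrow>
      norm (P (\<gamma> s)) \<le> p \<and> \<gamma> s \<le> 1 \<and> \<bar>\<gamma>' s\<bar> \<le> \<epsilon> * (\<gamma> s)\<^sup>2"
    unfolding eventually_at_top_linorder by blast
  show ?thesis by (rule that[of "max T 0"]) (use T in auto)
qed

lemma eventually_ratio:
  obtains T where "\<And>t. t \<ge> T \<Longrightarrow> (\<gamma> (t - r) / \<gamma> t) ^ m \<le> 2"
proof -
  have "((\<lambda>t. (\<gamma> (t - r) / \<gamma> t) ^ m) \<longlongrightarrow> 1 ^ m) at_top"
    by (intro tendsto_power \<gamma>_ratio)
  then have "eventually (\<lambda>t. (\<gamma> (t - r) / \<gamma> t) ^ m < 2) at_top"
    by (rule order_tendstoD) simp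
  then show ?thesis
    unfolding eventually_at_top_linorder using that less_imp_le by blast
qed

text \<open>\<open>M\<close> and \<open>T\<close> are fixed before the trajectory. The first bound
  joins the exponential growth up to \<open>T\<close> with the barrier estimate afterwards and gives
  stability; the second gives attractivity.\<close>

lemma uniform_estimate:
  obtains M T where "M > 0" "T \<ge> 0"
    "\<And>u0 x \<xi> \<eta> t. loop_trajectory A q Bi B C L \<tau> r \<gamma> \<gamma>' P D c N Q a q0 u0 x \<xi> \<eta> \<Longrightarrow> 0 \<le> t \<Longrightarrow>
       norm (x t) + norm (\<xi> t) \<le> M * \<eta>"
    "\<And>u0 x \<xi> \<eta> t. loop_trajectory A q Bi B C L \<tau> r \<gamma> \<gamma>' P D c N Q a q0 u0 x \<xi> \<eta> \<Longrightarrow> T \<le> t \<Longrightarrow>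
       norm (x t) + norm (\<xi> t) \<le> M * \<eta> * sqrt (\<gamma> t)"
proof -
  \<comment> \<open>Recovering \<open>norm (x t)\<close> from V costs \<open>g ^ N\<close> by
    \<open>P_lower\<close>; the additional power leaves a factor \<open>g\<close> that tends to
    zero.\<close>
  define m where "m = Suc N"
  define \<kappa> where "\<kappa> = 160 * (norm Q)\<^sup>2 * \<beta>\<^sup>2 * c / (a\<^sup>2 * q0) + 1"
  have \<kappa>: "\<kappa> > 0" "160 * (norm Q)\<^sup>2 * \<beta>\<^sup>2 * c / (a\<^sup>2 * q0) \<le> \<kappa>"
    using c_pos q0_pos by (auto simp: \<kappa>_def intro!: add_nonneg_pos divide_nonneg_nonneg mult_nonneg_nonneg)
  define \<sigma> where "\<sigma> = r * sqrt (input_rate \<kappa>) + sqrt (2 * c * \<kappa> / q0)"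
  have \<sigma>: "\<sigma> \<ge> 0"
    using c_pos q0_pos \<kappa>(1) r_pos by (simp add: \<sigma>_def input_rate_def)
  define p where "p = min 1 (min (q0 / (4 * \<kappa>)) ((1 / (8 * (\<beta> * \<sigma> + 1)))\<^sup>2))"
  have \<beta>\<sigma>: "\<beta> * \<sigma> \<ge> 0" using \<beta>_nonneg \<sigma> by simp
  have p0: "p > 0" using q0_pos \<kappa>(1) \<beta>\<sigma> by (simp add: p_def)
  have p1: "p \<le> 1" by (simp add: p_def)
  have p2: "4 * p * \<kappa> \<le> q0"
  proof -
    have "p \<le> q0 / (4 * \<kappa>)" by (simp add: p_def)
    then show ?thesis using \<kappa>(1) by (simp add: field_simps)
  qed
  have p3: "2 * sqrt p * \<beta> * \<sigma> \<le> 1 / 4"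
  proof -
    have "sqrt p \<le> 1 / (8 * (\<beta> * \<sigma> + 1))"
      by (rule real_le_lsqrt) (use \<beta>\<sigma> p0 in \<open>auto simp: p_def\<close>)
    then have "2 * sqrt p * (\<beta> * \<sigma>) \<le> 2 * (1 / (8 * (\<beta> * \<sigma> + 1))) * (\<beta> * \<sigma>)"
      using \<beta>\<sigma> by (intro mult_right_mono mult_left_mono) auto
    also have "\<dots> \<le> 1 / 4" using \<beta>\<sigma> by (simp add: divide_le_eq)
    finally show ?thesis by (simp add: mult.assoc)
  qed
  define \<epsilon> where "\<epsilon> = min 1 (min (1 / (4 * c)) (min (1 / (4 * real (Suc m))) (a / (4 * real (Suc m)))))"
  have \<epsilon>0: "\<epsilon> > 0" using c_pos a_pos by (simp add: \<epsilon>_def)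
  have \<epsilon>1: "\<epsilon> \<le> 1" by (simp add: \<epsilon>_def)
  have \<epsilon>2: "\<epsilon> * c \<le> 1 / 4"
  proof -
    have "\<epsilon> \<le> 1 / (4 * c)" by (simp add: \<epsilon>_def)
    then show ?thesis using c_pos by (simp add: field_simps)
  qed
  have \<epsilon>3: "real m * \<epsilon> \<le> 1 / 4"
  proof -
    have "\<epsilon> \<le> 1 / (4 * real (Suc m))" by (simp add: \<epsilon>_def)
    then have "real (Suc m) * \<epsilon> \<le> 1 / 4" by (simp add: field_simps del: of_nat_Suc)
    then show ?thesis using \<epsilon>0 by (simp add: algebra_simps)
  qed
  have \<epsilon>4: "real (Suc m) * \<epsilon> \<le> a / 4"
  proof -
    have "\<epsilon> \<le> a / (4 * real (Suc m))" by (simp add: \<epsilon>_def)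
    then show ?thesis by (simp add: field_simps del: of_nat_Suc)
  qed
  obtain T1 where T1: "T1 \<ge> 0"
    "\<And>s. s \<ge> T1 \<Longrightarrow> norm (P (\<gamma> s)) \<le> p \<and> \<gamma> s \<le> 1 \<and> \<bar>\<gamma>' s\<bar> \<le> \<epsilon> * (\<gamma> s)\<^sup>2"
    using eventually_small_gain[OF p0 \<epsilon>0] by blast
  obtain T2 where T2: "\<And>t. t \<ge> T2 \<Longrightarrow> (\<gamma> (t - r) / \<gamma> t) ^ Suc m \<le> 2"
    using eventually_ratio by blast
  define T where "T = max (T1 + r) T2"
  have T: "T \<ge> r" "T \<ge> 0" using T1(1) r_pos by (auto simp: T_def)
  have late: "norm (P (\<gamma> s)) \<le> p \<and> \<gamma> s \<le> 1 \<and> \<bar>\<gamma>' s\<bar> \<le> \<epsilon> * (\<gamma> s)\<^sup>2" if "s \<ge> T - r" for s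
    using T1(2)[of s] that by (auto simp: T_def)
  have ratio: "(\<gamma> (t - r) / \<gamma> t) ^ Suc m \<le> 2" if "t \<ge> T" for t
    using T2[of t] that by (auto simp: T_def)
  have "bounded ((\<lambda>t. P (\<gamma> t)) ` {0..T})"
    by (intro compact_imp_bounded compact_continuous_image continuous_on_subset[OF P_\<gamma>_cont]) auto
  then obtain b where b: "\<And>s. s \<in> {0..T} \<Longrightarrow> norm (P (\<gamma> s)) \<le> b"
    unfolding bounded_iff by blast
  have b0: "b \<ge> 0" using order_trans[OF norm_ge_zero b[of 0]] T(2) by simp
  define k where "k = max 1 (norm B * b)"
  have k: "norm (K s) \<le> k" if "s \<in> {0..T}" for s
  proof -
    have "norm (K s) \<le> norm B * norm (P (\<gamma> s))"
      using norm_matrix_mult_le[of "transpose B" "P (\<gamma> s)"] by (simp add: K_def norm_transpose)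
    also have "\<dots> \<le> norm B * b" by (rule mult_left_mono[OF b[OF that]]) simp
    finally show ?thesis by (simp add: k_def)
  qed
  have k1: "k \<ge> 1" by (simp add: k_def)
  define c1 where "c1 = norm A + \<beta> * k + 2 * norm (L ** C) + 1"
  have c1: "c1 \<ge> 0" using \<beta>_nonneg k1 by (simp add: c1_def)
  define M1 where "M1 = 2 * exp (4 * c1 * T)"
  have M1: "M1 > 0" by (simp add: M1_def)
  define gT where "gT = \<gamma> T"
  have gT: "gT > 0" using \<gamma>_pos T(2) by (simp add: gT_def)
  \<comment> \<open>As \<gamma> is at least \<open>gT\<close> on the start-up interval, this puts
    both barriers, scaled by \<open>\<eta>^2\<close>, above the values that \<open>early\<close>
    permits; the added 1 in each numerator makes the inequalities strict.\<close>
  define k2 where "k2 = (b * M1\<^sup>2 + 1) / gT ^ m + (4 * norm Q * M1\<^sup>2 + 1) / (\<kappa> * gT ^ Suc m)"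
  have s1: "(b * M1\<^sup>2 + 1) / gT ^ m > 0" using b0 gT by (intro divide_pos_pos add_nonneg_pos) auto
  have s2: "(4 * norm Q * M1\<^sup>2 + 1) / (\<kappa> * gT ^ Suc m) > 0"
    using gT \<kappa>(1) by (intro divide_pos_pos add_nonneg_pos mult_pos_pos) auto
  have k2: "k2 > 0" unfolding k2_def using s1 s2 by simp
  have k2V: "b * M1\<^sup>2 < k2 * gT ^ m"
  proof -
    have "b * M1\<^sup>2 + 1 = (b * M1\<^sup>2 + 1) / gT ^ m * gT ^ m" using gT by simp
    also have "\<dots> \<le> k2 * gT ^ m" using s2 gT by (intro mult_right_mono) (auto simp: k2_def)
    finally show ?thesis by simp
  qed
  have k2E: "4 * norm Q * M1\<^sup>2 < \<kappa> * k2 * gT ^ Suc m"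
  proof -
    have "4 * norm Q * M1\<^sup>2 + 1 = (4 * norm Q * M1\<^sup>2 + 1) / (\<kappa> * gT ^ Suc m) * (\<kappa> * gT ^ Suc m)"
      using gT \<kappa>(1) by simp
    also have "\<dots> \<le> k2 * (\<kappa> * gT ^ Suc m)"
      using s1 gT \<kappa>(1) by (intro mult_right_mono) (auto simp: k2_def)
    finally show ?thesis by (simp add: mult_ac)
  qed
  define M2 where "M2 = 2 * sqrt (c * k2) + sqrt (\<kappa> * k2 / q0)"
  have M2: "M2 > 0"
    unfolding M2_def using c_pos k2 \<kappa>(1) q0_pos by (intro add_pos_nonneg) auto
  have early: "norm (x s) \<le> M1 * \<eta>" "norm (\<xi> s) \<le> M1 * \<eta>"
    if tr: "loop_trajectory A q Bi B C L \<tau> r \<gamma> \<gamma>' P D c N Q a q0 u0 x \<xi> \<eta>" and s: "s \<in> {0..T}"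
    for u0 x \<xi> \<eta> s
  proof -
    interpret tj: loop_trajectory A q Bi B C L \<tau> r \<gamma> \<gamma>' P D c N Q a q0 u0 x \<xi> \<eta> by (rule tr)
    have "2 * \<eta> * exp (4 * c1 * s) \<le> M1 * \<eta>"
      using s c1 tj.\<eta>_pos by (simp add: M1_def mult_left_mono)
    then show "norm (x s) \<le> M1 * \<eta>" "norm (\<xi> s) \<le> M1 * \<eta>"
      using tj.finite_time_bound[OF k k1 c1_def s] by simp_all
  qed
  have tail: "norm (x t) + norm (\<xi> t) \<le> M2 * \<eta> * sqrt (\<gamma> t)"
    if tr: "loop_trajectory A q Bi B C L \<tau> r \<gamma> \<gamma>' P D c N Q a q0 u0 x \<xi> \<eta>" and t: "t \<ge> T"
    for u0 x \<xi> \<eta> t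
  proof -
    interpret tj: loop_trajectory A q Bi B C L \<tau> r \<gamma> \<gamma>' P D c N Q a q0 u0 x \<xi> \<eta> by (rule tr)
    have \<eta>2: "\<eta>\<^sup>2 > 0" using tj.\<eta>_pos by simp
    have init: "tj.V s < k2 * \<eta>\<^sup>2 * \<gamma> s ^ m \<and> tj.E s < \<kappa> * (k2 * \<eta>\<^sup>2) * \<gamma> s ^ Suc m"
      if s: "0 \<le> s" "s \<le> T" for s
    proof -
      have xs: "norm (x s) \<le> M1 * \<eta>" and \<xi>s: "norm (\<xi> s) \<le> M1 * \<eta>"
        using early[OF tr, of s] s by auto
      have gs: "gT \<le> \<gamma> s" using \<gamma>_antimono[OF s] by (simp add: gT_def)
      have "tj.V s \<le> norm (P (\<gamma> s)) * (norm (x s))\<^sup>2" unfolding tj.V_def by (rule quadratic_form_le)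
      also have "\<dots> \<le> b * (M1 * \<eta>)\<^sup>2" using b[of s] s xs b0 by (intro mult_mono power_mono) auto
      also have "\<dots> = (b * M1\<^sup>2) * \<eta>\<^sup>2" by (simp add: power_mult_distrib)
      also have "\<dots> < (k2 * gT ^ m) * \<eta>\<^sup>2" by (rule mult_strict_right_mono[OF k2V \<eta>2])
      also have "\<dots> \<le> (k2 * \<gamma> s ^ m) * \<eta>\<^sup>2"
        using gs gT k2 by (intro mult_right_mono mult_left_mono power_mono) auto
      finally have "tj.V s < k2 * \<eta>\<^sup>2 * \<gamma> s ^ m" by (simp add: mult_ac)
      moreover have "norm (tj.e s) \<le> 2 * M1 * \<eta>"
        using norm_triangle_ineq4[of "x s" "\<xi> s"] xs \<xi>s by (simp add: tj.e_def)
      then have "norm Q * (norm (tj.e s))\<^sup>2 \<le> norm Q * (2 * M1 * \<eta>)\<^sup>2"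
        by (intro mult_left_mono power_mono) auto
      then have "tj.E s \<le> (4 * norm Q * M1\<^sup>2) * \<eta>\<^sup>2"
        using quadratic_form_le[of "tj.e s" Q] by (simp add: tj.E_def power_mult_distrib mult_ac)
      then have "tj.E s < (\<kappa> * k2 * gT ^ Suc m) * \<eta>\<^sup>2"
        using mult_strict_right_mono[OF k2E \<eta>2] by linarith
      moreover have "(\<kappa> * k2 * gT ^ Suc m) * \<eta>\<^sup>2 \<le> (\<kappa> * k2 * \<gamma> s ^ Suc m) * \<eta>\<^sup>2"
        using gs gT k2 \<kappa>(1) by (intro mult_right_mono mult_left_mono power_mono) auto
      ultimately show ?thesis by (simp add: mult_ac)
    qed
    have "k2 * \<eta>\<^sup>2 > 0" using k2 \<eta>2 by simp
    from tj.decay_estimate[OF T(1) late ratio p1 p2 p3 \<sigma>_def \<epsilon>1 \<epsilon>2 \<epsilon>3 \<epsilon>4 \<kappa> this init t]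
    have VE: "tj.V t < k2 * \<eta>\<^sup>2 * \<gamma> t ^ m" "tj.E t < \<kappa> * (k2 * \<eta>\<^sup>2) * \<gamma> t ^ Suc m" by auto
    define g where "g = \<gamma> t"
    have g: "0 < g" "g \<le> 1" using \<gamma>_pos[of t] late[of t] t T r_pos by (auto simp: g_def)
    have "g ^ N * (norm (x t))\<^sup>2 \<le> c * tj.V t"
      using P_lower[OF g, of "x t"] by (simp add: tj.V_def g_def power2_norm_eq_inner)
    also have "\<dots> \<le> c * (k2 * \<eta>\<^sup>2 * g ^ m)" using VE(1) c_pos by (simp add: g_def)
    also have "\<dots> = g ^ N * (c * k2 * \<eta>\<^sup>2 * g)" by (simp add: m_def)
    finally have "(norm (x t))\<^sup>2 \<le> c * k2 * \<eta>\<^sup>2 * g"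
      by (rule mult_left_le_imp_le) (use g in simp)
    then have "norm (x t) \<le> sqrt (c * k2 * \<eta>\<^sup>2 * g)" by (rule real_le_rsqrt)
    then have x: "norm (x t) \<le> sqrt (c * k2) * (\<eta> * sqrt g)"
      using tj.\<eta>_pos by (simp add: real_sqrt_mult mult.assoc)
    have "q0 * (norm (tj.e t))\<^sup>2 \<le> tj.E t"
      using Q_lower[of "tj.e t"] by (simp add: tj.E_def power2_norm_eq_inner)
    also have "\<dots> \<le> \<kappa> * (k2 * \<eta>\<^sup>2) * g ^ Suc m" using VE(2) by (simp add: g_def)
    also have "\<dots> \<le> \<kappa> * (k2 * \<eta>\<^sup>2) * g ^ 1"
      using g \<kappa>(1) k2 by (intro mult_left_mono power_decreasing) auto
    finally have "(norm (tj.e t))\<^sup>2 \<le> \<kappa> * k2 / q0 * \<eta>\<^sup>2 * g"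
      using q0_pos by (simp add: field_simps)
    then have "norm (tj.e t) \<le> sqrt (\<kappa> * k2 / q0 * \<eta>\<^sup>2 * g)" by (rule real_le_rsqrt)
    then have e: "norm (tj.e t) \<le> sqrt (\<kappa> * k2 / q0) * (\<eta> * sqrt g)"
      using tj.\<eta>_pos by (simp only: real_sqrt_mult real_sqrt_abs abs_of_pos mult.assoc)
    have "norm (\<xi> t) \<le> norm (x t) + norm (tj.e t)"
      using norm_triangle_ineq4[of "x t" "tj.e t"] by (simp add: tj.e_def)
    then have "norm (x t) + norm (\<xi> t)
        \<le> 2 * (sqrt (c * k2) * (\<eta> * sqrt g)) + sqrt (\<kappa> * k2 / q0) * (\<eta> * sqrt g)"
      using x e by linarith
    also have "\<dots> = M2 * \<eta> * sqrt g" unfolding M2_def by (simp only: distrib_right mult.assoc)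
    finally show ?thesis by (simp add: g_def)
  qed
  define M where "M = 2 * M1 + M2"
  show ?thesis
  proof (rule that[of M T])
    show "M > 0" using M1 M2 by (simp add: M_def)
    show "T \<ge> 0" by (rule T(2))
  next
    fix u0 x \<xi> \<eta> t
    assume tr: "loop_trajectory A q Bi B C L \<tau> r \<gamma> \<gamma>' P D c N Q a q0 u0 x \<xi> \<eta>"
    then have \<eta>: "\<eta> > 0" by (rule loop_trajectory.\<eta>_pos)
    have le: "M2 * \<eta> * sqrt (\<gamma> t) \<le> M * \<eta> * sqrt (\<gamma> t)" if "t \<ge> 0"
      using \<eta> M1 \<gamma>_pos[OF that] by (intro mult_right_mono) (auto simp: M_def)
    show "norm (x t) + norm (\<xi> t) \<le> M * \<eta> * sqrt (\<gamma> t)" if "T \<le> t"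
      using tail[OF tr that] le that T(2) by simp
    show "norm (x t) + norm (\<xi> t) \<le> M * \<eta>" if "0 \<le> t"
    proof (cases "t \<le> T")
      case True
      have "norm (x t) + norm (\<xi> t) \<le> 2 * M1 * \<eta>" using early[OF tr, of t] that True by simp
      also have "\<dots> \<le> M * \<eta>" using M2 \<eta> by (intro mult_right_mono) (auto simp: M_def)
      finally show ?thesis .
    next
      case False
      then have "\<gamma> t \<le> 1" using late[of t] r_pos by simp
      then have "M2 * \<eta> * sqrt (\<gamma> t) \<le> M2 * \<eta> * 1" using M2 \<eta> by (intro mult_left_mono) auto
      also have "\<dots> \<le> M * \<eta>" using M1 \<eta> by (simp add: M_def)
      finally show ?thesis using tail[OF tr, of t] False by simp
    qed
  qed
qed

lemma asymptotically_stable_loop: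
  "asymptotically_stable r (closed_loop_solution A q Bi C L \<tau> (\<lambda>t. - (transpose B ** P (\<gamma> t))))"
proof -
  obtain M T where M: "M > 0" and T: "T \<ge> 0" and
    bound: "\<And>u0 x \<xi> \<eta> t. loop_trajectory A q Bi B C L \<tau> r \<gamma> \<gamma>' P D c N Q a q0 u0 x \<xi> \<eta> \<Longrightarrow> 0 \<le> t \<Longrightarrow>
       norm (x t) + norm (\<xi> t) \<le> M * \<eta>" and
    tail: "\<And>u0 x \<xi> \<eta> t. loop_trajectory A q Bi B C L \<tau> r \<gamma> \<gamma>' P D c N Q a q0 u0 x \<xi> \<eta> \<Longrightarrow> T \<le> t \<Longrightarrow>
       norm (x t) + norm (\<xi> t) \<le> M * \<eta> * sqrt (\<gamma> t)"
    using uniform_estimate by blast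
  have K_eq: "(\<lambda>t. - (transpose B ** P (\<gamma> t))) = K" by (simp add: K_def fun_eq_iff)
  have trajectory: "loop_trajectory A q Bi B C L \<tau> r \<gamma> \<gamma>' P D c N Q a q0 u0 x \<xi> \<eta>"
    if "admissible_history r u0" and "closed_loop_solution A q Bi C L \<tau> K u0 x \<xi>"
      and "norm (x 0) + norm (\<xi> 0) + (SUP \<theta>\<in>{-r..<0}. norm (u0 \<theta>)) \<le> \<eta>" and "\<eta> > 0"
    for u0 x \<xi> \<eta>
  proof -
    have "bdd_above ((\<lambda>\<theta>. norm (u0 \<theta>)) ` {-r..<0})"
      using that(1) by (auto simp: admissible_history_def bounded_iff bdd_above_def)
    then have sup: "norm (u0 \<theta>) \<le> (SUP \<theta>\<in>{-r..<0}. norm (u0 \<theta>))" if "-r \<le> \<theta>" "\<theta> < 0" for \<theta>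
      using that by (intro cSUP_upper) auto
    have "(SUP \<theta>\<in>{-r..<0}. norm (u0 \<theta>)) \<ge> 0"
      using sup[of "-r"] r_pos norm_ge_zero[of "u0 (-r)"] by linarith
    then have init: "norm (x 0) \<le> \<eta>" "norm (\<xi> 0) \<le> \<eta>"
      using that(3) norm_ge_zero[of "x 0"] norm_ge_zero[of "\<xi> 0"] by linarith+
    have "norm (u0 \<theta>) \<le> \<eta>" if "-r \<le> \<theta>" "\<theta> < 0" for \<theta>
      using sup[OF that] \<open>norm (x 0) + norm (\<xi> 0) + _ \<le> \<eta>\<close>
        norm_ge_zero[of "x 0"] norm_ge_zero[of "\<xi> 0"] by linarith
    with that(2,4) init show ?thesis by unfold_locales auto
  qed
  show ?thesis
    unfolding asymptotically_stable_def K_eq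
  proof (intro conjI allI impI)
    fix \<epsilon> :: real assume \<epsilon>: "\<epsilon> > 0"
    have "norm (x t) + norm (\<xi> t) \<le> \<epsilon>"
      if "admissible_history r u0" "closed_loop_solution A q Bi C L \<tau> K u0 x \<xi>"
        "norm (x 0) + norm (\<xi> 0) + (SUP \<theta>\<in>{-r..<0}. norm (u0 \<theta>)) \<le> \<epsilon> / M" "t \<ge> 0" for u0 x \<xi> t
      using bound[OF trajectory[OF that(1-3)] that(4)] M \<epsilon> by simp
    then show "\<exists>\<delta>>0. \<forall>u0 x \<xi>. admissible_history r u0 \<longrightarrow> closed_loop_solution A q Bi C L \<tau> K u0 x \<xi> \<longrightarrow>
        norm (x 0) + norm (\<xi> 0) + (SUP \<theta>\<in>{-r..<0}. norm (u0 \<theta>)) \<le> \<delta> \<longrightarrow>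
        (\<forall>t\<ge>0. norm (x t) + norm (\<xi> t) \<le> \<epsilon>)"
      using M \<epsilon> by (intro exI[of _ "\<epsilon> / M"]) auto
  next
    fix u0 x \<xi>
    assume sol: "admissible_history r u0" "closed_loop_solution A q Bi C L \<tau> K u0 x \<xi>"
    define S where "S = norm (x 0) + norm (\<xi> 0) + (SUP \<theta>\<in>{-r..<0}. norm (u0 \<theta>))"
    \<comment> \<open>The locale asks for a positive bound, and the data may vanish; any finite
      bound is enough for attractivity.\<close>
    define \<eta> where "\<eta> = max S 1"
    have tr: "loop_trajectory A q Bi B C L \<tau> r \<gamma> \<gamma>' P D c N Q a q0 u0 x \<xi> \<eta>"
      by (rule trajectory[OF sol]) (auto simp: \<eta>_def S_def)
    have "((\<lambda>t. M * \<eta> * sqrt (\<gamma> t)) \<longlongrightarrow> M * \<eta> * sqrt 0) at_top"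
      by (intro tendsto_intros \<gamma>_lim)
    then have lim: "((\<lambda>t. M * \<eta> * sqrt (\<gamma> t)) \<longlongrightarrow> 0) at_top" by simp
    show "((\<lambda>t. norm (x t) + norm (\<xi> t)) \<longlongrightarrow> 0) at_top"
    proof (rule tendsto_sandwich[OF _ _ tendsto_const lim])
      show "eventually (\<lambda>t. 0 \<le> norm (x t) + norm (\<xi> t)) at_top" by simp
      show "eventually (\<lambda>t. norm (x t) + norm (\<xi> t) \<le> M * \<eta> * sqrt (\<gamma> t)) at_top"
        using eventually_ge_at_top[of T] by eventually_elim (rule tail[OF tr])
    qed
  qed
qed

end

theorem theorem2:
  fixes A :: "real^'n^'n" and q :: nat and Bi :: "nat \<Rightarrow> real^'m^'n" and B :: "real^'m^'n"
    and C :: "real^'n^'p" and L :: "real^'p^'n"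
    and \<tau> \<tau>' :: "nat \<Rightarrow> real \<Rightarrow> real" and \<tau>bar d \<gamma>0 \<omega> \<mu> :: real
    and \<gamma> :: "real \<Rightarrow> real" and P :: "real \<Rightarrow> real^'n^'n"
  assumes "B = (\<Sum>i=1..q. Bi i)"
    and "controllable A B"
    and "\<And>l. eigenvalue_of A l \<Longrightarrow> l = 0"
    and "\<tau>bar > 0" and "0 \<le> d" and "d < 1"
    and "\<And>i t. i \<in> {1..q} \<Longrightarrow> t \<ge> 0 \<Longrightarrow> 0 \<le> \<tau> i t \<and> \<tau> i t \<le> \<tau>bar"
    and "\<And>i t. i \<in> {1..q} \<Longrightarrow> t \<ge> 0 \<Longrightarrow>
           (\<tau> i has_real_derivative \<tau>' i t) (at t within {0..}) \<and> \<tau>' i t \<le> d"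
    and "observable A C"
    and "hurwitz (A - L ** C)"
    and "\<gamma>0 > 0" and "\<omega> > 0" and "0 < \<mu>" and "\<mu> < 1"
    and "\<And>t. t \<ge> 0 \<Longrightarrow> \<gamma> t = \<gamma>0 / (\<omega> * t + 1) powr \<mu>"
    and "\<And>g. g > 0 \<Longrightarrow> parametric_lyapunov_solution A B g (P g)"
  shows "asymptotically_stable \<tau>bar
           (closed_loop_solution A q Bi C L \<tau> (\<lambda>t. - (transpose B ** P (\<gamma> t))))"
proof -
  note \<gamma>0 = \<open>\<gamma>0 > 0\<close> and \<omega> = \<open>\<omega> > 0\<close> and \<mu> = \<open>0 < \<mu>\<close> \<open>\<mu> < 1\<close> and r = \<open>\<tau>bar > 0\<close>
  note \<gamma>_eq = \<open>\<And>t. t \<ge> 0 \<Longrightarrow> \<gamma> t = \<gamma>0 / (\<omega> * t + 1) powr \<mu>\<close>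
  note delays = \<open>\<And>i t. i \<in> {1..q} \<Longrightarrow> t \<ge> 0 \<Longrightarrow>
    (\<tau> i has_real_derivative \<tau>' i t) (at t within {0..}) \<and> \<tau>' i t \<le> d\<close>
  define \<gamma>' where "\<gamma>' t = - \<mu> * \<omega> * \<gamma>0 * (\<omega> * t + 1) powr (- \<mu> - 1)" for t
  obtain c N D where family: "c > 0"
    "\<And>g v. g > 0 \<Longrightarrow> (norm (transpose B *v (P g *v v)))\<^sup>2 \<le> c * g * (v \<bullet> (P g *v v))"
    "\<And>g v. g > 0 \<Longrightarrow> (A *v v) \<bullet> (P g *v (A *v v)) \<le> c * g\<^sup>2 * (v \<bullet> (P g *v v))"
    "\<And>g. g > 0 \<Longrightarrow> (P has_vector_derivative D g) (at g)"
    "\<And>g v. g > 0 \<Longrightarrow> \<bar>v \<bullet> (D g *v v)\<bar> \<le> c / g * (v \<bullet> (P g *v v))"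
    "\<And>g v. g > 0 \<Longrightarrow> (norm (transpose B *v (D g *v v)))\<^sup>2 \<le> c / g * (v \<bullet> (P g *v v))"
    "\<And>g v. 0 < g \<Longrightarrow> g \<le> 1 \<Longrightarrow> g ^ N * (v \<bullet> v) \<le> c * (v \<bullet> (P g *v v))"
    "(P \<longlongrightarrow> 0) (at_right 0)"
    by (rule parametric_lyapunov_family[OF assms(2)])
      (erule assms(3), erule assms(16), (rule that; assumption))
  obtain Q a where Q: "positive_definite Q" "a > 0"
    "\<And>v. 2 * (v \<bullet> (Q *v ((A - L ** C) *v v))) \<le> - a * (v \<bullet> (Q *v v))"
    using hurwitz_lyapunov[OF assms(10)] by blast
  obtain q0 where q0: "q0 > 0" "\<And>v. q0 * (v \<bullet> v) \<le> v \<bullet> (Q *v v)"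
    using positive_definite_lower_bound[OF Q(1)] by blast
  have \<gamma>_ev: "eventually (\<lambda>t. \<gamma> t = \<gamma>0 / (\<omega> * t + 1) powr \<mu>) at_top"
    using eventually_ge_at_top[of 0] by eventually_elim (rule \<gamma>_eq)
  have \<gamma>_ev': "eventually (\<lambda>t. \<gamma> (t - \<tau>bar) = \<gamma>0 / (\<omega> * (t - \<tau>bar) + 1) powr \<mu>) at_top"
    using eventually_ge_at_top[of \<tau>bar] by eventually_elim (rule \<gamma>_eq, simp)
  have base: "\<omega> * t + 1 > 0" if "t \<ge> 0" for t using that \<omega> by (simp add: add_nonneg_pos)
  interpret delayed_loop A q Bi B C L \<tau> \<tau>bar \<gamma> \<gamma>' P D c N Q a q0
  proof
    show "continuous_on {0..} (\<tau> i)" if "i \<in> {1..q}" for i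
      unfolding continuous_on_eq_continuous_within using delays[OF that] DERIV_continuous by fastforce
    show "\<gamma> t > 0" if "t \<ge> 0" for t using \<gamma>_eq[OF that] base[OF that] \<gamma>0 by simp
    show "(\<gamma> has_real_derivative \<gamma>' t) (at t within {0..})" if t: "t \<ge> 0" for t
    proof (rule has_field_derivative_transform_within[of _ _ _ _ 1])
      have "((\<lambda>t. \<gamma>0 * (\<omega> * t + 1) powr (- \<mu>)) has_real_derivative \<gamma>' t) (at t within {0..})"
        using base[OF t] by (auto intro!: derivative_eq_intros simp: \<gamma>'_def powr_diff)
      then show "((\<lambda>t. \<gamma>0 / (\<omega> * t + 1) powr \<mu>) has_real_derivative \<gamma>' t) (at t within {0..})"
        by (simp add: powr_minus divide_inverse)
    qed (use t \<gamma>_eq in auto)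
    show "\<gamma> t \<le> \<gamma> s" if "0 \<le> s" "s \<le> t" for s t
      using that \<gamma>_eq[of s] \<gamma>_eq[of t] base[of s] base[of t] \<gamma>0 \<omega> \<mu>
      by (simp add: divide_left_mono powr_mono2)
    have "((\<lambda>t. \<gamma>0 / (\<omega> * t + 1) powr \<mu>) \<longlongrightarrow> 0) at_top"
      using \<gamma>0 \<omega> \<mu> by real_asymp
    then show "(\<gamma> \<longlongrightarrow> 0) at_top" using tendsto_cong[OF \<gamma>_ev] by simp
    \<comment> \<open>The quotient equals \<open>- (\<mu> * \<omega> / \<gamma>0) * (\<omega> * t +
      1) powr (\<mu> - 1)\<close>, which tends to zero because \<open>\<mu> < 1\<close>.\<close>
    have "((\<lambda>t. - \<mu> * \<omega> * \<gamma>0 * (\<omega> * t + 1) powr (- \<mu> - 1) / (\<gamma>0 / (\<omega> * t + 1) powr \<mu>)\<^sup>2) \<longlongrightarrow> 0) at_top"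
      using \<gamma>0 \<omega> \<mu> by real_asymp
    moreover have "eventually (\<lambda>t. \<gamma>' t / (\<gamma> t)\<^sup>2
        = - \<mu> * \<omega> * \<gamma>0 * (\<omega> * t + 1) powr (- \<mu> - 1) / (\<gamma>0 / (\<omega> * t + 1) powr \<mu>)\<^sup>2) at_top"
      using \<gamma>_ev by eventually_elim (simp add: \<gamma>'_def)
    ultimately show "((\<lambda>t. \<gamma>' t / (\<gamma> t)\<^sup>2) \<longlongrightarrow> 0) at_top" using tendsto_cong by fast
    have "((\<lambda>t. (\<gamma>0 / (\<omega> * (t - \<tau>bar) + 1) powr \<mu>) / (\<gamma>0 / (\<omega> * t + 1) powr \<mu>)) \<longlongrightarrow> 1) at_top"
      using \<gamma>0 \<omega> \<mu> r by real_asymp (simp add: field_simps)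
    moreover have "eventually (\<lambda>t. \<gamma> (t - \<tau>bar) / \<gamma> t
        = (\<gamma>0 / (\<omega> * (t - \<tau>bar) + 1) powr \<mu>) / (\<gamma>0 / (\<omega> * t + 1) powr \<mu>)) at_top"
      using \<gamma>_ev \<gamma>_ev' by eventually_elim simp
    ultimately show "((\<lambda>t. \<gamma> (t - \<tau>bar) / \<gamma> t) \<longlongrightarrow> 1) at_top" using tendsto_cong by fast
    show "transpose Q = Q" using Q(1) by (simp add: positive_definite_def)
  qed (fact assms(1) r assms(7,16) family Q q0)+
  show ?thesis by (rule asymptotically_stable_loop)
qed

end
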